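(* Let $d \ge 1$ and let $L, M \subseteq \mathbb{R}^d$ be lattices of the same volume. Then there is a bounded Lebesgue measurable set $\Omega \subseteq \mathbb{R}^d$ which tiles $\mathbb{R}^d$ with both $L$ and $M$, i.e. $$\sum_{\ell \in L} \mathbf{1}_\Omega(x-\ell) = 1 \quad\text{and}\quad \sum_{m \in M} \mathbf{1}_\Omega(x-m) = 1 \quad \text{for almost all } x \in \mathbb{R}^d.$$
   Context: A lattice in $\mathbb{R}^d$ is a discrete subgroup of $\mathbb{R}^d$ which linearly spans $\mathbb{R}^d$; equivalently, a set $A\mathbb{Z}^d$ with $A$ a non-singular real $d\times d$ matrix. The volume of the lattice $A\mathbb{Z}^d$ is $|\det A|$ (the Lebesgue measure of any measurable fundamental domain). $\mathbf{1}_\Omega$ denotes the indicator function of $\Omega$. "Almost all" is with respect to Lebesgue measure. *)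

theory Defs
  imports "HOL-Analysis.Analysis"
begin

definition euclidean_lattice :: "(real ^ 'n) set \<Rightarrow> bool" where
  "euclidean_lattice L \<longleftrightarrow>
     0 \<in> L \<and> (\<forall>x\<in>L. \<forall>y\<in>L. x + y \<in> L) \<and> (\<forall>x\<in>L. - x \<in> L) \<and>
     discrete L \<and> span L = UNIV"

definition int_vectors :: "(real ^ 'n) set" where
  "int_vectors = {x. \<forall>i. x $ i \<in> \<int>}"

definition matrix_lattice :: "real ^ 'n ^ 'n \<Rightarrow> (real ^ 'n) set" where
  "matrix_lattice A = (*v) A ` int_vectors"

text \<open>Independence of the generating matrix is lemma \<open>lattice_volume_matrix_lattice\<close> below.\<close>

definition lattice_volume :: "(real ^ 'n) set \<Rightarrow> real" where
  "lattice_volume L =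
     (THE v. \<exists>A :: real ^ 'n ^ 'n. det A \<noteq> 0 \<and> L = matrix_lattice A \<and> v = \<bar>det A\<bar>)"

definition tiles_with :: "(real ^ 'n) set \<Rightarrow> (real ^ 'n) set \<Rightarrow> bool" where
  "tiles_with \<Omega> L \<longleftrightarrow>
     (AE x in lebesgue. ((\<lambda>l. indicat_real \<Omega> (x - l)) has_sum 1) L)"

lemma matrix_lattice_subset_imp_factor:
  fixes A B :: "real ^ 'n ^ 'n"
  assumes "matrix_lattice A \<subseteq> matrix_lattice B"
  obtains C :: "real ^ 'n ^ 'n" where "A = B ** C" and "det C \<in> \<int>"
proof -
  have "\<exists>c. c \<in> int_vectors \<and> column j A = B *v c" for j
  proof -
    have "axis j 1 \<in> (int_vectors :: (real ^ 'n) set)"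
      by (auto simp: int_vectors_def axis_def)
    then have "A *v axis j 1 \<in> matrix_lattice A"
      by (auto simp: matrix_lattice_def)
    then show ?thesis
      using assms unfolding matrix_vector_mult_basis by (auto simp: matrix_lattice_def)
  qed
  then obtain c where c: "\<And>j. c j \<in> int_vectors" "\<And>j. column j A = B *v c j"
    by metis
  define C :: "real ^ 'n ^ 'n" where "C = (\<chi> i j. c j $ i)"
  have "A = B ** C"
    using c(2) by (simp add: C_def vec_eq_iff matrix_matrix_mult_def
        matrix_vector_mult_def column_def)
  moreover have "det C \<in> \<int>"
    using c(1) unfolding det_def
    by (intro Ints_sum Ints_mult Ints_prod) (auto simp: C_def int_vectors_def)
  ultimately show thesis using that by blast
qed

lemma matrix_lattice_eq_imp_abs_det_eq:
  fixes A B :: "real ^ 'n ^ 'n"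
  assumes "matrix_lattice A = matrix_lattice B"
  shows "\<bar>det A\<bar> = \<bar>det B\<bar>"
proof -
  have le: "\<bar>det X\<bar> \<le> \<bar>det Y\<bar>"
    if eq: "matrix_lattice X = matrix_lattice Y" for X Y :: "real ^ 'n ^ 'n"
  proof -
    obtain C where C: "Y = X ** C" "det C \<in> \<int>"
      using eq matrix_lattice_subset_imp_factor[of Y X] by blast
    obtain D where D: "X = Y ** D" "det D \<in> \<int>"
      using eq matrix_lattice_subset_imp_factor[of X Y] by blast
    have Y: "det Y = det X * det C" using C(1) det_mul by metis
    have X: "det X = det Y * det D" using D(1) det_mul by metis
    show ?thesis
    proof (cases "det C = 0")
      case True
      then show ?thesis using X Y by simp
    next
      case False
      then have "1 \<le> \<bar>det C\<bar>" using C(2) Ints_nonzero_abs_ge1 by blast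
      then show ?thesis using mult_left_mono[of 1 "\<bar>det C\<bar>" "\<bar>det X\<bar>"] Y
        by (simp add: abs_mult)
    qed
  qed
  show ?thesis using le[of A B] le[of B A] assms by simp
qed

lemma lattice_volume_matrix_lattice:
  fixes A :: "real ^ 'n ^ 'n"
  assumes "det A \<noteq> 0"
  shows "lattice_volume (matrix_lattice A) = \<bar>det A\<bar>"
  unfolding lattice_volume_def
  by (rule the_equality) (use assms matrix_lattice_eq_imp_abs_det_eq in blast)+

end

theory Submission
  imports Defs
begin

text \<open>
  Fix fundamental parallelepipeds D of L and E of M. It suffices to cut D into finitely many
  measurable pieces and to translate them by vectors of L + M so that they form E: splitting each
  translation vector as l + m and translating the corresponding piece by l alone yields the common tile.

  Let T be the subgroup of those m in M that have a positive multiple in L. Then H = L + T is a lattice,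
  and M has a basis whose vectors with index outside a suitable set I span T
  and whose vectors e(i) with i in I generate a group acting freely on the torus modulo H.
  On this torus, let c and p count the points of D and E in the H-orbit of x. The convolution of the
  indicators of D and E, divided by their common volume, has constant periodization 1 with respect to
  both lattices; comparing both indicators with it exhibits p - c as the divergence of a bounded real
  flow along the e(i). For |I| at most 1 this flow is rounded directly. For |I| at least 2, a mass transport
  to ever sparser marker sets makes the flow integral in all but two directions, and in the
  remaining two directions it is rounded along a sequence of Rokhlin towers. A bounded integral flow gives
  the pieces: partition each orbit into large cubes; a cube has more points than units of flow
  through its boundary, so the units can be exchanged between neighbouring cubes.
\<close>


section \<open>Bounded equidecomposition\<close>

text \<open>Rounding a flow from a base point in each orbit would need a non-measurable choice;
  measurable choices are available on finite pieces of orbits, up to sets of small measure. The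
  plane makes this enough, for two reasons. Markers of spacing n have density of order n^-2 while
  transport paths have length of order n, so the set crossed by mass at spacing 2^k has measure of
  order 2^-k, and by Borel-Cantelli almost every point sees finitely many steps; in one direction
  the same count gives no decay. Moreover, a plane flow with integral divergence is, turned by a
  right angle, a closed form modulo 1. On finite pieces it has a potential modulo 1, and the rotated
  gradient of a real lift corrects the flow to an integral one of the same divergence. The lifts
  must keep bounded increments through all levels, since boundedness of the flow is what leaves
  finitely many pieces at the end. The fluxes of the mass transport are unbounded, but only their
  fractional parts enter the corrected flow. Markers exist because the group acts freely modulo H,
  which is why the torsion part T is absorbed into H.\<close>

lemma measurable_count_space_compose2:
  fixes f :: "'a \<Rightarrow> 'b::countable" and g :: "'a \<Rightarrow> 'c::countable"
  assumes "f \<in> measurable M (count_space UNIV)" "g \<in> measurable M (count_space UNIV)"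
  shows "(\<lambda>x. h (f x) (g x)) \<in> measurable M (count_space UNIV)"
proof -
  have "(\<lambda>x. h i (g x)) \<in> measurable M (count_space UNIV)" for i
    by (rule measurable_compose[OF assms(2)]) simp
  then show ?thesis
    by (rule measurable_compose_countable[OF _ assms(1)])
qed

lemma measurable_sum_count_space:
  fixes f :: "'i \<Rightarrow> 'a \<Rightarrow> 'b::{countable, comm_monoid_add}"
  assumes "\<And>i. i \<in> S \<Longrightarrow> f i \<in> measurable M (count_space UNIV)"
  shows "(\<lambda>x. \<Sum>i\<in>S. f i x) \<in> measurable M (count_space UNIV)"
proof (cases "finite S")
  case True
  then show ?thesis using assms
  proof (induction S)
    case empty then show ?case by simp
  next
    case (insert i S)
    then show ?case
      using measurable_count_space_compose2[of "f i" M "\<lambda>x. \<Sum>i\<in>S. f i x" "(+)"] by simp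
  qed
qed simp

section \<open>Common refinement of two interval partitions\<close>

lemma interval_refinement_sum:
  fixes b :: "nat \<Rightarrow> nat"
  assumes "A \<le> B" "B \<le> (\<Sum>j<n. b j)"
  shows "(\<Sum>j<n. card ({A..<B} \<inter> {\<Sum>k<j. b k..<\<Sum>k<Suc j. b k})) = B - A"
  using assms
proof (induction n arbitrary: A B)
  case 0 then show ?case by simp
next
  case (Suc n)
  define s where "s = (\<Sum>k<n. b k)"
  have *: "card ({A..<B} \<inter> X) = card ({A..<min B s} \<inter> X)" if "X \<subseteq> {..<s}" for X
    by (rule arg_cong[where f=card]) (use that in auto)
  have sub: "{\<Sum>k<j. b k..<\<Sum>k<Suc j. b k} \<subseteq> {..<s}" if "j < n" for j
  proof -
    have "(\<Sum>k<Suc j. b k) \<le> s"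
      unfolding s_def by (rule sum_mono2) (use that in auto)
    then show ?thesis by auto
  qed
  have "(\<Sum>j<n. card ({A..<B} \<inter> {\<Sum>k<j. b k..<\<Sum>k<Suc j. b k}))
      = (\<Sum>j<n. card ({A..<min B s} \<inter> {\<Sum>k<j. b k..<\<Sum>k<Suc j. b k}))"
    by (intro sum.cong refl *) (rule sub, simp)
  also have "\<dots> = min B s - A"
  proof (cases "A \<le> min B s")
    case True then show ?thesis using Suc.IH[of A "min B s"] by (simp add: s_def)
  next
    case False
    then have e: "{A..<min B s} = {}" by auto
    from False have "min B s \<le> A" by linarith
    then show ?thesis unfolding e by simp
  qed
  finally have 1: "(\<Sum>j<n. card ({A..<B} \<inter> {\<Sum>k<j. b k..<\<Sum>k<Suc j. b k})) = min B s - A" .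
  have "{A..<B} \<inter> {s..<s + b n} = {max A s..<B}"
    using Suc.prems by (auto simp: s_def)
  then have 2: "card ({A..<B} \<inter> {s..<s + b n}) = B - max A s" by simp
  show ?case using 1 2 Suc.prems(1) by (simp add: s_def max_def min_def split: if_splits)
qed

text \<open>The transport matrix of the north-west corner rule: overlaps of two partitions of an
  interval into consecutive blocks of lengths \<open>a k\<close> and \<open>b k\<close>. Being given
  by a formula, it depends measurably on the data.\<close>

definition refinement :: "(nat \<Rightarrow> nat) \<Rightarrow> (nat \<Rightarrow> nat) \<Rightarrow> nat \<Rightarrow> nat \<Rightarrow> nat" where
  "refinement a b i j =
     card ({\<Sum>k<i. a k..<\<Sum>k<Suc i. a k} \<inter> {\<Sum>k<j. b k..<\<Sum>k<Suc j. b k})"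

lemma refinement_swap: "refinement a b i j = refinement b a j i"
  by (simp add: refinement_def Int_commute)

lemma refinement_sum:
  assumes "(\<Sum>i<m. a i) = (\<Sum>j<n. b j)" "i < m"
  shows "(\<Sum>j<n. refinement a b i j) = a i"
proof -
  have "(\<Sum>k<Suc i. a k) \<le> (\<Sum>k<m. a k)"
    by (rule sum_mono2) (use assms(2) in auto)
  then show ?thesis
    unfolding refinement_def using assms(1) by (subst interval_refinement_sum) auto
qed

lemma refinement_measurable:
  assumes "\<And>i. i < m \<Longrightarrow> a i \<in> measurable M (count_space UNIV)"
    and "\<And>j. j < n \<Longrightarrow> b j \<in> measurable M (count_space UNIV)" "i < m" "j < n"
  shows "(\<lambda>x. refinement (\<lambda>k. a k x) (\<lambda>k. b k x) i j) \<in> measurable M (count_space UNIV)"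
proof -
  have ps: "(\<lambda>x. ((\<Sum>k<t. f k x), (\<Sum>k<Suc t. f k x))) \<in> measurable M (count_space UNIV)"
    if "\<And>i. i < m \<Longrightarrow> f i \<in> measurable M (count_space UNIV)" "t < m"
    for f :: "nat \<Rightarrow> 'a \<Rightarrow> nat" and t m
    using that by (intro measurable_count_space_compose2[where h = Pair] measurable_sum_count_space) auto
  show ?thesis
    using measurable_count_space_compose2[OF ps[of m a i] ps[of n b j],
        where h = "\<lambda>p q. card ({fst p..<snd p} \<inter> {fst q..<snd q})"] assms
    by (simp add: refinement_def)
qed

section \<open>Equidecomposition of integer-valued densities\<close>

text \<open>The sigma-algebra is left open because Lebesgue measure and a measure living on periodic
  sets only are both instances.\<close>

locale translation_invariant =
  fixes N :: "'a::real_vector measure"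
  assumes space_eq [simp]: "space N = UNIV"
    and shift_measurable [measurable]: "(\<lambda>x. x + v) \<in> measurable N N"
    and emeasure_shift: "A \<in> sets N \<Longrightarrow> emeasure N ((\<lambda>x. x + v) -` A) = emeasure N A"
begin

lemma shift_minus_measurable [measurable]: "(\<lambda>x. x - v) \<in> measurable N N"
  using shift_measurable[of "- v"] by simp

lemma shift_sets: "A \<in> sets N \<Longrightarrow> {x. x + v \<in> A} \<in> sets N"
  using measurable_sets[OF shift_measurable[of v], of A] by (simp add: vimage_def)

lemma shift_minus_sets: "A \<in> sets N \<Longrightarrow> {x. x - v \<in> A} \<in> sets N"
  using shift_sets[of A "- v"] by simp

lemma AE_shift:
  assumes "AE x in N. P x"
  shows "AE x in N. P (x + v)"
proof -
  obtain Z where Z: "{x. \<not> P x} \<subseteq> Z" "emeasure N Z = 0" "Z \<in> sets N"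
    using assms by (auto elim: AE_E)
  have "(\<lambda>x. x + v) -` Z \<in> null_sets N"
    using shift_sets[OF Z(3), of v] emeasure_shift[OF Z(3), of v] Z(2)
    by (auto simp: vimage_def)
  then show ?thesis by (rule AE_I') (use Z(1) in auto)
qed

lemma AE_shift_minus: "AE x in N. P x \<Longrightarrow> AE x in N. P (x - v)"
  using AE_shift[of P "- v"] by simp

text \<open>Densities with values in \<open>nat\<close> replace sets, so that a point may carry
  several units; \<open>u v x\<close> is the number of units that travel from \<open>x\<close> to
  \<open>x + v\<close>. Finiteness of \<open>V\<close> is what later makes the tile bounded.\<close>

definition equid :: "'a set \<Rightarrow> ('a \<Rightarrow> nat) \<Rightarrow> ('a \<Rightarrow> nat) \<Rightarrow> bool" where
  "equid H c d \<longleftrightarrow> (\<exists>V u. finite V \<and> V \<subseteq> H \<and>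
     (\<forall>v\<in>V. u v \<in> measurable N (count_space UNIV)) \<and>
     (AE x in N. c x = (\<Sum>v\<in>V. u v x)) \<and> (AE x in N. d x = (\<Sum>v\<in>V. u v (x - v))))"

text \<open>Several indices may share a translation vector; their pieces are added up.\<close>

lemma equidI:
  assumes "finite J" "g ` J \<subseteq> H" "\<And>j. j \<in> J \<Longrightarrow> u j \<in> measurable N (count_space UNIV)"
    and c: "AE x in N. c x = (\<Sum>j\<in>J. u j x)" and d: "AE x in N. d x = (\<Sum>j\<in>J. u j (x - g j))"
  shows "equid H c d"
proof -
  let ?u = "\<lambda>v x. \<Sum>j | j \<in> J \<and> g j = v. u j x"
  have "(\<Sum>v\<in>g ` J. ?u v x) = (\<Sum>j\<in>J. u j x)" for x
    using sum.image_gen[OF assms(1), of "\<lambda>j. u j x" g] by simp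
  moreover have "(\<Sum>v\<in>g ` J. ?u v (x - v)) = (\<Sum>j\<in>J. u j (x - g j))" for x
  proof -
    have "(\<Sum>v\<in>g ` J. ?u v (x - v)) = (\<Sum>v\<in>g ` J. \<Sum>j | j \<in> J \<and> g j = v. u j (x - g j))"
      by (intro sum.cong) auto
    then show ?thesis using sum.image_gen[OF assms(1), of "\<lambda>j. u j (x - g j)" g] by simp
  qed
  ultimately show ?thesis
    unfolding equid_def using assms(1,2) c d
    by (intro exI[of _ "g ` J"] exI[of _ ?u] conjI ballI measurable_sum_count_space assms(3)) auto
qed

lemma equid_cong_AE:
  assumes "equid H c d" "AE x in N. c x = c' x" "AE x in N. d x = d' x"
  shows "equid H c' d'"
proof -
  obtain V u where V: "finite V" "V \<subseteq> H" "\<forall>v\<in>V. u v \<in> measurable N (count_space UNIV)"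
    "AE x in N. c x = (\<Sum>v\<in>V. u v x)" "AE x in N. d x = (\<Sum>v\<in>V. u v (x - v))"
    using assms(1) unfolding equid_def by blast
  have "AE x in N. c' x = (\<Sum>v\<in>V. u v x)" "AE x in N. d' x = (\<Sum>v\<in>V. u v (x - v))"
    by (use V(4) assms(2) in eventually_elim, simp) (use V(5) assms(3) in eventually_elim, simp)
  then show ?thesis unfolding equid_def using V by blast
qed

lemma equid_shift:
  "\<lbrakk>c \<in> measurable N (count_space UNIV); v \<in> H\<rbrakk> \<Longrightarrow> equid H c (\<lambda>x. c (x - v))"
  by (rule equidI[of "{()}" "\<lambda>_. v" H "\<lambda>_. c"]) auto

lemma equid_refl:
  "\<lbrakk>c \<in> measurable N (count_space UNIV); 0 \<in> H\<rbrakk> \<Longrightarrow> equid H c c"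
  using equid_shift[of c 0 H] by simp

lemma equid_add:
  assumes "equid H c d" "equid H c' d'"
  shows "equid H (\<lambda>x. c x + c' x) (\<lambda>x. d x + d' x)"
proof -
  obtain V u where V: "finite V" "V \<subseteq> H" "\<forall>v\<in>V. u v \<in> measurable N (count_space UNIV)"
    "AE x in N. c x = (\<Sum>v\<in>V. u v x)" "AE x in N. d x = (\<Sum>v\<in>V. u v (x - v))"
    using assms(1) unfolding equid_def by blast
  obtain W w where W: "finite W" "W \<subseteq> H" "\<forall>v\<in>W. w v \<in> measurable N (count_space UNIV)"
    "AE x in N. c' x = (\<Sum>v\<in>W. w v x)" "AE x in N. d' x = (\<Sum>v\<in>W. w v (x - v))"
    using assms(2) unfolding equid_def by blast
  show ?thesis
  proof (rule equidI[where J = "V <+> W" and g = "case_sum id id" and u = "case_sum u w"])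
    show "AE x in N. c x + c' x = (\<Sum>j\<in>V <+> W. case_sum u w j x)"
      using V(4) W(4) by eventually_elim (use V(1) W(1) in \<open>simp add: sum.Plus\<close>)
    show "AE x in N. d x + d' x = (\<Sum>j\<in>V <+> W. case_sum u w j (x - case_sum id id j))"
      using V(5) W(5) by eventually_elim (use V(1) W(1) in \<open>simp add: sum.Plus\<close>)
  qed (use V W in \<open>auto simp: Plus_def\<close>)
qed

lemma equid_sum:
  assumes "finite I" "\<And>i. i \<in> I \<Longrightarrow> equid H (c i) (d i)" "0 \<in> H"
  shows "equid H (\<lambda>x. \<Sum>i\<in>I. c i x) (\<lambda>x. \<Sum>i\<in>I. d i x)"
  using assms(1,2)
proof (induction I)
  case empty
  then show ?case using equid_refl[of "\<lambda>_. 0" H] assms(3) by simp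
next
  case (insert i I)
  then show ?case using equid_add[of H "c i" "d i"] by simp
qed

lemma equid_sym:
  assumes "equid H c d" "uminus ` H \<subseteq> H"
  shows "equid H d c"
proof -
  obtain V u where V: "finite V" "V \<subseteq> H" "\<forall>v\<in>V. u v \<in> measurable N (count_space UNIV)"
    "AE x in N. c x = (\<Sum>v\<in>V. u v x)" "AE x in N. d x = (\<Sum>v\<in>V. u v (x - v))"
    using assms(1) unfolding equid_def by blast
  show ?thesis
  proof (rule equidI[where J = V and g = uminus and u = "\<lambda>v x. u v (x - v)"])
    show "(\<lambda>x. u j (x - j)) \<in> measurable N (count_space UNIV)" if "j \<in> V" for j
      using that V(3) by (intro measurable_compose[OF shift_minus_measurable]) auto
  qed (use V assms(2) in auto)
qed

text \<open>At each point the units that arrive under the first decomposition and those that leave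
  under the second partition the same number \<open>d x\<close>. The common refinement tells how
  many units arrive along \<open>p i\<close> and leave along \<open>q j\<close>.\<close>

lemma equid_trans:
  assumes cd: "equid H c d" and de: "equid H d e" and H: "\<And>x y. \<lbrakk>x \<in> H; y \<in> H\<rbrakk> \<Longrightarrow> x + y \<in> H"
  shows "equid H c e"
proof -
  obtain V u where V: "finite V" "V \<subseteq> H" "\<forall>v\<in>V. u v \<in> measurable N (count_space UNIV)"
    "AE x in N. c x = (\<Sum>v\<in>V. u v x)" "AE x in N. d x = (\<Sum>v\<in>V. u v (x - v))"
    using cd unfolding equid_def by blast
  obtain W w where W: "finite W" "W \<subseteq> H" "\<forall>v\<in>W. w v \<in> measurable N (count_space UNIV)"
    "AE x in N. d x = (\<Sum>v\<in>W. w v x)" "AE x in N. e x = (\<Sum>v\<in>W. w v (x - v))"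
    using de unfolding equid_def by blast
  obtain p where p: "bij_betw p {..<card V} V" using ex_bij_betw_nat_finite[OF V(1)] by (auto simp: atLeast0LessThan)
  obtain q where q: "bij_betw q {..<card W} W" using ex_bij_betw_nat_finite[OF W(1)] by (auto simp: atLeast0LessThan)
  define a where "a = (\<lambda>i x. u (p i) (x - p i))"
  define b where "b = (\<lambda>j. w (q j))"
  define m where "m = card V"
  define n where "n = card W"
  have pV: "p i \<in> V" if "i < m" for i using p that by (auto simp: bij_betw_def m_def)
  have qW: "q i \<in> W" if "i < n" for i using q that by (auto simp: bij_betw_def n_def)
  have am: "a i \<in> measurable N (count_space UNIV)" if "i < m" for i
    unfolding a_def using V(3) pV[OF that]
    by (intro measurable_compose[OF shift_minus_measurable]) auto
  have bm: "b i \<in> measurable N (count_space UNIV)" if "i < n" for i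
    unfolding b_def using W(3) qW[OF that] by auto
  define E where "E = (\<lambda>i j x. refinement (\<lambda>k. a k x) (\<lambda>k. b k x) i j)"
  have Em: "E i j \<in> measurable N (count_space UNIV)" if "i < m" "j < n" for i j
    unfolding E_def by (rule refinement_measurable[OF am bm]) (use that in auto)
  have eq: "AE x in N. (\<Sum>i<m. a i x) = (\<Sum>j<n. b j x)"
    using V(5) W(4)
  proof eventually_elim
    case (elim x)
    have "(\<Sum>i<m. a i x) = (\<Sum>v\<in>V. u v (x - v))"
      unfolding a_def m_def by (rule sum.reindex_bij_betw[OF p])
    moreover have "(\<Sum>j<n. b j x) = (\<Sum>v\<in>W. w v x)"
      unfolding b_def n_def by (rule sum.reindex_bij_betw[OF q])
    ultimately show ?case using elim by simp
  qed
  have rows: "AE x in N. \<forall>i<m. (\<Sum>j<n. E i j x) = a i x"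
    using eq by eventually_elim (auto simp: E_def refinement_sum)
  have cols: "AE x in N. \<forall>j<n. (\<Sum>i<m. E i j x) = b j x"
    using eq
  proof eventually_elim
    case (elim x)
    show ?case
      using refinement_sum[OF elim[symmetric]]
      by (simp add: E_def refinement_swap[of "\<lambda>k. b k x"])
  qed
  have rows': "AE x in N. \<forall>i\<in>{..<m}. (\<Sum>j<n. E i j (x + p i)) = a i (x + p i)"
  proof (rule AE_finite_allI)
    fix i assume "i \<in> {..<m}"
    with AE_shift[OF rows, of "p i"] show "AE x in N. (\<Sum>j<n. E i j (x + p i)) = a i (x + p i)"
      by (auto elim: eventually_mono)
  qed simp
  have cols': "AE x in N. \<forall>j\<in>{..<n}. (\<Sum>i<m. E i j (x - q j)) = b j (x - q j)"
  proof (rule AE_finite_allI)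
    fix j assume "j \<in> {..<n}"
    with AE_shift_minus[OF cols, of "q j"] show "AE x in N. (\<Sum>i<m. E i j (x - q j)) = b j (x - q j)"
      by (auto elim: eventually_mono)
  qed simp
  \<comment> \<open>\<open>E i j\<close> is indexed by the intermediate point of the move, so a unit
    starting at \<open>x\<close> is counted at \<open>x + p i\<close>.\<close>
  show ?thesis
  proof (rule equidI[where J = "{..<m} \<times> {..<n}" and g = "\<lambda>(i, j). p i + q j" and u = "\<lambda>(i, j) x. E i j (x + p i)"])
    show "(\<lambda>(i, j). p i + q j) ` ({..<m} \<times> {..<n}) \<subseteq> H"
    proof clarsimp
      fix i j assume "i < m" "j < n"
      then show "p i + q j \<in> H" using H[of "p i" "q j"] pV[of i] qW[of j] V(2) W(2) by blast
    qed
    show "(case k of (i, j) \<Rightarrow> \<lambda>x. E i j (x + p i)) \<in> measurable N (count_space UNIV)"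
      if "k \<in> {..<m} \<times> {..<n}" for k
      using that Em by (auto intro!: measurable_compose[OF shift_measurable])
    show "AE x in N. c x = (\<Sum>k\<in>{..<m} \<times> {..<n}. (case k of (i, j) \<Rightarrow> \<lambda>x. E i j (x + p i)) x)"
      using rows' V(4)
    proof eventually_elim
      case (elim x)
      have "(\<Sum>v\<in>V. u v x) = (\<Sum>i<m. u (p i) x)"
        unfolding m_def by (rule sum.reindex_bij_betw[OF p, symmetric])
      also have "\<dots> = (\<Sum>i<m. \<Sum>j<n. E i j (x + p i))"
        using elim(1) by (intro sum.cong) (auto simp: a_def)
      finally show ?case using elim(2) by (simp add: sum.cartesian_product case_prod_unfold)
    qed
    show "AE x in N. e x = (\<Sum>k\<in>{..<m} \<times> {..<n}. (case k of (i, j) \<Rightarrow> \<lambda>x. E i j (x + p i))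
            (x - (case k of (i, j) \<Rightarrow> p i + q j)))"
      using cols' W(5)
    proof eventually_elim
      case (elim x)
      have "(\<Sum>v\<in>W. w v (x - v)) = (\<Sum>j<n. w (q j) (x - q j))"
        unfolding n_def by (rule sum.reindex_bij_betw[OF q, symmetric])
      also have "\<dots> = (\<Sum>j<n. \<Sum>i<m. E i j (x - q j))"
        using elim(1) by (intro sum.cong) (auto simp: b_def)
      also have "\<dots> = (\<Sum>i<m. \<Sum>j<n. E i j (x - q j))" by (rule sum.swap)
      finally show ?case using elim(2)
        by (simp add: sum.cartesian_product case_prod_unfold algebra_simps)
    qed
  qed auto
qed

end

section \<open>Free translation actions and markers\<close>

lemma measurable_count_space_finite_range:
  assumes "finite T" "\<And>x. r x \<in> T" "\<And>v. v \<in> T \<Longrightarrow> {x \<in> space M. r x = v} \<in> sets M"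
  shows "r \<in> measurable M (count_space UNIV)"
proof (rule measurableI)
  fix A
  have "r -` A \<inter> space M = (\<Union>v\<in>T \<inter> A. {x \<in> space M. r x = v})"
    using assms(2) by auto
  also have "\<dots> \<in> sets M" using assms by auto
  finally show "r -` A \<inter> space M \<in> sets M" .
qed simp

text \<open>Freeness enters as a countable measurable colouring that separates \<open>x\<close> from
  \<open>x + f\<close>. Comparing colours then makes choices along orbits measurable.\<close>

locale free_translation = translation_invariant N for N :: "'a::real_vector measure" +
  fixes Fr :: "'a set"
  assumes coloring: "\<lbrakk>finite F; F \<subseteq> Fr\<rbrakk> \<Longrightarrow>
    \<exists>\<kappa>. \<kappa> \<in> measurable N (count_space (UNIV::nat set)) \<and> (\<forall>x. \<forall>f\<in>F. \<kappa> (x + f) \<noteq> \<kappa> x)"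
begin

text \<open>Greedy maximal independent set: the colours are processed in order, and a point of
  colour j is added if no neighbour has been chosen before. Points of equal colour are never
  neighbours, so no conflict arises within a round.\<close>

lemma markers:
  assumes "finite F" "F \<subseteq> Fr" "uminus ` F \<subseteq> F"
  obtains B where "B \<in> sets N" "\<And>x f. \<lbrakk>x \<in> B; f \<in> F\<rbrakk> \<Longrightarrow> x + f \<notin> B"
    "\<And>x. \<exists>f\<in>insert 0 F. x + f \<in> B"
proof -
  obtain \<kappa> :: "'a \<Rightarrow> nat" where \<kappa>: "\<kappa> \<in> measurable N (count_space UNIV)"
    and col: "\<And>x f. f \<in> F \<Longrightarrow> \<kappa> (x + f) \<noteq> \<kappa> x"
    using coloring[OF assms(1,2)] by blast
  define W where "W = rec_nat {} (\<lambda>j S. S \<union> {x. \<kappa> x = j \<and> (\<forall>f\<in>F. x + f \<notin> S)})"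
  have W0: "W 0 = {}" and WS: "W (Suc j) = W j \<union> {x. \<kappa> x = j \<and> (\<forall>f\<in>F. x + f \<notin> W j)}" for j
    by (simp_all add: W_def)
  define B where "B = (\<Union>j. W j)"
  \<comment> \<open>A point is decided once, in the round of its own colour.\<close>
  have inW: "x \<in> W j \<longleftrightarrow> \<kappa> x < j \<and> (\<forall>f\<in>F. x + f \<notin> W (\<kappa> x))" for x j
    by (induction j) (auto simp: W0 WS less_Suc_eq)
  have inB: "x \<in> B \<longleftrightarrow> (\<forall>f\<in>F. x + f \<notin> W (\<kappa> x))" for x
    unfolding B_def using inW by (metis UN_iff UNIV_I lessI)
  have WB: "x \<in> W j \<longleftrightarrow> x \<in> B \<and> \<kappa> x < j" for x j
    using inW inB by blast
  have meas: "W j \<in> sets N" for j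
  proof (induction j)
    case (Suc j)
    have "{x. x + f \<notin> W j} \<in> sets N" for f
      using sets.compl_sets[OF shift_sets[OF Suc, of f]] by (simp add: Compl_eq_Diff_UNIV[symmetric] Collect_neg_eq)
    then have "{x \<in> space N. \<forall>f\<in>F. x + f \<notin> W j} \<in> sets N"
      using assms(1) by (intro sets.sets_Collect_finite_All) auto
    moreover have "{x. \<kappa> x = j} \<in> sets N"
      using measurable_sets[OF \<kappa>, of "{j}"] by (simp add: vimage_def)
    moreover have "W (Suc j) = W j \<union> {x. \<kappa> x = j} \<inter> {x \<in> space N. \<forall>f\<in>F. x + f \<notin> W j}"
      using WS by auto
    ultimately show ?case using Suc by auto
  qed (simp add: W0)
  show thesis
  proof
    show "B \<in> sets N" unfolding B_def using meas by auto
    show "x + f \<notin> B" if "x \<in> B" "f \<in> F" for x f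
    proof
      assume a: "x + f \<in> B"
      have "- f \<in> F" using assms(3) that(2) by auto
      then have "x \<notin> W (\<kappa> (x + f))" using a inB[of "x + f"] by force
      moreover have "x + f \<notin> W (\<kappa> x)" using that inB by blast
      ultimately show False using WB a that col[OF that(2), of x] by (meson linorder_neqE_nat)
    qed
    show "\<exists>f\<in>insert 0 F. x + f \<in> B" for x
      using inB[of x] WB by auto
  qed
qed

text \<open>By \<open>inj\<close> the candidates of a point have different scores, so the minimiser
  is unique, and the set where it equals a given \<open>v\<close> is described by finitely many
  measurable comparisons.\<close>

lemma select:
  fixes q :: "'v \<Rightarrow> 'a" and score :: "'v \<Rightarrow> 'a \<Rightarrow> nat"
  assumes "finite Box" "B \<in> sets N"
    and cand: "\<And>x. \<exists>v\<in>Box. x + q v \<in> B"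
    and meas: "\<And>v. v \<in> Box \<Longrightarrow> score v \<in> measurable N (count_space UNIV)"
    and inj: "\<And>v v' x. \<lbrakk>v \<in> Box; v' \<in> Box; v \<noteq> v'; x + q v \<in> B; x + q v' \<in> B\<rbrakk> \<Longrightarrow> score v x \<noteq> score v' x"
  obtains r where "r \<in> measurable N (count_space UNIV)" "\<And>x. r x \<in> Box" "\<And>x. x + q (r x) \<in> B"
    "\<And>x v. \<lbrakk>v \<in> Box; x + q v \<in> B; \<And>v'. \<lbrakk>v' \<in> Box; x + q v' \<in> B\<rbrakk> \<Longrightarrow> score v x \<le> score v' x\<rbrakk> \<Longrightarrow> r x = v"
    "\<And>x v. \<lbrakk>v \<in> Box; x + q v \<in> B\<rbrakk> \<Longrightarrow> score (r x) x \<le> score v x"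
proof -
  have "\<exists>v. v \<in> Box \<and> x + q v \<in> B \<and> (\<forall>v'\<in>Box. x + q v' \<in> B \<longrightarrow> score v x \<le> score v' x)" for x
  proof -
    let ?C = "{v \<in> Box. x + q v \<in> B}"
    have C: "finite ?C" "?C \<noteq> {}" using assms(1) cand[of x] by auto
    show ?thesis
      using arg_min_if_finite(1)[OF C, of "\<lambda>v. score v x"] arg_min_least[OF C, of _ "\<lambda>v. score v x"]
      by (intro exI[of _ "arg_min_on (\<lambda>v. score v x) ?C"]) auto
  qed
  then obtain r where r: "\<And>x. r x \<in> Box" "\<And>x. x + q (r x) \<in> B"
    "\<And>x v'. \<lbrakk>v' \<in> Box; x + q v' \<in> B\<rbrakk> \<Longrightarrow> score (r x) x \<le> score v' x" by metis
  have uniq: "r x = v" if "v \<in> Box" "x + q v \<in> B"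
    "\<And>v'. \<lbrakk>v' \<in> Box; x + q v' \<in> B\<rbrakk> \<Longrightarrow> score v x \<le> score v' x" for x v
    using inj[of v "r x" x] r(3)[of v x] that r(1,2)[of x] by (metis order_antisym)
  have "r \<in> measurable N (count_space UNIV)"
  proof (rule measurable_count_space_finite_range[OF assms(1) r(1)])
    fix v assume v: "v \<in> Box"
    have B: "{x \<in> space N. x + q v' \<in> B} \<in> sets N" for v'
      using shift_sets[OF assms(2)] by simp
    have sc: "{x \<in> space N. score v x \<le> score v' x} \<in> sets N" if "v' \<in> Box" for v'
      using measurable_sets[OF measurable_count_space_compose2[OF meas[OF v] meas[OF that], where h = "(\<le>)"], of "{True}"]
      by (simp add: vimage_def)
    have "{x \<in> space N. r x = v} = {x \<in> space N. x + q v \<in> B \<and>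
        (\<forall>v'\<in>Box. x + q v' \<in> B \<longrightarrow> score v x \<le> score v' x)}"
      using r uniq v by auto
    also have "\<dots> \<in> sets N"
      using assms(1) B sc by (intro sets.sets_Collect_conj sets.sets_Collect_finite_All sets.sets_Collect_imp) auto
    finally show "{x \<in> space N. r x = v} \<in> sets N" .
  qed
  then show thesis using that r uniq by blast
qed

end

locale finite_free_translation = free_translation N Fr + finite_measure N
  for N :: "'a::real_vector measure" and Fr
begin

lemma measure_shift: "A \<in> sets N \<Longrightarrow> measure N {x. x + v \<in> A} = measure N A"
  using emeasure_shift[of A v] by (simp add: measure_def vimage_def)

lemma measure_shift_minus: "A \<in> sets N \<Longrightarrow> measure N {x. x - v \<in> A} = measure N A"
  using measure_shift[of A "- v"] by simp

lemma measure_finite_Union_le: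
  fixes \<epsilon> :: real
  assumes "finite T" "\<And>t. t \<in> T \<Longrightarrow> S t \<in> sets N" "\<And>t. t \<in> T \<Longrightarrow> measure N (S t) \<le> (\<epsilon>::real)"
  shows "measure N (\<Union>t\<in>T. S t) \<le> card T * \<epsilon>"
proof -
  have "measure N (\<Union>t\<in>T. S t) \<le> (\<Sum>t\<in>T. measure N (S t))"
    using assms by (intro finite_measure_subadditive_finite) auto
  also have "\<dots> \<le> (\<Sum>t\<in>T. \<epsilon>)" by (intro sum_mono assms)
  finally show ?thesis by simp
qed

end

section \<open>Rokhlin towers for two commuting translations\<close>

locale plane_translation = finite_free_translation N Fr
  for N :: "'a::real_vector measure" and Fr +
  fixes e1 e2 :: 'a
  assumes free: "(i, j) \<noteq> (0, 0) \<Longrightarrow> of_int i *\<^sub>R e1 + of_int j *\<^sub>R e2 \<in> Fr"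
begin

text \<open>Only nonnegative multiples are used: tiles are described by the offset from a point
  forward to its marker, so that offsets add up within \<open>nat\<close>.\<close>

definition P :: "nat \<times> nat \<Rightarrow> 'a" where
  "P v = of_nat (fst v) *\<^sub>R e1 + of_nat (snd v) *\<^sub>R e2"

lemma P_add: "P (u + v) = P u + P v"
  by (simp add: P_def algebra_simps)

lemma P_simps [simp]: "P (0, 0) = 0" "P 0 = 0" "P (Suc 0, 0) = e1" "P (0, Suc 0) = e2"
  by (simp_all add: P_def)

text \<open>Boundary of the tiling with offsets \<open>r\<close>: an edge stays inside a tile if the
  offset drops by one unit in its direction, because both ends then have the same marker.\<close>

definition bad :: "('a \<Rightarrow> nat \<times> nat) \<Rightarrow> 'a set" where
  "bad r = {x. r x \<noteq> r (x + e1) + (1, 0) \<or> r x \<noteq> r (x + e2) + (0, 1)}"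

lemma bad_sets:
  assumes "r \<in> measurable N (count_space UNIV)"
  shows "bad r \<in> sets N"
proof -
  have "(\<lambda>x. (\<lambda>p q. p \<noteq> q + d) (r x) (r (x + e))) \<in> measurable N (count_space UNIV)" for d e
    using measurable_count_space_compose2[OF assms measurable_compose[OF shift_measurable assms],
        where h = "\<lambda>p q. p \<noteq> q + d"] by simp
  from measurable_sets[OF this, of "{True}"]
  have *: "{x. r x \<noteq> r (x + e) + d} \<in> sets N" for d e by (simp add: vimage_def)
  have "bad r = {x. r x \<noteq> r (x + e1) + (1, 0)} \<union> {x. r x \<noteq> r (x + e2) + (0, 1)}"
    by (auto simp: bad_def)
  then show ?thesis using * by auto
qed

text \<open>Each point chooses the marker of least colour in the square of side 2n ahead of it. This
  preference depends on the marker alone, so two neighbours choose alike unless a marker lies in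
  just one of their squares. Such a marker sits on a frame of length linear in n, whereas markers
  have density at most 1/(n+1)^2.\<close>

lemma rokhlin:
  fixes n :: nat
  obtains B r where "B \<in> sets N" "measure N B * (real n + 1)\<^sup>2 \<le> measure N UNIV"
    "r \<in> measurable N (count_space UNIV)" "\<And>x. r x \<in> {..2*n} \<times> {..2*n}" "\<And>x. x + P (r x) \<in> B"
    "measure N (bad r) \<le> 4 * (2 * real n + 1) * measure N B"
proof -
  define Q where "Q = (\<lambda>(i, j). of_int i *\<^sub>R e1 + of_int j *\<^sub>R e2 :: 'a)"
  define F where "F = (\<lambda>m. Q ` ({-m..m} \<times> {-m..m} - {(0::int, 0::int)}))"
  have Ffin: "finite (F m)" and FFr: "F m \<subseteq> Fr" for m
    using free by (auto simp: F_def Q_def)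
  have Fneg: "uminus ` F m \<subseteq> F m" for m
  proof
    fix y assume "y \<in> uminus ` F m"
    then obtain i j where ij: "(i, j) \<in> {-m..m} \<times> {-m..m} - {(0, 0)}" "y = - Q (i, j)"
      unfolding F_def by fast
    then have "y = Q (- i, - j)" "(- i, - j) \<in> {-m..m} \<times> {-m..m} - {(0, 0)}"
      by (auto simp: Q_def)
    then show "y \<in> F m" unfolding F_def by blast
  qed
  obtain B where B: "B \<in> sets N" and sep: "\<And>x f. \<lbrakk>x \<in> B; f \<in> F (int n)\<rbrakk> \<Longrightarrow> x + f \<notin> B"
    and cov: "\<And>x. \<exists>f\<in>insert 0 (F (int n)). x + f \<in> B"
    using markers[OF Ffin FFr Fneg] by metis
  \<comment> \<open>Two candidates of one point may differ by 2n in a coordinate, twice the range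
    over which markers are separated, so a second colouring with this larger range is needed to
    order them.\<close>
  obtain \<kappa> :: "'a \<Rightarrow> nat" where \<kappa>: "\<kappa> \<in> measurable N (count_space UNIV)"
    and col: "\<And>x f. f \<in> F (2 * int n) \<Longrightarrow> \<kappa> (x + f) \<noteq> \<kappa> x"
    using coloring[OF Ffin FFr, of "2 * int n"] by blast
  let ?Box = "{..2*n} \<times> {..2*n}"
  have P_diff: "P v = P u + Q (int (fst v) - int (fst u), int (snd v) - int (snd u))" for u v
    by (simp add: P_def Q_def algebra_simps)
  have diffF: "Q (int (fst v) - int (fst u), int (snd v) - int (snd u)) \<in> F (int m)"
    if "u \<in> {..m} \<times> {..m}" "v \<in> {..m} \<times> {..m}" "u \<noteq> v" for u v m
    unfolding F_def using that by (intro imageI) (auto simp: prod_eq_iff)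
  have cand: "\<exists>v\<in>?Box. x + P v \<in> B" for x
  proof -
    obtain f where f: "f \<in> insert 0 (F (int n))" "x + P (n, n) + f \<in> B" using cov by blast
    have "f \<in> Q ` ({-int n..int n} \<times> {-int n..int n})"
    proof (cases "f = 0")
      case True
      then have "f = Q (0, 0)" by (simp add: Q_def)
      then show ?thesis by (intro image_eqI) auto
    next
      case False
      then show ?thesis using f(1) unfolding F_def by blast
    qed
    then obtain i j where ij: "i \<in> {-int n..int n}" "j \<in> {-int n..int n}" "f = Q (i, j)"
      by blast
    have "P (nat (int n + i), nat (int n + j)) = P (n, n) + Q (i, j)"
      using ij by (simp add: P_def Q_def algebra_simps of_nat_nat)
    then have "x + P (nat (int n + i), nat (int n + j)) \<in> B" using f ij by (simp add: add.assoc)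
    moreover have "(nat (int n + i), nat (int n + j)) \<in> ?Box" using ij by auto
    ultimately show ?thesis by blast
  qed
  have sm: "(\<lambda>x. \<kappa> (x + P v)) \<in> measurable N (count_space UNIV)" for v
    by (rule measurable_compose[OF shift_measurable \<kappa>])
  have inj: "\<kappa> (x + P v) \<noteq> \<kappa> (x + P v')" if "v \<in> ?Box" "v' \<in> ?Box" "v \<noteq> v'" for x v v'
    using col[OF diffF[of v' "2 * n" v, simplified], of "x + P v'"] that
    by (simp add: P_diff[of v v'] add.assoc)
  obtain r where r: "r \<in> measurable N (count_space UNIV)" "\<And>x. r x \<in> ?Box" "\<And>x. x + P (r x) \<in> B"
    "\<And>x v. \<lbrakk>v \<in> ?Box; x + P v \<in> B; \<And>v'. \<lbrakk>v' \<in> ?Box; x + P v' \<in> B\<rbrakk> \<Longrightarrow> \<kappa> (x + P v) \<le> \<kappa> (x + P v')\<rbrakk> \<Longrightarrow> r x = v"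
    "\<And>x v. \<lbrakk>v \<in> ?Box; x + P v \<in> B\<rbrakk> \<Longrightarrow> \<kappa> (x + P (r x)) \<le> \<kappa> (x + P v)"
    by (rule select[of ?Box B P "\<lambda>v x. \<kappa> (x + P v)", OF _ B cand sm inj]) (auto intro: that)
  have m1: "measure N B * (real n + 1)\<^sup>2 \<le> measure N UNIV"
  proof -
    have dis: "disjoint_family_on (\<lambda>v. {x. x + P v \<in> B}) ({..n} \<times> {..n})"
    unfolding disjoint_family_on_def
    proof (intro ballI impI)
      fix u v assume uv: "u \<in> {..n} \<times> {..n}" "v \<in> {..n} \<times> {..n}" "u \<noteq> v"
      show "{x. x + P u \<in> B} \<inter> {x. x + P v \<in> B} = {}"
        using sep[OF _ diffF[OF uv]] by (auto simp: P_diff[of v u] add.assoc[symmetric])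
    qed
    have "measure N (\<Union>v\<in>{..n} \<times> {..n}. {x. x + P v \<in> B}) = (\<Sum>v\<in>{..n} \<times> {..n}. measure N {x. x + P v \<in> B})"
      using dis shift_sets[OF B] by (intro finite_measure_finite_Union) auto
    also have "\<dots> = measure N B * (real n + 1)\<^sup>2"
      unfolding measure_shift[OF B] by (simp add: power2_eq_square algebra_simps)
    finally show ?thesis by (metis bounded_measure space_eq)
  qed
  \<comment> \<open>The offsets, seen from \<open>x\<close>, that belong to exactly one of the
    squares of \<open>x\<close> and of a neighbour: the first column or row of \<open>x\<close>, and
    the last column or row of the neighbour.\<close>
  define V where "V = (\<lambda>j. (0::nat, j)) ` {..2*n} \<union> (\<lambda>j. (2*n+1, j)) ` {..2*n} \<union>
     ((\<lambda>j. (j, 0)) ` {..2*n} \<union> (\<lambda>j. (j, 2*n+1)) ` {..2*n})"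
  have cV: "card V \<le> 4 * (2 * n + 1)"
  proof -
    have c: "card (f ` {..2*n}) \<le> 2 * n + 1" for f :: "nat \<Rightarrow> nat \<times> nat"
      using card_image_le[of "{..2*n}" f] by simp
    have u: "card (S \<union> T) \<le> a + b" if "card S \<le> a" "card T \<le> b" for S T :: "(nat \<times> nat) set" and a b
      using card_Un_le[of S T] that by linarith
    have "card V \<le> (2 * n + 1 + (2 * n + 1)) + (2 * n + 1 + (2 * n + 1))"
      unfolding V_def by (intro u c)
    then show ?thesis by simp
  qed
  have badV: "bad r \<subseteq> (\<Union>v\<in>V. {x. x + P v \<in> B})"
  proof (rule ccontr)
    assume "\<not> ?thesis"
    then obtain x where x: "x \<in> bad r" "\<And>v. v \<in> V \<Longrightarrow> x + P v \<notin> B" by auto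
    have key: "r x = r (x + P d) + d" if d: "d = (1, 0) \<or> d = (0, 1)" for d
    proof (rule r(4))
      let ?s = "r (x + P d)"
      have *: "x + P (v + d) = x + P d + P v" for v by (simp add: P_add algebra_simps)
      have up: "v + d \<in> ?Box" if "v \<in> ?Box" "x + P (v + d) \<in> B" for v
        using that x(2)[of "v + d"] d unfolding V_def by (cases v) (force simp: le_Suc_eq)
      show "?s + d \<in> ?Box" using up r(2,3)[of "x + P d"] * by metis
      show "x + P (?s + d) \<in> B" using r(3)[of "x + P d"] * by metis
      fix v' assume v': "v' \<in> ?Box" "x + P v' \<in> B"
      have "\<exists>v. v' = v + d \<and> v \<in> ?Box"
      proof -
        obtain a b where ab: "v' = (a, b)" by force
        show ?thesis
          using d
        proof
          assume d: "d = (1, 0)"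
          have "v' \<in> V" if "a = 0" using that v'(1) ab unfolding V_def by auto
          then have "a \<noteq> 0" using x(2) v'(2) by blast
          then show ?thesis using d ab v' by (intro exI[of _ "(a - 1, b)"]) auto
        next
          assume d: "d = (0, 1)"
          have "v' \<in> V" if "b = 0" using that v'(1) ab unfolding V_def by auto
          then have "b \<noteq> 0" using x(2) v'(2) by blast
          then show ?thesis using d ab v' by (intro exI[of _ "(a, b - 1)"]) auto
        qed
      qed
      then obtain v where v: "v' = v + d" "v \<in> ?Box" by blast
      show "\<kappa> (x + P (?s + d)) \<le> \<kappa> (x + P v')"
        using r(5)[of v "x + P d"] v v' * by metis
    qed
    show False using key[of "(1, 0)"] key[of "(0, 1)"] x(1) by (simp add: bad_def)
  qed
  have "measure N (bad r) \<le> measure N (\<Union>v\<in>V. {x. x + P v \<in> B})"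
    using badV shift_sets[OF B] by (intro finite_measure_mono) (auto simp: V_def)
  also have "\<dots> \<le> card V * measure N B"
    using shift_sets[OF B] measure_shift[OF B] by (intro measure_finite_Union_le) (auto simp: V_def)
  also have "\<dots> \<le> 4 * (2 * real n + 1) * measure N B"
    using of_nat_mono[OF cV, where 'a = real] by (intro mult_right_mono) auto
  finally show thesis using that[OF B m1 r(1,2,3)] by blast
qed

end

section \<open>Every measurable function is a divergence in the plane\<close>

context finite_free_translation
begin

lemma AE_eventually_notin:
  assumes "\<And>n. A n \<in> sets N" "summable f" "\<And>n. measure N (A n) \<le> f n"
  shows "AE x in N. eventually (\<lambda>n. x \<notin> A n) sequentially"
proof -
  have "summable (\<lambda>n. measure N (A n))"
    by (rule summable_comparison_test'[OF assms(2), of 0]) (use assms(3) in auto)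
  from borel_cantelli_AE1[OF assms(1) _ this] show ?thesis
    by (simp add: emeasure_eq_measure)
qed

end

context plane_translation
begin

lemma coboundary:
  assumes \<theta>: "\<theta> \<in> borel_measurable N"
  obtains H1 H2 :: "'a \<Rightarrow> real" where "H1 \<in> borel_measurable N" "H2 \<in> borel_measurable N"
    "AE x in N. \<theta> x = H1 x - H1 (x - e1) + (H2 x - H2 (x - e2))"
proof -
  define M where "M = measure N UNIV"
  have "\<forall>k. \<exists>B r. B \<in> sets N \<and> measure N B * (real (2^k) + 1)\<^sup>2 \<le> M \<and>
    r \<in> measurable N (count_space UNIV) \<and> (\<forall>x. r x \<in> {..2*2^k} \<times> {..2*2^k}) \<and> (\<forall>x. x + P (r x) \<in> B)"
  proof
    fix k :: nat
    obtain B r where "B \<in> sets N" "measure N B * (real (2^k) + 1)\<^sup>2 \<le> measure N UNIV"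
      "r \<in> measurable N (count_space UNIV)" "\<And>x. r x \<in> {..2*2^k} \<times> {..2*2^k}" "\<And>x. x + P (r x) \<in> B"
      by (rule rokhlin[of "2^k"]) blast
    then show "\<exists>B r. B \<in> sets N \<and> measure N B * (real (2^k) + 1)\<^sup>2 \<le> M \<and>
      r \<in> measurable N (count_space UNIV) \<and> (\<forall>x. r x \<in> {..2*2^k} \<times> {..2*2^k}) \<and> (\<forall>x. x + P (r x) \<in> B)"
      unfolding M_def by blast
  qed
  then obtain B r where B: "\<And>k. B k \<in> sets N" and Bm: "\<And>k. measure N (B k) * (real (2^k) + 1)\<^sup>2 \<le> M"
    and r: "\<And>k. r k \<in> measurable N (count_space UNIV)" and rb: "\<And>k x. r k x \<in> {..2*2^k} \<times> {..2*2^k}"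
    and rB: "\<And>k x. x + P (r k x) \<in> B k"
    by metis
  let ?Box = "\<lambda>k. {..2*2^k} \<times> {..2*2^k} :: (nat \<times> nat) set"
  define u where "u = (\<lambda>k \<theta>' v x. if r k x = v then \<theta>' x else 0 :: real)"
  define \<Theta> where "\<Theta> = rec_nat \<theta> (\<lambda>k \<theta>' x. \<Sum>v\<in>?Box k. u k \<theta>' v (x - P v))"
  have \<Theta>0: "\<Theta> 0 = \<theta>" and \<Theta>S: "\<Theta> (Suc k) = (\<lambda>x. \<Sum>v\<in>?Box k. u k (\<Theta> k) v (x - P v))" for k
    by (simp_all add: \<Theta>_def)
  have rv: "{x \<in> space N. r k x = v} \<in> sets N" for k v
    using measurable_sets[OF r, of "{v}" k] by (simp add: vimage_def)
  have um: "u k \<theta>' v \<in> borel_measurable N" if "\<theta>' \<in> borel_measurable N" for k \<theta>' v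
    unfolding u_def by (rule measurable_If[OF that _ rv]) simp
  have ums: "(\<lambda>x. u k \<theta>' v (x - y)) \<in> borel_measurable N" if "\<theta>' \<in> borel_measurable N" for k \<theta>' v y
    by (rule measurable_compose[OF shift_minus_measurable um[OF that]])
  have \<Theta>m: "\<Theta> k \<in> borel_measurable N" for k
    by (induction k) (auto simp: \<Theta>0 \<Theta>S \<theta> intro!: borel_measurable_sum ums)
  \<comment> \<open>\<open>h1 k x\<close> is the mass that crosses the edge from \<open>x\<close> to
    \<open>x + e1\<close> on the first leg of stage k, and \<open>h2 k x\<close> the mass crossing
    to \<open>x + e2\<close> on the second leg.\<close>
  define h1 where "h1 = (\<lambda>k x. \<Sum>v\<in>?Box k. \<Sum>j<fst v. u k (\<Theta> k) v (x - P (j, 0)))"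
  define h2 where "h2 = (\<lambda>k x. \<Sum>v\<in>?Box k. \<Sum>j<snd v. u k (\<Theta> k) v (x - P (fst v, j)))"
  have h1m: "h1 k \<in> borel_measurable N" and h2m: "h2 k \<in> borel_measurable N" for k
    unfolding h1_def h2_def by (intro borel_measurable_sum ums \<Theta>m)+
  have Ps: "x - P (Suc j, i) = x - e1 - P (j, i)" "x - P (i, Suc j) = x - e2 - P (i, j)" for x i j
    by (simp_all add: P_def algebra_simps)
  have usum: "(\<Sum>v\<in>?Box k. u k (\<Theta> k) v x) = \<Theta> k x" for k x
  proof -
    have "(\<Sum>v\<in>?Box k. u k (\<Theta> k) v x) = (\<Sum>v\<in>?Box k. if v = r k x then \<Theta> k x else 0)"
      by (intro sum.cong) (auto simp: u_def)
    also have "\<dots> = \<Theta> k x" using rb[of k x] by (subst sum.delta) auto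
    finally show ?thesis .
  qed
  have step: "\<Theta> k x - \<Theta> (Suc k) x = h1 k x - h1 k (x - e1) + (h2 k x - h2 k (x - e2))" for k x
  proof -
    have 1: "(\<Sum>j<fst v. u k (\<Theta> k) v (x - P (j, 0))) - (\<Sum>j<fst v. u k (\<Theta> k) v (x - e1 - P (j, 0)))
      = u k (\<Theta> k) v x - u k (\<Theta> k) v (x - P (fst v, 0))" for v
      using sum_lessThan_telescope'[of "\<lambda>j. u k (\<Theta> k) v (x - P (j, 0))" "fst v"]
      by (simp add: sum_subtractf Ps[symmetric])
    have 2: "(\<Sum>j<snd v. u k (\<Theta> k) v (x - P (fst v, j))) - (\<Sum>j<snd v. u k (\<Theta> k) v (x - e2 - P (fst v, j)))
      = u k (\<Theta> k) v (x - P (fst v, 0)) - u k (\<Theta> k) v (x - P v)" for v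
      using sum_lessThan_telescope'[of "\<lambda>j. u k (\<Theta> k) v (x - P (fst v, j))" "snd v"]
      by (simp add: sum_subtractf Ps[symmetric])
    have "h1 k x - h1 k (x - e1) + (h2 k x - h2 k (x - e2))
      = (\<Sum>v\<in>?Box k. ((\<Sum>j<fst v. u k (\<Theta> k) v (x - P (j, 0))) - (\<Sum>j<fst v. u k (\<Theta> k) v (x - e1 - P (j, 0))))
         + ((\<Sum>j<snd v. u k (\<Theta> k) v (x - P (fst v, j))) - (\<Sum>j<snd v. u k (\<Theta> k) v (x - e2 - P (fst v, j)))))"
      by (simp only: h1_def h2_def sum.distrib sum_subtractf)
    also have "\<dots> = (\<Sum>v\<in>?Box k. u k (\<Theta> k) v x - u k (\<Theta> k) v (x - P v))"
      by (simp only: 1 2) simp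
    also have "\<dots> = \<Theta> k x - \<Theta> (Suc k) x" unfolding sum_subtractf usum \<Theta>S ..
    finally show ?thesis by simp
  qed
  have \<Theta>B: "x \<in> B k" if ne: "\<Theta> (Suc k) x \<noteq> 0" for k x
  proof -
    obtain v where "v \<in> ?Box k" "u k (\<Theta> k) v (x - P v) \<noteq> 0"
      using ne unfolding \<Theta>S by (rule sum.not_neutral_contains_not_neutral)
    then have "r k (x - P v) = v" by (auto simp: u_def split: if_splits)
    then show ?thesis using rB[of "x - P v" k] by simp
  qed
  have Bk: "measure N (B k) \<le> M / 4 ^ k" for k
  proof -
    have "(4::real) ^ k \<le> (real (2^k) + 1)\<^sup>2"
      by (simp add: power2_eq_square algebra_simps power_mult_distrib[symmetric])
    then have "measure N (B k) * 4 ^ k \<le> measure N (B k) * (real (2^k) + 1)\<^sup>2"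
      by (intro mult_left_mono) auto
    then show ?thesis using Bm[of k] by (simp add: field_simps)
  qed
  define T1 where "T1 = (\<lambda>k. \<Union>j<2*2^Suc k. {x. x - P (j, 0) \<in> B k})"
  \<comment> \<open>On the second leg mass has been displaced by \<open>fst v\<close>, which varies
    from point to point. Splitting \<open>B k\<close> by the value \<open>v\<close> of the offset
    keeps the pieces disjoint before the displacement, so for fixed \<open>j\<close> their total
    measure is at most that of \<open>B k\<close>. Counting every pair of displacements with the
    full \<open>B k\<close> would give a bound that is not summable.\<close>
  define T2 where "T2 = (\<lambda>k. \<Union>j<2*2^Suc k. \<Union>v\<in>?Box (Suc k). {x. x - P (fst v, j) \<in> B k \<inter> {y \<in> space N. r (Suc k) y = v}})"
  have T1s: "T1 k \<in> sets N" and T2s: "T2 k \<in> sets N" for k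
    unfolding T1_def T2_def
    by (intro sets.finite_UN shift_minus_sets sets.Int B rv finite_lessThan finite_SigmaI finite_atMost)+
  have h1T: "x \<in> T1 k" if ne: "h1 (Suc k) x \<noteq> 0" for k x
  proof -
    obtain v where v: "v \<in> ?Box (Suc k)" "(\<Sum>j<fst v. u (Suc k) (\<Theta> (Suc k)) v (x - P (j, 0))) \<noteq> 0"
      using ne unfolding h1_def by (rule sum.not_neutral_contains_not_neutral)
    from v(2) obtain j where "j \<in> {..<fst v}" and j2: "u (Suc k) (\<Theta> (Suc k)) v (x - P (j, 0)) \<noteq> 0"
      by (rule sum.not_neutral_contains_not_neutral)
    then have j: "j < fst v" by simp
    have "x - P (j, 0) \<in> B k" using j2 by (intro \<Theta>B) (auto simp: u_def split: if_splits)
    moreover have "j < 2 * 2 ^ Suc k" using j v by auto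
    ultimately show ?thesis unfolding T1_def by blast
  qed
  have h2T: "x \<in> T2 k" if ne: "h2 (Suc k) x \<noteq> 0" for k x
  proof -
    obtain v where v: "v \<in> ?Box (Suc k)" "(\<Sum>j<snd v. u (Suc k) (\<Theta> (Suc k)) v (x - P (fst v, j))) \<noteq> 0"
      using ne unfolding h2_def by (rule sum.not_neutral_contains_not_neutral)
    from v(2) obtain j where "j \<in> {..<snd v}" and j2: "u (Suc k) (\<Theta> (Suc k)) v (x - P (fst v, j)) \<noteq> 0"
      by (rule sum.not_neutral_contains_not_neutral)
    then have j: "j < snd v" by simp
    have "x - P (fst v, j) \<in> B k" using j2 by (intro \<Theta>B) (auto simp: u_def split: if_splits)
    moreover have "r (Suc k) (x - P (fst v, j)) = v" using j2 by (auto simp: u_def split: if_splits)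
    moreover have "j < 2 * 2 ^ Suc k" using j v by auto
    ultimately show ?thesis unfolding T2_def using v(1)
      by (intro UN_I[of j] UN_I[of v]) simp_all
  qed
  have geo: "2 * 2 ^ Suc k * measure N (B k) \<le> 4 * M * (1/2) ^ k" for k
  proof -
    have "2 * 2 ^ Suc k * measure N (B k) \<le> 2 * 2 ^ Suc k * (M / 4 ^ k)"
      by (intro mult_left_mono Bk) auto
    also have "\<dots> = 4 * M * (1/2) ^ k"
      using power_mult_distrib[of "2::real" 2 k] by (simp add: field_simps)
    finally show ?thesis .
  qed
  have T1m: "measure N (T1 k) \<le> 4 * M * (1/2) ^ k" for k
  proof -
    have "measure N (T1 k) \<le> card {..<2*2^Suc k::nat} * measure N (B k)"
      unfolding T1_def by (rule measure_finite_Union_le) (auto simp: measure_shift_minus B intro!: shift_minus_sets)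
    then show ?thesis using geo[of k] by simp
  qed
  have T2m: "measure N (T2 k) \<le> 4 * M * (1/2) ^ k" for k
  proof -
    have "measure N (\<Union>v\<in>?Box (Suc k). {x. x - P (fst v, j) \<in> B k \<inter> {y \<in> space N. r (Suc k) y = v}}) \<le> measure N (B k)" for j
    proof -
      let ?C = "\<lambda>v. B k \<inter> {y \<in> space N. r (Suc k) y = v}"
      have Cs: "?C v \<in> sets N" for v using B rv by auto
      have "measure N (\<Union>v\<in>?Box (Suc k). {x. x - P (fst v, j) \<in> ?C v})
        \<le> (\<Sum>v\<in>?Box (Suc k). measure N {x. x - P (fst v, j) \<in> ?C v})"
        by (intro finite_measure_subadditive_finite image_subsetI shift_minus_sets Cs finite_SigmaI finite_atMost)
      also have "\<dots> = (\<Sum>v\<in>?Box (Suc k). measure N (?C v))"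
        by (simp only: measure_shift_minus[OF Cs])
      also have "\<dots> = measure N (\<Union>v\<in>?Box (Suc k). ?C v)"
        by (rule finite_measure_finite_Union[symmetric]) (use Cs in \<open>auto simp: disjoint_family_on_def\<close>)
      also have "\<dots> \<le> measure N (B k)"
        by (rule finite_measure_mono) (use B in auto)
      finally show ?thesis .
    qed
    then have "measure N (T2 k) \<le> card {..<2*2^Suc k::nat} * measure N (B k)"
      unfolding T2_def
      by (intro measure_finite_Union_le sets.finite_UN shift_minus_sets sets.Int B rv finite_lessThan
          finite_SigmaI finite_atMost)
    then show ?thesis using geo[of k] by simp
  qed
  have Mp: "0 \<le> M" by (simp add: M_def)
  have sum: "summable (\<lambda>k. 4 * M * (1/2::real) ^ k)" by (intro summable_mult summable_geometric) auto
  have BM: "measure N (B k) \<le> 4 * M * (1/2) ^ k" for k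
  proof -
    have "(1::real) \<le> 2 ^ k" by simp
    then have "(1::real) \<le> 2 * 2 ^ Suc k" unfolding power_Suc by linarith
    then have "1 * measure N (B k) \<le> 2 * 2 ^ Suc k * measure N (B k)"
      by (intro mult_right_mono) auto
    then show ?thesis using geo[of k] by simp
  qed
  have evB: "AE x in N. \<forall>\<^sub>F k in sequentially. x \<notin> B k"
    by (rule AE_eventually_notin[OF B sum BM])
  have ev1: "AE x in N. \<forall>\<^sub>F k in sequentially. x \<notin> T1 k"
    by (rule AE_eventually_notin[OF T1s sum T1m])
  have ev2: "AE x in N. \<forall>\<^sub>F k in sequentially. x \<notin> T2 k"
    by (rule AE_eventually_notin[OF T2s sum T2m])
  show thesis
  proof
    show "(\<lambda>x. \<Sum>k. h1 k x) \<in> borel_measurable N" "(\<lambda>x. \<Sum>k. h2 k x) \<in> borel_measurable N"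
      by (intro borel_measurable_suminf h1m h2m)+
    show "AE x in N. \<theta> x = (\<Sum>k. h1 k x) - (\<Sum>k. h1 k (x - e1)) + ((\<Sum>k. h2 k x) - (\<Sum>k. h2 k (x - e2)))"
      using evB ev1 AE_shift_minus[OF ev1, of e1] ev2 AE_shift_minus[OF ev2, of e2]
    proof eventually_elim
      case (elim x)
      have "\<forall>\<^sub>F k in sequentially. x \<notin> B k \<and> x \<notin> T1 k \<and> x - e1 \<notin> T1 k \<and> x \<notin> T2 k \<and> x - e2 \<notin> T2 k"
        using elim by eventually_elim auto
      then obtain K where K: "\<And>k. k \<ge> K \<Longrightarrow> x \<notin> B k \<and> x \<notin> T1 k \<and> x - e1 \<notin> T1 k \<and> x \<notin> T2 k \<and> x - e2 \<notin> T2 k"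
        unfolding eventually_sequentially by blast
      \<comment> \<open>Index 0 has to be kept: the initial mass need not lie on a marker set, so
        vanishing is known only for indices beyond \<open>K\<close>.\<close>
      have fin: "(\<Sum>k. h k) = (\<Sum>k<Suc K. h k)" if "\<And>k. k \<ge> K \<Longrightarrow> h (Suc k) = 0" for h :: "nat \<Rightarrow> real"
      proof (rule suminf_finite)
        fix k assume "k \<notin> {..<Suc K}"
        then obtain k' where "k = Suc k'" "k' \<ge> K" by (cases k) auto
        then show "h k = 0" using that by simp
      qed simp
      have s1: "(\<Sum>k. h1 k x) = (\<Sum>k<Suc K. h1 k x)" by (rule fin) (use h1T K in blast)
      have s2: "(\<Sum>k. h1 k (x - e1)) = (\<Sum>k<Suc K. h1 k (x - e1))" by (rule fin) (use h1T K in blast)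
      have s3: "(\<Sum>k. h2 k x) = (\<Sum>k<Suc K. h2 k x)" by (rule fin) (use h2T K in blast)
      have s4: "(\<Sum>k. h2 k (x - e2)) = (\<Sum>k<Suc K. h2 k (x - e2))" by (rule fin) (use h2T K in blast)
      have "\<theta> x = \<Theta> 0 x - \<Theta> (Suc K) x" using \<Theta>B[of K x] K[of K] \<Theta>0 by auto
      also have "\<dots> = (\<Sum>k<Suc K. \<Theta> k x - \<Theta> (Suc k) x)"
        by (rule sum_lessThan_telescope'[symmetric])
      also have "\<dots> = (\<Sum>k<Suc K. h1 k x - h1 k (x - e1) + (h2 k x - h2 k (x - e2)))"
        by (simp only: step)
      finally show ?case unfolding s1 s2 s3 s4 by (simp only: sum.distrib sum_subtractf)
    qed
  qed
qed

end

section \<open>Integral flows\<close>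

context plane_translation
begin

text \<open>Integrality of the divergence on the whole forward orbit of \<open>x\<close>, so that
  later arguments work orbit by orbit; as a countable conjunction it still holds almost
  everywhere.\<close>

definition compat :: "('a \<Rightarrow> real) \<Rightarrow> ('a \<Rightarrow> real) \<Rightarrow> 'a \<Rightarrow> bool" where
  "compat a b x \<longleftrightarrow> (\<forall>v. a (x + P v) - a (x + P v - e1) + (b (x + P v) - b (x + P v - e2)) \<in> \<int>)"

lemma compat_shift:
  assumes "compat a b x"
  shows "compat a b (x + P v)"
  unfolding compat_def
proof
  fix u
  show "a (x + P v + P u) - a (x + P v + P u - e1) + (b (x + P v + P u) - b (x + P v + P u - e2)) \<in> \<int>"
    using assms[unfolded compat_def, rule_format, of "v + u"] unfolding P_add add.assoc .
qed

text \<open>Modulo 1, the increment from x to x + P v of the potential with increments - b along e1 and a along e2.\<close>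

definition alpha :: "('a \<Rightarrow> real) \<Rightarrow> ('a \<Rightarrow> real) \<Rightarrow> nat \<times> nat \<Rightarrow> 'a \<Rightarrow> real" where
  "alpha a b v x = (\<Sum>s<snd v. a (x + P (fst v, Suc s))) - (\<Sum>s<fst v. b (x + P (Suc s, 0)))"

lemma P_Suc: "P (Suc i, j) = P (i, j) + e1" "P (i, Suc j) = P (i, j) + e2"
  by (simp_all add: P_def algebra_simps)

lemma alpha_zero [simp]: "alpha a b 0 x = 0" by (simp add: alpha_def)

lemma alpha_up: "alpha a b (i, Suc j) x = alpha a b (i, j) x + a (x + P (i, Suc j))"
  by (simp add: alpha_def)

text \<open>Induction on the height: each further unit square changes the expression by the
  divergence at its upper right corner, an integer.\<close>

lemma alpha_right:
  assumes "compat a b x"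
  shows "alpha a b (Suc i, j) x - alpha a b (i, j) x + b (x + P (Suc i, j)) \<in> \<int>"
proof (induction j)
  case 0 show ?case by (simp add: alpha_def)
next
  case (Suc j)
  let ?y = "x + P (Suc i, Suc j)"
  have y: "?y - e1 = x + P (i, Suc j)" "?y - e2 = x + P (Suc i, j)" by (simp_all add: P_Suc algebra_simps)
  have "a ?y - a (x + P (i, Suc j)) + (b ?y - b (x + P (Suc i, j))) \<in> \<int>"
    using assms unfolding compat_def by (metis y)
  from Ints_add[OF Suc this] show ?case unfolding alpha_up by (simp add: algebra_simps)
qed

text \<open>Path independence modulo 1: the direct path to \<open>x + P (u + v)\<close> and the one
  through \<open>x + P v\<close> enclose finitely many unit squares.\<close>

lemma alpha_cocycle:
  assumes "compat a b x"
  shows "alpha a b (u + v) x - alpha a b u (x + P v) - alpha a b v x \<in> \<int>"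
proof -
  obtain k l where v: "v = (k, l)" by force
  have c': "compat a b (x + P v)" using compat_shift assms by blast
  have row: "alpha a b ((i, 0) + v) x - alpha a b (i, 0) (x + P v) - alpha a b v x \<in> \<int>" for i
  proof (induction i)
    case 0 show ?case by (simp add: v alpha_def)
  next
    case (Suc i)
    have 1: "alpha a b (Suc (i + k), l) x - alpha a b (i + k, l) x + b (x + P (Suc (i + k), l)) \<in> \<int>"
      by (rule alpha_right[OF assms])
    have 3: "x + P v + P (Suc i, 0) = x + P (Suc (i + k), l)" by (simp add: v P_def algebra_simps)
    have 2: "alpha a b (Suc i, 0) (x + P v) - alpha a b (i, 0) (x + P v) + b (x + P (Suc (i + k), l)) \<in> \<int>"
      using alpha_right[OF c', of i 0] unfolding 3 .
    from Ints_diff[OF Ints_add[OF Suc 1] 2] show ?case by (simp add: v algebra_simps)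
  qed
  have "alpha a b ((i, j) + v) x - alpha a b (i, j) (x + P v) - alpha a b v x \<in> \<int>" for i j
  proof (induction j)
    case 0 show ?case by (rule row)
  next
    case (Suc j)
    have eq: "x + P (k, l) + P (i, Suc j) = x + P (i + k, Suc (j + l))" by (simp add: P_def algebra_simps)
    show ?case using Suc by (simp add: v alpha_up eq)
  qed
  from this[of "fst u" "snd u"] show ?thesis by simp
qed

lemma alpha_measurable:
  assumes "a \<in> borel_measurable N" "b \<in> borel_measurable N"
  shows "alpha a b v \<in> borel_measurable N"
proof -
  have "(\<lambda>x. a (x + y)) \<in> borel_measurable N" "(\<lambda>x. b (x + y)) \<in> borel_measurable N" for y
    using assms by (auto intro: measurable_compose[OF shift_measurable])
  then show ?thesis unfolding alpha_def by (intro borel_measurable_diff borel_measurable_sum)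
qed

lemma measurable_select_compose:
  fixes w :: "'a \<Rightarrow> nat \<times> nat"
  assumes w: "w \<in> measurable N (count_space UNIV)" and f: "\<And>v. f v \<in> measurable N K"
  shows "(\<lambda>x. f (w x) (x + P (w x))) \<in> measurable N K"
  by (rule measurable_compose_countable[OF _ w, of "\<lambda>v x. f v (x + P v)"])
    (rule measurable_compose[OF shift_measurable f])

end

section \<open>Nested towers\<close>

text \<open>\<open>D n\<close> bounds the total offset of the first n levels, and \<open>r n\<close>
  is required to be good relative to it. The sixth power in \<open>r_bad\<close> is made of three
  squares: one for passing from \<open>r n\<close> to the composed offset, two for the pairs of
  offsets met in \<open>core\<close>. The factor 3 counts a point and its two predecessors.\<close>

locale tower = plane_translation N Fr e1 e2
  for N :: "'a::real_vector measure" and Fr e1 e2 +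
  fixes r :: "nat \<Rightarrow> 'a \<Rightarrow> nat \<times> nat" and D :: "nat \<Rightarrow> nat"
  assumes r_measurable: "\<And>n. r n \<in> measurable N (count_space UNIV)"
    and D_0: "D 0 = 0"
    and r_box: "\<And>n x. fst (r n x) + D n \<le> D (Suc n) \<and> snd (r n x) + D n \<le> D (Suc n)"
    and r_bad: "\<And>n. 3 * (real (D n) + 2) ^ 6 * measure N (bad (r n)) \<le> (1/2) ^ n"
begin

text \<open>The next marker is chosen from the current base point, so points with a common base at
  level n share all later bases: tiles of level n + 1 are unions of tiles of level n. The tilings by
  the separate \<open>r n\<close> need not be nested.\<close>

primrec w :: "nat \<Rightarrow> 'a \<Rightarrow> nat \<times> nat" where
  "w 0 x = 0"
| "w (Suc n) x = w n x + r n (x + P (w n x))"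

abbreviation base :: "nat \<Rightarrow> 'a \<Rightarrow> 'a" where "base n x \<equiv> x + P (w n x)"

abbreviation box :: "nat \<Rightarrow> (nat \<times> nat) set" where "box m \<equiv> {..m} \<times> {..m}"

lemma w_box: "w n x \<in> box (D n)"
proof (induction n)
  case (Suc n)
  then show ?case using r_box[of n "base n x"] by (auto simp: mem_Times_iff)
qed (simp add: D_0 zero_prod_def)

lemma w_measurable: "w n \<in> measurable N (count_space UNIV)"
proof (induction n)
  case (Suc n)
  have "(\<lambda>x. r n (base n x)) \<in> measurable N (count_space UNIV)"
    using measurable_select_compose[OF Suc, of "\<lambda>_. r n"] r_measurable by simp
  from measurable_count_space_compose2[OF Suc this, where h = "(+)"] show ?case by simp
qed simp

lemma w_bad_sets: "bad (w n) \<in> sets N"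
  by (rule bad_sets[OF w_measurable])

lemma not_bad_same_base:
  assumes "x \<notin> bad (w n)"
  shows "base n (x + e1) = base n x" "base n (x + e2) = base n x"
    "w n x = w n (x + e1) + (1, 0)" "w n x = w n (x + e2) + (0, 1)"
proof -
  show 1: "w n x = w n (x + e1) + (1, 0)" "w n x = w n (x + e2) + (0, 1)"
    using assms by (auto simp: bad_def)
  have "P (w n x) = P (w n (x + e1)) + e1" "P (w n x) = P (w n (x + e2)) + e2"
    by (subst 1, simp add: P_add)+
  then show "base n (x + e1) = base n x" "base n (x + e2) = base n x"
    by (simp_all add: algebra_simps)
qed

text \<open>If \<open>r n\<close> has no bad point in the square of side \<open>D n + 1\<close>
  ahead of \<open>x\<close>, every base point that \<open>x\<close>, \<open>x + e1\<close> or
  \<open>x + e2\<close> can have at level n leads to the same next marker. The extra 1 accounts for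
  the neighbours.\<close>

lemma bad_Suc_subset: "bad (w (Suc n)) \<subseteq> (\<Union>v\<in>box (D n + 1). {x. x + P v \<in> bad (r n)})"
proof (rule ccontr)
  assume "\<not> ?thesis"
  then obtain x where x: "x \<in> bad (w (Suc n))" "\<And>v. v \<in> box (D n + 1) \<Longrightarrow> x + P v \<notin> bad (r n)" by auto
  have e: "x + P (i, j) + e1 = x + P (Suc i, j)" "x + P (i, j) + e2 = x + P (i, Suc j)" for i j
    by (simp_all add: P_Suc algebra_simps)
  have row: "r n (x + P (i, 0)) + (i, 0) = r n x" if "i \<le> D n + 1" for i
    using that
  proof (induction i)
    case (Suc i)
    have "x + P (i, 0) \<notin> bad (r n)" using Suc.prems by (intro x(2)) auto
    then have "r n (x + P (i, 0)) = r n (x + P (Suc i, 0)) + (1, 0)" by (simp add: bad_def e)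
    then show ?case using Suc by (metis (no_types, lifting) Suc_leD add.assoc add_Pair plus_1_eq_Suc add_0)
  qed (simp add: zero_prod_def[symmetric])
  have all: "r n (x + P (i, j)) + (i, j) = r n x" if "i \<le> D n + 1" "j \<le> D n + 1" for i j
    using that(2)
  proof (induction j)
    case 0 then show ?case using row that by simp
  next
    case (Suc j)
    have "x + P (i, j) \<notin> bad (r n)" using Suc.prems that by (intro x(2)) auto
    then have "r n (x + P (i, j)) = r n (x + P (i, Suc j)) + (0, 1)" by (simp add: bad_def e)
    then show ?case using Suc by (metis (no_types, lifting) Suc_leD add.assoc add_Pair plus_1_eq_Suc add_0)
  qed
  have all': "v + r n (x + P v) = r n x" if "v \<in> box (D n + 1)" for v
    using all[of "fst v" "snd v"] that by (auto simp: add.commute)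
  have "w (Suc n) x = r n x" using all'[of "w n x"] w_box[of n x] by auto
  moreover have "w (Suc n) (x + P d) + d = r n x" if d: "d = (1, 0) \<or> d = (0, 1)" for d
  proof -
    have "w n (x + P d) + d \<in> box (D n + 1)" using w_box[of n "x + P d"] d by (auto simp: mem_Times_iff)
    from all'[OF this] show ?thesis by (simp add: P_add algebra_simps)
  qed
  from this[of "(1, 0)"] this[of "(0, 1)"] have "w (Suc n) (x + e1) + (1, 0) = r n x" "w (Suc n) (x + e2) + (0, 1) = r n x"
    by (simp_all del: w.simps)
  ultimately show False using x(1) by (auto simp: bad_def simp del: w.simps)
qed

text \<open>Testing a whole square around the tile instead of \<open>x\<close> alone makes the
  condition depend on \<open>base n x\<close> only, so the core is a union of tiles of level n.
  Predecessors are tested too, in order to cover edges that enter the tile.\<close>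

fun core :: "nat \<Rightarrow> 'a set" where
  "core 0 = {}"
| "core (Suc n) = {x. \<forall>v\<in>box (D n). base n x - P v \<notin> bad (w (Suc n)) \<and>
     base n x - P v - e1 \<notin> bad (w (Suc n)) \<and> base n x - P v - e2 \<notin> bad (w (Suc n))}"

lemma core_not_bad:
  assumes "x \<in> core n"
  shows "x \<notin> bad (w n)" "x - e1 \<notin> bad (w n)" "x - e2 \<notin> bad (w n)"
proof -
  obtain m where n: "n = Suc m" using assms by (cases n) auto
  show "x \<notin> bad (w n)" "x - e1 \<notin> bad (w n)" "x - e2 \<notin> bad (w n)"
    using assms w_box[of m x] unfolding n core.simps by (force simp del: w.simps)+
qed

lemma core_Suc_cong: "base n x = base n y \<Longrightarrow> x \<in> core (Suc n) \<longleftrightarrow> y \<in> core (Suc n)"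
  by (simp del: w.simps)

lemma core_complement_subset:
  "- core (Suc n) \<subseteq> (\<Union>u\<in>box (D n). \<Union>v\<in>box (D n). \<Union>f\<in>{0, e1, e2}. {x. x + (P u - P v - f) \<in> bad (w (Suc n))})"
proof
  fix x assume "x \<in> - core (Suc n)"
  then obtain v where v: "v \<in> box (D n)" "base n x - P v \<in> bad (w (Suc n)) \<or>
     base n x - P v - e1 \<in> bad (w (Suc n)) \<or> base n x - P v - e2 \<in> bad (w (Suc n))"
    unfolding core.simps by blast
  have "\<exists>f\<in>{0, e1, e2}. base n x - P v - f \<in> bad (w (Suc n))"
    using v(2) by (auto simp del: w.simps)
  then obtain f where "f \<in> {0, e1, e2}" "base n x - P v - f \<in> bad (w (Suc n))" by blast
  with v(1) show "x \<in> (\<Union>u\<in>box (D n). \<Union>v\<in>box (D n). \<Union>f\<in>{0, e1, e2}. {x. x + (P u - P v - f) \<in> bad (w (Suc n))})"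
    using w_box[of n x] by (intro UN_I[of "w n x"] UN_I[of v] UN_I[of f]) (simp_all add: algebra_simps del: w.simps)
qed

lemma core_sets: "core n \<in> sets N"
proof (cases n)
  case (Suc m)
  have *: "{x \<in> space N. base m x - y \<notin> bad (w (Suc m))} \<in> sets N" for y
  proof -
    have "{x \<in> space N. base m x - y \<notin> bad (w (Suc m))} = (\<lambda>x. base m x) -` (- {z. z - y \<in> bad (w (Suc m))}) \<inter> space N"
      by auto
    also have "\<dots> \<in> sets N"
    proof (rule measurable_sets)
      show "(\<lambda>x. base m x) \<in> measurable N N"
        using measurable_select_compose[OF w_measurable, of "\<lambda>_ x. x" N] by simp
      show "- {z. z - y \<in> bad (w (Suc m))} \<in> sets N"
        using sets.compl_sets[OF shift_minus_sets[OF w_bad_sets, of y]] by (simp add: Compl_eq_Diff_UNIV del: w.simps)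
    qed
    finally show ?thesis .
  qed
  have "{x \<in> space N. \<forall>v\<in>box (D m). base m x - P v \<notin> bad (w (Suc m)) \<and>
     base m x - P v - e1 \<notin> bad (w (Suc m)) \<and> base m x - P v - e2 \<notin> bad (w (Suc m))} \<in> sets N"
    unfolding diff_diff_add
    by (intro sets.sets_Collect_finite_All' sets.sets_Collect_conj * finite_SigmaI finite_atMost) (auto)
  then show ?thesis using Suc by simp
qed simp

lemma core_complement_measure: "measure N (- core (Suc n)) \<le> (1/2) ^ n"
proof -
  let ?d = "real (D n) + 2"
  have sb: "{x. x + y \<in> bad (w (Suc n))} \<in> sets N" for y by (rule shift_sets[OF w_bad_sets])
  have m1: "measure N (bad (w (Suc n))) \<le> ?d ^ 2 * measure N (bad (r n))"
  proof -
    have "measure N (bad (w (Suc n))) \<le> measure N (\<Union>v\<in>box (D n + 1). {x. x + P v \<in> bad (r n)})"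
      by (intro finite_measure_mono bad_Suc_subset sets.finite_UN shift_sets bad_sets r_measurable) simp
    also have "\<dots> \<le> card (box (D n + 1)) * measure N (bad (r n))"
      by (rule measure_finite_Union_le) (auto intro!: shift_sets bad_sets r_measurable simp: measure_shift[OF bad_sets[OF r_measurable]])
    also have "\<dots> = ?d ^ 2 * measure N (bad (r n))"
      by (simp add: card_cartesian_product power2_eq_square algebra_simps)
    finally show ?thesis .
  qed
  let ?m = "measure N (bad (w (Suc n)))"
  have "measure N (- core (Suc n)) \<le> measure N (\<Union>u\<in>box (D n). \<Union>v\<in>box (D n). \<Union>f\<in>{0, e1, e2}. {x. x + (P u - P v - f) \<in> bad (w (Suc n))})"
    by (intro finite_measure_mono core_complement_subset sets.finite_UN sb) auto
  also have "\<dots> \<le> card (box (D n)) * (card (box (D n)) * (card {0, e1, e2} * ?m))"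
    by (intro measure_finite_Union_le sets.finite_UN sb) (auto simp: measure_shift[OF w_bad_sets] simp del: w.simps)
  also have "\<dots> \<le> ?d ^ 2 * (?d ^ 2 * (3 * (?d ^ 2 * measure N (bad (r n)))))"
  proof (intro mult_mono)
    have c: "card (box (D n)) \<le> (D n + 2) ^ 2" by (simp add: card_cartesian_product power2_eq_square)
    show "real (card (box (D n))) \<le> ?d ^ 2" 
      using of_nat_mono[OF c, where 'a = real] unfolding of_nat_power of_nat_add of_nat_numeral .
    then show "real (card (box (D n))) \<le> ?d ^ 2" .
    show "real (card {0, e1, e2}) \<le> 3" using card_insert_le_m1[of 3 "{e1, e2}" 0] card_insert_le_m1[of 2 "{e2}" e1] by simp
  qed (use m1 in \<open>auto simp del: w.simps\<close>)
  also have "\<dots> = 3 * ?d ^ 6 * measure N (bad (r n))"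
    by (simp add: power_numeral_reduce algebra_simps)
  also have "\<dots> \<le> (1/2) ^ n" by (rule r_bad)
  finally show ?thesis .
qed

lemma AE_eventually_core: "AE x in N. eventually (\<lambda>n. x \<in> core n) sequentially"
proof -
  have c: "- core n \<in> sets N" for n
    using sets.compl_sets[OF core_sets[of n]] by (simp add: Compl_eq_Diff_UNIV)
  have s: "summable (\<lambda>n. (1/2::real) ^ n)" by (rule summable_geometric) simp
  have "AE x in N. \<forall>\<^sub>F n in sequentially. x \<notin> - core (Suc n)"
    by (rule AE_eventually_notin[OF c s core_complement_measure])
  then show ?thesis
  proof eventually_elim
    case (elim x)
    then show ?case using eventually_sequentially_Suc[of "\<lambda>n. x \<in> core n"] by (simp del: core.simps)
  qed
qed


section \<open>Real lifts of the potential with bounded increments\<close>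

text \<open>A real lift of the potential at \<open>x\<close> relative to the base point of level n.
  On the core, changing the base adds a number that is constant on each tile of level n, so
  increments already fixed inside a tile persist. Off the core the value is reset to [0,1), which
  prevents errors from accumulating.\<close>

fun pot :: "('a \<Rightarrow> real) \<Rightarrow> ('a \<Rightarrow> real) \<Rightarrow> nat \<Rightarrow> 'a \<Rightarrow> real" where
  "pot a b 0 x = 0"
| "pot a b (Suc n) x = (if x \<in> core n then pot a b n x + frac (- alpha a b (r n (base n x)) (base n x))
     else frac (- alpha a b (w (Suc n) x) x))"

lemma pot_measurable:
  assumes "a \<in> borel_measurable N" "b \<in> borel_measurable N"
  shows "pot a b n \<in> borel_measurable N"
proof (induction n)
  case (Suc n)
  have al: "alpha a b v \<in> borel_measurable N" for v by (rule alpha_measurable[OF assms])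
  have fr: "(\<lambda>x. frac (- f x)) \<in> borel_measurable N" if "f \<in> borel_measurable N" for f :: "'a \<Rightarrow> real"
    unfolding frac_def using that by measurable
  have "(\<lambda>x. alpha a b (r n x) x) \<in> borel_measurable N"
    by (rule measurable_compose_countable[OF al r_measurable])
  then have "(\<lambda>x. alpha a b (r n (base n x)) (base n x)) \<in> borel_measurable N"
    using measurable_select_compose[OF w_measurable, of "\<lambda>_ x. alpha a b (r n x) x" borel] by simp
  moreover have "(\<lambda>x. alpha a b (w (Suc n) x) x) \<in> borel_measurable N"
    by (rule measurable_compose_countable[OF al w_measurable])
  moreover have "{x \<in> space N. x \<in> core n} \<in> sets N" using core_sets[of n] by simp
  ultimately show ?case
    unfolding pot.simps by (intro measurable_If borel_measurable_add Suc fr)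
qed simp

lemma pot_alpha:
  assumes "compat a b x"
  shows "pot a b n x + alpha a b (w n x) x \<in> \<int>"
proof (induction n)
  case (Suc n)
  have fr: "frac (- t) + t \<in> \<int>" for t :: real by (simp add: frac_def)
  show ?case
  proof (cases "x \<in> core n")
    case True
    let ?r = "r n (base n x)"
    have "alpha a b (?r + w n x) x - alpha a b ?r (base n x) - alpha a b (w n x) x \<in> \<int>"
      by (rule alpha_cocycle[OF assms])
    from Ints_add[OF Ints_add[OF Suc fr[of "alpha a b ?r (base n x)"]] this]
    show ?thesis using True by (simp add: add.commute)
  next
    case False
    then show ?thesis using fr by (simp del: w.simps)
  qed
qed simp

lemma pot_same_core:
  assumes "e = e1 \<or> e = e2" "x \<in> core n" "x + e \<in> core n"
  shows "pot a b (Suc n) (x + e) - pot a b (Suc n) x = pot a b n (x + e) - pot a b n x"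
proof -
  have eq: "base n (x + e) = base n x"
    using assms(1) not_bad_same_base[OF core_not_bad(1)[OF assms(2)]] by auto
  show ?thesis unfolding pot.simps using assms(2,3) by (simp only: if_True eq)
qed

text \<open>The critical edge has exactly one end in \<open>core n\<close>. Such an edge joins
  different tiles of the previous level, so neither end was in the core one step earlier and both
  values were then reset to [0,1). The end in the core gains less than 1 since, and the other end is
  reset again.\<close>

lemma pot_increment:
  assumes e: "e = e1 \<or> e = e2"
  shows "\<bar>pot a b n (x + e) - pot a b n x\<bar> \<le> 2"
proof (induction n)
  case (Suc n)
  have out: "0 \<le> pot a b (Suc m) y \<and> pot a b (Suc m) y < 1" if "y \<notin> core m" for m y
    using that by (simp add: frac_ge_0 frac_lt_1)
  have inn: "0 \<le> pot a b (Suc n) y \<and> pot a b (Suc n) y < 2"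
    if "n = Suc m" "y \<in> core n" "y \<notin> core m" for m y
    using that(2) out[OF that(3)] frac_ge_0[of "- alpha a b (r n (base n y)) (base n y)"]
      frac_lt_1[of "- alpha a b (r n (base n y)) (base n y)"]
    unfolding that(1) pot.simps(2)[of _ _ "Suc m"] by (simp del: pot.simps core.simps w.simps)
  show ?case
  proof (cases "x \<in> core n \<longleftrightarrow> x + e \<in> core n")
    case True
    show ?thesis
    proof (cases "x \<in> core n")
      case in_core: True
      then show ?thesis using pot_same_core[OF e in_core] True Suc by simp
    next
      case False
      then show ?thesis using out[of x n] out[of "x + e" n] True by linarith
    qed
  next
    case False
    then obtain m where n: "n = Suc m" by (cases n) auto
    have neq: "base m (x + e) \<noteq> base m x" using core_Suc_cong[where n = m and x = "x + e" and y = x] False unfolding n by blast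
    have "x \<notin> core m" using not_bad_same_base[OF core_not_bad(1)[of x m]] neq e by auto
    moreover have "x + e \<notin> core m"
    proof
      assume "x + e \<in> core m"
      then have "x \<notin> bad (w m)" using core_not_bad(2,3)[of "x + e" m] e by auto
      then show False using not_bad_same_base[of x m] neq e by auto
    qed
    ultimately show ?thesis
      using False out[of x n] out[of "x + e" n] inn[OF n, of x] inn[OF n, of "x + e"] by linarith
  qed
qed simp

lemma pot_int_e1:
  assumes "compat a b (x - e1)" "x - e1 \<in> core n"
  shows "b x + (pot a b n x - pot a b n (x - e1)) \<in> \<int>"
proof -
  have c: "compat a b x" using compat_shift[OF assms(1), of "(1, 0)"] by simp
  have "x - e1 \<notin> bad (w n)" by (rule core_not_bad[OF assms(2)])
  from not_bad_same_base(3)[OF this] have w: "w n (x - e1) = w n x + (1, 0)" by simp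
  have 1: "alpha a b (w n (x - e1)) (x - e1) - alpha a b (w n x) x - alpha a b (1, 0) (x - e1) \<in> \<int>"
    using alpha_cocycle[OF assms(1), of "w n x" "(1, 0)"] by (simp add: w)
  have 2: "alpha a b (1, 0) (x - e1) = - b x" by (simp add: alpha_def)
  from Ints_add[OF Ints_diff[OF pot_alpha[OF c, of n] pot_alpha[OF assms(1), of n]] 1]
  show ?thesis unfolding 2 by (simp add: algebra_simps)
qed

lemma pot_int_e2:
  assumes "compat a b (x - e2)" "x - e2 \<in> core n"
  shows "a x - (pot a b n x - pot a b n (x - e2)) \<in> \<int>"
proof -
  have c: "compat a b x" using compat_shift[OF assms(1), of "(0, 1)"] by simp
  have "x - e2 \<notin> bad (w n)" by (rule core_not_bad[OF assms(2)])
  from not_bad_same_base(4)[OF this] have w: "w n (x - e2) = w n x + (0, 1)" by simp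
  have 1: "alpha a b (w n (x - e2)) (x - e2) - alpha a b (w n x) x - alpha a b (0, 1) (x - e2) \<in> \<int>"
    using alpha_cocycle[OF assms(1), of "w n x" "(0, 1)"] by (simp add: w)
  have 2: "alpha a b (0, 1) (x - e2) = a x" by (simp add: alpha_def)
  from Ints_minus[OF Ints_add[OF Ints_diff[OF pot_alpha[OF c, of n] pot_alpha[OF assms(1), of n]] 1]]
  show ?thesis unfolding 2 by (simp add: algebra_simps)
qed

text \<open>Almost every edge eventually lies in all cores, so the increments of \<open>pot\<close>
  stabilise. As limits of gradients, \<open>c1\<close> and \<open>c2\<close> satisfy the closedness
  relation; hence the rotated field (-c2, c1), added to (a, b), makes it integral and leaves its
  divergence unchanged.\<close>

lemma rounding:
  fixes a b :: "'a \<Rightarrow> real"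
  assumes a: "a \<in> borel_measurable N" and b: "b \<in> borel_measurable N"
    and ab: "AE x in N. a x - a (x - e1) + (b x - b (x - e2)) \<in> \<int>"
  obtains c1 c2 where "c1 \<in> borel_measurable N" "c2 \<in> borel_measurable N"
    "AE x in N. \<bar>c1 x\<bar> \<le> 2 \<and> \<bar>c2 x\<bar> \<le> 2"
    "AE x in N. b x + c1 x \<in> \<int> \<and> a x - c2 x \<in> \<int>"
    "AE x in N. c2 x - c2 (x - e1) = c1 x - c1 (x - e2)"
proof -
  let ?S = "pot a b"
  define c where "c = (\<lambda>e x. lim (\<lambda>n. ?S n x - ?S n (x - e)))"
  have cm: "c e \<in> borel_measurable N" for e
    unfolding c_def
    by (intro borel_measurable_lim_metric borel_measurable_diff measurable_compose[OF shift_minus_measurable]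
        pot_measurable[OF a b])
  have cp: "AE x in N. compat a b x"
    unfolding compat_def AE_all_countable by (intro allI AE_shift[OF ab])
  have val: "\<exists>K. \<forall>n\<ge>K. c e x = ?S n x - ?S n (x - e)"
    if e: "e = e1 \<or> e = e2" and ev: "\<forall>\<^sub>F n in sequentially. x \<in> core n" "\<forall>\<^sub>F n in sequentially. x - e \<in> core n" for e x
  proof -
    from eventually_conj[OF ev] obtain K where K: "\<And>n. n \<ge> K \<Longrightarrow> x \<in> core n \<and> x - e \<in> core n"
      unfolding eventually_sequentially by blast
    have const: "?S n x - ?S n (x - e) = ?S K x - ?S K (x - e)" if "n \<ge> K" for n
      using that
    proof (induction n rule: dec_induct)
      case (step n)
      then show ?case using pot_same_core[OF e, of "x - e" n a b] K[of n] by simp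
    qed simp
    have "(\<lambda>n. ?S n x - ?S n (x - e)) \<longlonglongrightarrow> ?S K x - ?S K (x - e)"
    proof (rule tendsto_eventually)
      show "\<forall>\<^sub>F n in sequentially. ?S n x - ?S n (x - e) = ?S K x - ?S K (x - e)"
        unfolding eventually_sequentially by (intro exI[of _ K] allI impI const)
    qed
    then have ceq: "c e x = ?S K x - ?S K (x - e)" unfolding c_def by (rule limI)
    show ?thesis by (intro exI[of _ K] allI impI trans[OF ceq sym[OF const]])
  qed
  note core = AE_eventually_core
  show thesis
  proof
    show "c e1 \<in> borel_measurable N" "c e2 \<in> borel_measurable N" by (rule cm)+
    show "AE x in N. \<bar>c e1 x\<bar> \<le> 2 \<and> \<bar>c e2 x\<bar> \<le> 2"
      using core AE_shift_minus[OF core, of e1] AE_shift_minus[OF core, of e2]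
    proof eventually_elim
      case (elim x)
      obtain K1 where K1: "c e1 x = ?S K1 x - ?S K1 (x - e1)" using val[of e1 x] elim by blast
      obtain K2 where K2: "c e2 x = ?S K2 x - ?S K2 (x - e2)" using val[of e2 x] elim by blast
      show ?case using pot_increment[of e1 a b K1 "x - e1"] pot_increment[of e2 a b K2 "x - e2"] K1 K2 by simp
    qed
    show "AE x in N. b x + c e1 x \<in> \<int> \<and> a x - c e2 x \<in> \<int>"
      using core AE_shift_minus[OF core, of e1] AE_shift_minus[OF core, of e2]
        AE_shift_minus[OF cp, of e1] AE_shift_minus[OF cp, of e2]
    proof eventually_elim
      case (elim x)
      obtain K1 where K1: "\<And>n. n \<ge> K1 \<Longrightarrow> c e1 x = ?S n x - ?S n (x - e1)" using val[of e1 x] elim by blast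
      obtain K2 where K2: "\<And>n. n \<ge> K2 \<Longrightarrow> c e2 x = ?S n x - ?S n (x - e2)" using val[of e2 x] elim by blast
      from eventually_conj[OF elim(2,3)] obtain K where K: "\<And>n. n \<ge> K \<Longrightarrow> x - e1 \<in> core n \<and> x - e2 \<in> core n"
        unfolding eventually_sequentially by blast
      define n where "n = max K (max K1 K2)"
      show ?case
        using pot_int_e1[OF elim(4), of n] pot_int_e2[OF elim(5), of n] K[of n] K1[of n] K2[of n]
        by (simp add: n_def)
    qed
    show "AE x in N. c e2 x - c e2 (x - e1) = c e1 x - c e1 (x - e2)"
      using core AE_shift_minus[OF core, of e1] AE_shift_minus[OF core, of e2] AE_shift_minus[OF core, of "e1 + e2"]
    proof eventually_elim
      case (elim x)
      have x12: "x - e1 - e2 = x - (e1 + e2)" "x - e2 - e1 = x - (e1 + e2)" by (simp_all add: algebra_simps)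
      obtain K1 where K1: "\<And>n. n \<ge> K1 \<Longrightarrow> c e2 x = ?S n x - ?S n (x - e2)" using val[of e2 x] elim by blast
      obtain K2 where K2: "\<And>n. n \<ge> K2 \<Longrightarrow> c e2 (x - e1) = ?S n (x - e1) - ?S n (x - (e1 + e2))"
        using val[of e2 "x - e1"] elim unfolding x12 by blast
      obtain K3 where K3: "\<And>n. n \<ge> K3 \<Longrightarrow> c e1 x = ?S n x - ?S n (x - e1)" using val[of e1 x] elim by blast
      obtain K4 where K4: "\<And>n. n \<ge> K4 \<Longrightarrow> c e1 (x - e2) = ?S n (x - e2) - ?S n (x - (e1 + e2))"
        using val[of e1 "x - e2"] elim unfolding x12 by blast
      define n where "n = max (max K1 K2) (max K3 K4)"
      show ?case using K1[of n] K2[of n] K3[of n] K4[of n] by (simp add: n_def)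
    qed
  qed
qed

end

section \<open>Existence of nested towers\<close>

context plane_translation
begin

lemma rokhlin_small_bad:
  assumes "0 < (\<epsilon>::real)"
  shows "\<exists>n r. r \<in> measurable N (count_space UNIV) \<and> (\<forall>x. r x \<in> {..n} \<times> {..n}) \<and> measure N (bad r) \<le> \<epsilon>"
proof -
  define M where "M = measure N UNIV"
  have M: "0 \<le> M" by (simp add: M_def)
  \<comment> \<open>\<open>rokhlin\<close> bounds the bad set by 4(2n+1)M/(n+1)^2, which is at most
    8M/(n+1).\<close>
  obtain n :: nat where n: "8 * M / \<epsilon> < real n" using reals_Archimedean2 by blast
  obtain B r where B: "measure N B * (real n + 1)\<^sup>2 \<le> M"
    and r: "r \<in> measurable N (count_space UNIV)" "\<And>x. r x \<in> {..2*n} \<times> {..2*n}"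
    and bad: "measure N (bad r) \<le> 4 * (2 * real n + 1) * measure N B"
    unfolding M_def by (rule rokhlin[of n]) blast
  have "4 * (2 * real n + 1) * measure N B * (real n + 1) \<le> 8 * (measure N B * (real n + 1)\<^sup>2)"
    by (simp add: power2_eq_square algebra_simps)
  also have "\<dots> \<le> 8 * M" using B by simp
  also have "\<dots> \<le> \<epsilon> * (real n + 1)" using n assms by (simp add: field_simps)
  finally have "4 * (2 * real n + 1) * measure N B \<le> \<epsilon>"
    by (simp add: mult_le_cancel_right)
  then show ?thesis using r bad by (intro exI[of _ "2 * n"] exI[of _ r]) auto
qed

lemma tower_exists: "\<exists>r D. tower N Fr e1 e2 r D"
proof -
  have "\<forall>\<epsilon>::real. \<exists>n r. 0 < \<epsilon> \<longrightarrow> r \<in> measurable N (count_space UNIV) \<and> (\<forall>x. r x \<in> {..n} \<times> {..n}) \<and> measure N (bad r) \<le> \<epsilon>"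
    using rokhlin_small_bad by blast
  then obtain nn rr where R: "\<And>\<epsilon>::real. 0 < \<epsilon> \<Longrightarrow> rr \<epsilon> \<in> measurable N (count_space UNIV) \<and>
      (\<forall>x. rr \<epsilon> x \<in> {..nn \<epsilon>} \<times> {..nn \<epsilon> :: nat}) \<and> measure N (bad (rr \<epsilon>)) \<le> \<epsilon>"
    by metis
  define \<epsilon> where "\<epsilon> = (\<lambda>n d. (1/2) ^ n / (3 * (real d + 2) ^ 6))"
  have \<epsilon>: "0 < \<epsilon> n d" for n d by (simp add: \<epsilon>_def)
  \<comment> \<open>The tolerance for the next tower depends on \<open>D n\<close>, so it can only
    be fixed once the previous towers, and with them \<open>D n\<close>, are known.\<close>
  define D where "D = rec_nat 0 (\<lambda>n d. d + nn (\<epsilon> n d))"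
  have D: "D 0 = 0" "D (Suc n) = D n + nn (\<epsilon> n (D n))" for n by (simp_all add: D_def)
  define r where "r = (\<lambda>n. rr (\<epsilon> n (D n)))"
  have "tower N Fr e1 e2 r D"
  proof
    fix n x
    show "r n \<in> measurable N (count_space UNIV)" unfolding r_def using R \<epsilon> by blast
    show "D 0 = 0" by (rule D)
    show "fst (r n x) + D n \<le> D (Suc n) \<and> snd (r n x) + D n \<le> D (Suc n)"
      using R[OF \<epsilon>[of n "D n"]] unfolding r_def D(2) by (auto simp: mem_Times_iff)
    have "measure N (bad (r n)) \<le> \<epsilon> n (D n)" unfolding r_def using R \<epsilon> by blast
    moreover have "0 < 3 * (real (D n) + 2) ^ 6" by simp
    ultimately show "3 * (real (D n) + 2) ^ 6 * measure N (bad (r n)) \<le> (1/2) ^ n"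
      unfolding \<epsilon>_def by (simp only: pos_le_divide_eq mult.commute)
  qed
  then show ?thesis by blast
qed

lemma plane_rounding:
  fixes a b :: "'a \<Rightarrow> real"
  assumes "a \<in> borel_measurable N" "b \<in> borel_measurable N"
    and "AE x in N. a x - a (x - e1) + (b x - b (x - e2)) \<in> \<int>"
  obtains c1 c2 where "c1 \<in> borel_measurable N" "c2 \<in> borel_measurable N"
    "AE x in N. \<bar>c1 x\<bar> \<le> 2 \<and> \<bar>c2 x\<bar> \<le> 2"
    "AE x in N. b x + c1 x \<in> \<int> \<and> a x - c2 x \<in> \<int>"
    "AE x in N. c2 x - c2 (x - e1) = c1 x - c1 (x - e2)"
proof -
  obtain r D where "tower N Fr e1 e2 r D" using tower_exists by blast
  then interpret tower N Fr e1 e2 r D .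
  show thesis by (rule rounding[OF assms]) (rule that)
qed

end

section \<open>Rounding in any number of directions\<close>

context finite_free_translation
begin

text \<open>For each further direction \<open>k\<close>, \<open>coboundary\<close> writes
  \<open>\<phi> k\<close> as a divergence in the plane of \<open>i1\<close> and \<open>i2\<close>.
  Subtracting from \<open>\<phi> k\<close> only the divergence of the fractional parts leaves
  integers, and these are bounded because \<open>\<phi> k\<close> and fractional parts are. What is
  removed from direction \<open>k\<close> is added to \<open>i1\<close> and \<open>i2\<close>;
  translations commute, so the total divergence is unchanged and only these two directions remain to
  be rounded.\<close>

lemma integer_flow:
  fixes e :: "'i \<Rightarrow> 'a" and \<phi> :: "'i \<Rightarrow> 'a \<Rightarrow> real"
  assumes fin: "finite I"
    and free: "\<And>z::'i \<Rightarrow> int. \<exists>i\<in>I. z i \<noteq> 0 \<Longrightarrow> (\<Sum>i\<in>I. of_int (z i) *\<^sub>R e i) \<in> Fr"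
    and \<phi>: "\<And>i. i \<in> I \<Longrightarrow> \<phi> i \<in> borel_measurable N"
    and bd: "\<And>i. i \<in> I \<Longrightarrow> AE x in N. \<bar>\<phi> i x\<bar> \<le> C"
    and int: "AE x in N. (\<Sum>i\<in>I. \<phi> i x - \<phi> i (x - e i)) \<in> \<int>"
  obtains A C' where "\<And>i. i \<in> I \<Longrightarrow> A i \<in> borel_measurable N"
    "\<And>i. i \<in> I \<Longrightarrow> AE x in N. \<bar>A i x\<bar> \<le> C'" "\<And>i. i \<in> I \<Longrightarrow> AE x in N. A i x \<in> \<int>"
    "AE x in N. (\<Sum>i\<in>I. A i x - A i (x - e i)) = (\<Sum>i\<in>I. \<phi> i x - \<phi> i (x - e i))"
proof (cases "\<exists>i1\<in>I. \<exists>i2\<in>I. i1 \<noteq> i2")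
  case False
  then consider "I = {}" | i where "I = {i}" by blast
  then show thesis
  proof cases
    case 1
    then show thesis using that[of \<phi> C] by simp
  next
    case (2 i)
    have [measurable]: "\<phi> i \<in> borel_measurable N" using \<phi> 2 by blast
    have m: "(\<lambda>x. real_of_int \<lfloor>\<phi> i x\<rfloor>) \<in> borel_measurable N" by measurable
    have b: "AE x in N. \<bar>real_of_int \<lfloor>\<phi> i x\<rfloor>\<bar> \<le> C + 1"
      using bd[of i] 2 by (auto elim!: eventually_mono) linarith
    \<comment> \<open>With a single direction, the values of \<phi> at consecutive points differ by
      an integer, so taking floors preserves their difference.\<close>
    have "AE x in N. real_of_int \<lfloor>\<phi> i x\<rfloor> - real_of_int \<lfloor>\<phi> i (x - e i)\<rfloor> = \<phi> i x - \<phi> i (x - e i)"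
      using int
    proof eventually_elim
      case (elim x)
      then obtain z where z: "\<phi> i x = \<phi> i (x - e i) + of_int z"
        using 2 by (auto elim!: Ints_cases simp: algebra_simps)
      show ?case unfolding z by simp
    qed
    then show thesis using that[of "\<lambda>j x. real_of_int \<lfloor>\<phi> i x\<rfloor>" "C + 1"] 2 m b by simp
  qed
next
  case True
  then obtain i1 i2 where i: "i1 \<in> I" "i2 \<in> I" "i1 \<noteq> i2" by blast
  interpret pl: plane_translation N Fr "e i1" "e i2"
  proof unfold_locales
    fix a b :: int assume ab: "(a, b) \<noteq> (0, 0)"
    define z where "z = (\<lambda>k. if k = i1 then a else if k = i2 then b else 0)"
    have "(\<Sum>k\<in>I. of_int (z k) *\<^sub>R e k) = (\<Sum>k\<in>{i1, i2}. of_int (z k) *\<^sub>R e k)"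
      using i fin by (intro sum.mono_neutral_right) (auto simp: z_def)
    also have "\<dots> = of_int a *\<^sub>R e i1 + of_int b *\<^sub>R e i2" using i by (simp add: z_def)
    finally have s: "(\<Sum>k\<in>I. of_int (z k) *\<^sub>R e k) = of_int a *\<^sub>R e i1 + of_int b *\<^sub>R e i2" .
    have "z i1 \<noteq> 0 \<or> z i2 \<noteq> 0" using ab i(3) by (auto simp: z_def)
    then have "\<exists>k\<in>I. z k \<noteq> 0" using i by blast
    from free[OF this] show "of_int a *\<^sub>R e i1 + of_int b *\<^sub>R e i2 \<in> Fr" unfolding s .
  qed
  define J where "J = I - {i1, i2}"
  have J: "finite J" "J \<subseteq> I" "i1 \<notin> J" "i2 \<notin> J" "I = insert i1 (insert i2 J)" using fin i by (auto simp: J_def)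
  have exH: "\<forall>k\<in>J. \<exists>H. fst H \<in> borel_measurable N \<and> snd H \<in> borel_measurable N \<and>
    (AE x in N. \<phi> k x = fst H x - fst H (x - e i1) + (snd H x - snd H (x - e i2)))"
  proof
    fix k assume "k \<in> J"
    then have "\<phi> k \<in> borel_measurable N" using J \<phi> by blast
    then obtain H1 H2 where "H1 \<in> borel_measurable N" "H2 \<in> borel_measurable N"
      "AE x in N. \<phi> k x = H1 x - H1 (x - e i1) + (H2 x - H2 (x - e i2))"
      by (rule pl.coboundary)
    then show "\<exists>H. fst H \<in> borel_measurable N \<and> snd H \<in> borel_measurable N \<and>
      (AE x in N. \<phi> k x = fst H x - fst H (x - e i1) + (snd H x - snd H (x - e i2)))"
      by (intro exI[of _ "(H1, H2)"]) simp
  qed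
  from bchoice[OF exH] obtain H where H0: "\<forall>k\<in>J. fst (H k) \<in> borel_measurable N \<and> snd (H k) \<in> borel_measurable N \<and>
    (AE x in N. \<phi> k x = fst (H k) x - fst (H k) (x - e i1) + (snd (H k) x - snd (H k) (x - e i2)))" ..
  have H: "\<And>k. k \<in> J \<Longrightarrow> fst (H k) \<in> borel_measurable N"
    "\<And>k. k \<in> J \<Longrightarrow> snd (H k) \<in> borel_measurable N"
    "\<And>k. k \<in> J \<Longrightarrow> AE x in N. \<phi> k x = fst (H k) x - fst (H k) (x - e i1) + (snd (H k) x - snd (H k) (x - e i2))"
    using H0 by blast+
  define f where "f = (\<lambda>k x. frac (fst (H k) x))"
  define g where "g = (\<lambda>k x. frac (snd (H k) x))"
  have frm: "(\<lambda>x. frac (h x)) \<in> borel_measurable N" if "h \<in> borel_measurable N" for h :: "'a \<Rightarrow> real"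
    unfolding frac_def using that by measurable
  have fm: "f k \<in> borel_measurable N" and gm: "g k \<in> borel_measurable N" if "k \<in> J" for k
    unfolding f_def g_def using H that by (auto intro: frm)
  have sh: "(\<lambda>x. h (x - y)) \<in> borel_measurable N" if "h \<in> borel_measurable N" for h :: "'a \<Rightarrow> real" and y
    by (rule measurable_compose[OF shift_minus_measurable that])
  define B where "B = (\<lambda>k x. \<phi> k x - (f k x - f k (x - e i1)) - (g k x - g k (x - e i2)))"
  define a where "a = (\<lambda>x. \<phi> i1 x + (\<Sum>k\<in>J. f k x - f k (x - e k)))"
  define b where "b = (\<lambda>x. \<phi> i2 x + (\<Sum>k\<in>J. g k x - g k (x - e k)))"
  have am: "a \<in> borel_measurable N" and bm: "b \<in> borel_measurable N"
    unfolding a_def b_def using \<phi> i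
    by (auto intro!: borel_measurable_add borel_measurable_sum borel_measurable_diff sh fm gm)
  have Bm: "B k \<in> borel_measurable N" if "k \<in> J" for k
    unfolding B_def using \<phi> J that by (auto intro!: borel_measurable_diff sh fm gm)
  have Bint: "AE x in N. B k x \<in> \<int>" if "k \<in> J" for k
    using H(3)[OF that]
  proof eventually_elim
    case (elim x)
    have "B k x = of_int \<lfloor>fst (H k) x\<rfloor> - of_int \<lfloor>fst (H k) (x - e i1)\<rfloor>
      + (of_int \<lfloor>snd (H k) x\<rfloor> - of_int \<lfloor>snd (H k) (x - e i2)\<rfloor>)"
      unfolding B_def f_def g_def frac_def elim by simp
    then show ?case by simp
  qed
  have fb: "0 \<le> f k x" "f k x < 1" "0 \<le> g k x" "g k x < 1" for k x
    by (simp_all add: f_def g_def frac_ge_0 frac_lt_1)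
  have Bb: "AE x in N. \<bar>B k x\<bar> \<le> C + 2" if "k \<in> J" for k
  proof -
    have "AE x in N. \<bar>\<phi> k x\<bar> \<le> C" using bd J that by blast
    then show ?thesis
    proof eventually_elim
      case (elim x)
      then show ?case unfolding B_def
        using fb[of k x] fb[of k "x - e i1"] fb[of k "x - e i2"] by linarith
    qed
  qed
  have total: "a x - a (x - e i1) + (b x - b (x - e i2)) + (\<Sum>k\<in>J. B k x - B k (x - e k))
     = (\<Sum>k\<in>I. \<phi> k x - \<phi> k (x - e k))" for x
  proof -
    have c: "x - e i1 - e k = x - e k - e i1" "x - e i2 - e k = x - e k - e i2" for k by (simp_all add: algebra_simps)
    show ?thesis using J i(3) unfolding a_def b_def B_def c
      by (simp add: sum.distrib sum_subtractf algebra_simps)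
  qed
  have "AE x in N. \<forall>k\<in>J. B k x \<in> \<int> \<and> B k (x - e k) \<in> \<int>"
    using J(1) Bint AE_shift_minus[OF Bint] by (intro AE_finite_allI) auto
  with int have "AE x in N. a x - a (x - e i1) + (b x - b (x - e i2)) \<in> \<int>"
  proof eventually_elim
    case (elim x)
    have "(\<Sum>k\<in>J. B k x - B k (x - e k)) \<in> \<int>" using elim by (intro Ints_sum Ints_diff) auto
    from Ints_diff[OF elim(1) this] show ?case unfolding total[symmetric] by simp
  qed
  then obtain c1 c2 where c: "c1 \<in> borel_measurable N" "c2 \<in> borel_measurable N"
    "AE x in N. \<bar>c1 x\<bar> \<le> 2 \<and> \<bar>c2 x\<bar> \<le> 2"
    "AE x in N. b x + c1 x \<in> \<int> \<and> a x - c2 x \<in> \<int>"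
    "AE x in N. c2 x - c2 (x - e i1) = c1 x - c1 (x - e i2)"
    by (rule pl.plane_rounding[OF am bm])
  define A where "A = (\<lambda>k. if k = i1 then (\<lambda>x. a x - c2 x) else if k = i2 then (\<lambda>x. b x + c1 x) else B k)"
  \<comment> \<open>\<open>C\<close> bounds \<phi>, each of the \<open>card J\<close> differences of
    fractional parts is at most 1, and 2 bounds the correction from
    \<open>plane_rounding\<close>.\<close>
  define C' where "C' = C + card J + 2"
  have sb: "\<bar>\<Sum>k\<in>J. h k x - h k (x - e k)\<bar> \<le> card J" if "\<And>k x. 0 \<le> h k x \<and> h k x < 1" for h :: "'i \<Rightarrow> 'a \<Rightarrow> real" and x
  proof -
    have "\<bar>\<Sum>k\<in>J. h k x - h k (x - e k)\<bar> \<le> (\<Sum>k\<in>J. \<bar>h k x - h k (x - e k)\<bar>)" by (rule sum_abs)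
    also have "\<dots> \<le> (\<Sum>k\<in>J. 1)"
    proof (rule sum_mono)
      fix k show "\<bar>h k x - h k (x - e k)\<bar> \<le> 1" using that[of k x] that[of k "x - e k"] by linarith
    qed
    finally show ?thesis by simp
  qed
  show thesis
  proof (rule that)
    fix k assume k: "k \<in> I"
    show "A k \<in> borel_measurable N" using k J am bm c Bm unfolding A_def by auto
    show "AE x in N. \<bar>A k x\<bar> \<le> C'"
    proof -
      have 1: "AE x in N. \<bar>a x - c2 x\<bar> \<le> C'" using c(3) bd[OF i(1)]
      proof eventually_elim
        case (elim x)
        have "\<bar>\<Sum>k\<in>J. f k x - f k (x - e k)\<bar> \<le> card J" by (rule sb) (simp add: fb)
        then show ?case using elim unfolding a_def C'_def by linarith
      qed
      have 2: "AE x in N. \<bar>b x + c1 x\<bar> \<le> C'" using c(3) bd[OF i(2)]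
      proof eventually_elim
        case (elim x)
        have "\<bar>\<Sum>k\<in>J. g k x - g k (x - e k)\<bar> \<le> card J" by (rule sb) (simp add: fb)
        then show ?case using elim unfolding b_def C'_def by linarith
      qed
      have 3: "AE x in N. \<bar>B k x\<bar> \<le> C'" if "k \<in> J"
        using Bb[OF that] by eventually_elim (simp add: C'_def)
      show ?thesis using 1 2 3 k J(5) unfolding A_def by auto
    qed
    have 1: "AE x in N. a x - c2 x \<in> \<int>" "AE x in N. b x + c1 x \<in> \<int>" using c(4) by auto
    show "AE x in N. A k x \<in> \<int>"
    proof (cases "k = i1 \<or> k = i2")
      case True
      then show ?thesis using 1 i(3) by (elim disjE) (simp_all add: A_def)
    next
      case False
      then show ?thesis using Bint[of k] k J(5) by (simp add: A_def)
    qed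
  next
    have A: "(\<Sum>k\<in>I. A k x - A k (x - e k)) = (a x - c2 x) - (a (x - e i1) - c2 (x - e i1))
      + ((b x + c1 x) - (b (x - e i2) + c1 (x - e i2))) + (\<Sum>k\<in>J. B k x - B k (x - e k))" for x
    proof -
      have "(\<Sum>k\<in>J. A k x - A k (x - e k)) = (\<Sum>k\<in>J. B k x - B k (x - e k))"
        using J by (intro sum.cong) (auto simp: A_def)
      then show ?thesis using J(1,3,4) i unfolding J(5) by (simp add: A_def)
    qed
    show "AE x in N. (\<Sum>k\<in>I. A k x - A k (x - e k)) = (\<Sum>k\<in>I. \<phi> k x - \<phi> k (x - e k))"
      using c(5)
    proof eventually_elim
      case (elim x)
      then show ?case unfolding A total[symmetric] by simp
    qed
  qed
qed

end

section \<open>From integral flows to equidecompositions\<close>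

text \<open>Collects the values of a cluster at its marker: if \<open>r\<close> is the offset to the
  marker, the cluster of \<open>z\<close> consists of the points \<open>z - v\<close> with
  \<open>r (z - v) = v\<close>.\<close>

definition push :: "'a set \<Rightarrow> ('a \<Rightarrow> 'a) \<Rightarrow> ('a \<Rightarrow> 'b) \<Rightarrow> 'a::ab_group_add \<Rightarrow> 'b::comm_monoid_add" where
  "push K r f z = (\<Sum>v\<in>K. if r (z - v) = v then f (z - v) else 0)"

lemma push_sum_filter:
  assumes "finite K"
  shows "push K r f z = (\<Sum>v | v \<in> K \<and> r (z - v) = v. f (z - v))"
  unfolding push_def using sum.inter_filter[OF assms, of "\<lambda>v. f (z - v)" "\<lambda>v. r (z - v) = v"] by simp

section \<open>Boxes in the acting group\<close>

locale lattice_translation = free_translation N Fr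
  for N :: "'a::real_vector measure" and Fr +
  fixes I :: "'i set" and e :: "'i \<Rightarrow> 'a" and \<xi> :: "'i \<Rightarrow> 'a \<Rightarrow> real"
  assumes fin: "finite I"
    and \<xi>_linear: "\<And>i. linear (\<xi> i)"
    and \<xi>_e: "\<And>i j. \<lbrakk>i \<in> I; j \<in> I\<rbrakk> \<Longrightarrow> \<xi> i (e j) = (if i = j then 1 else 0)"
    and free: "\<And>z::'i \<Rightarrow> int. \<exists>i\<in>I. z i \<noteq> 0 \<Longrightarrow> (\<Sum>i\<in>I. of_int (z i) *\<^sub>R e i) \<in> Fr"
begin

definition comb :: "('i \<Rightarrow> int) \<Rightarrow> 'a" where
  "comb z = (\<Sum>i\<in>I. of_int (z i) *\<^sub>R e i)"

abbreviation \<Lambda> :: "'a set" where "\<Lambda> \<equiv> range comb"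

lemma \<xi>_add: "\<xi> i (x + y) = \<xi> i x + \<xi> i y" and \<xi>_diff: "\<xi> i (x - y) = \<xi> i x - \<xi> i y"
  and \<xi>_minus: "\<xi> i (- x) = - \<xi> i x"
  using \<xi>_linear[of i] by (simp_all add: linear_add linear_diff linear_neg)

lemma \<xi>_comb: "i \<in> I \<Longrightarrow> \<xi> i (comb z) = of_int (z i)"
proof -
  assume i: "i \<in> I"
  have "\<xi> i (comb z) = (\<Sum>j\<in>I. of_int (z j) * \<xi> i (e j))"
    unfolding comb_def linear_sum[OF \<xi>_linear] by (simp add: linear_scale[OF \<xi>_linear])
  also have "\<dots> = (\<Sum>j\<in>I. if j = i then of_int (z j) else 0)"
    using i by (intro sum.cong) (auto simp: \<xi>_e)
  also have "\<dots> = of_int (z i)" using i fin by simp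
  finally show ?thesis .
qed

lemma comb_add: "comb z + comb z' = comb (\<lambda>i. z i + z' i)"
  and comb_diff: "comb z - comb z' = comb (\<lambda>i. z i - z' i)"
  by (simp_all add: comb_def sum.distrib sum_subtractf algebra_simps)

lemma \<Lambda>_add: "\<lbrakk>x \<in> \<Lambda>; y \<in> \<Lambda>\<rbrakk> \<Longrightarrow> x + y \<in> \<Lambda>" and \<Lambda>_diff: "\<lbrakk>x \<in> \<Lambda>; y \<in> \<Lambda>\<rbrakk> \<Longrightarrow> x - y \<in> \<Lambda>"
  by (auto simp: comb_add comb_diff)

lemma \<Lambda>_0: "0 \<in> \<Lambda>" using rangeI[of comb "\<lambda>_. 0"] by (simp add: comb_def)

lemma \<Lambda>_minus: "x \<in> \<Lambda> \<Longrightarrow> - x \<in> \<Lambda>" using \<Lambda>_diff[OF \<Lambda>_0] by simp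

lemma \<Lambda>_e: "i \<in> I \<Longrightarrow> e i \<in> \<Lambda>"
proof -
  assume i: "i \<in> I"
  have "comb (\<lambda>j. if j = i then 1 else 0) = (\<Sum>j\<in>I. if j = i then e j else 0)"
    unfolding comb_def by (intro sum.cong) auto
  then have "comb (\<lambda>j. if j = i then 1 else 0) = e i" using i fin by simp
  then show ?thesis by (metis rangeI)
qed

lemma \<Lambda>_free: "\<lbrakk>x \<in> \<Lambda>; x \<noteq> 0\<rbrakk> \<Longrightarrow> x \<in> Fr"
  using free by (auto simp: comb_def) (metis (mono_tags, lifting) of_int_0 scale_eq_0_iff sum.neutral)

lemma \<Lambda>_int: "\<lbrakk>x \<in> \<Lambda>; i \<in> I\<rbrakk> \<Longrightarrow> \<exists>t::int. \<xi> i x = of_int t"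
  using \<xi>_comb by auto

definition Box :: "int \<Rightarrow> int \<Rightarrow> 'a set" where
  "Box \<alpha> \<beta> = {v \<in> \<Lambda>. \<forall>i\<in>I. of_int \<alpha> \<le> \<xi> i v \<and> \<xi> i v \<le> of_int \<beta>}"

lemma inj_comb: "inj_on comb (PiE I X)"
proof (rule inj_onI)
  fix z z' assume z: "z \<in> PiE I X" "z' \<in> PiE I X" "comb z = comb z'"
  show "z = z'"
  proof (rule PiE_ext[OF z(1,2)])
    fix i assume "i \<in> I"
    then show "z i = z' i" using \<xi>_comb[of i z] \<xi>_comb[of i z'] z(3) by simp
  qed
qed

lemma card_comb_PiE: "card (comb ` PiE I X) = (\<Prod>i\<in>I. card (X i))"
  using card_image[OF inj_comb, of X] card_PiE[OF fin, of X] by simp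

lemma comb_restrict: "comb (restrict z I) = comb z"
  unfolding comb_def by (intro sum.cong) auto

lemma Box_eq: "Box \<alpha> \<beta> = comb ` (PiE I (\<lambda>_. {\<alpha>..\<beta>}))"
proof
  show "comb ` (PiE I (\<lambda>_. {\<alpha>..\<beta>})) \<subseteq> Box \<alpha> \<beta>"
    by (auto simp: Box_def \<xi>_comb PiE_def Pi_def)
  show "Box \<alpha> \<beta> \<subseteq> comb ` (PiE I (\<lambda>_. {\<alpha>..\<beta>}))"
  proof
    fix v assume v: "v \<in> Box \<alpha> \<beta>"
    then obtain z where z: "v = comb z" by (auto simp: Box_def)
    have "restrict z I \<in> PiE I (\<lambda>_. {\<alpha>..\<beta>})" using v by (auto simp: Box_def z \<xi>_comb)
    then show "v \<in> comb ` (PiE I (\<lambda>_. {\<alpha>..\<beta>}))" using comb_restrict[of z] z by (metis imageI)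
  qed
qed

lemma finite_Box: "finite (Box \<alpha> \<beta>)"
  unfolding Box_eq using fin by (intro finite_imageI finite_PiE) auto

lemma card_Box: "card (Box \<alpha> \<beta>) = nat (\<beta> - \<alpha> + 1) ^ card I"
  unfolding Box_eq card_comb_PiE by simp

lemma card_Box_slice:
  assumes "i \<in> I"
  shows "card {v \<in> Box \<alpha> \<beta>. \<xi> i v = of_int t} \<le> nat (\<beta> - \<alpha> + 1) ^ (card I - 1)"
proof -
  let ?X = "\<lambda>j. if j = i then {t} else {\<alpha>..\<beta>}"
  have "{v \<in> Box \<alpha> \<beta>. \<xi> i v = of_int t} \<subseteq> comb ` PiE I ?X"
  proof
    fix v assume v: "v \<in> {v \<in> Box \<alpha> \<beta>. \<xi> i v = of_int t}"
    then obtain z where z: "v = comb z" by (auto simp: Box_def)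
    have "restrict z I \<in> PiE I ?X" using v assms by (auto simp: Box_def z \<xi>_comb)
    then show "v \<in> comb ` PiE I ?X" using comb_restrict[of z] z by (metis imageI)
  qed
  moreover have "finite (comb ` PiE I ?X)" using fin by (intro finite_imageI finite_PiE) auto
  ultimately have "card {v \<in> Box \<alpha> \<beta>. \<xi> i v = of_int t} \<le> card (comb ` PiE I ?X)" by (rule card_mono[rotated])
  also have "\<dots> = (\<Prod>j\<in>I. card (?X j))" by (rule card_comb_PiE)
  also have "\<dots> = (\<Prod>j\<in>I - {i}. card (?X j))" using assms fin by (subst prod.remove[of _ i]) auto
  also have "\<dots> = (\<Prod>j\<in>I - {i}. nat (\<beta> - \<alpha> + 1))" by (intro prod.cong) auto
  also have "\<dots> = nat (\<beta> - \<alpha> + 1) ^ (card I - 1)" using assms fin by simp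
  finally show ?thesis .
qed

lemma Box_diff:
  assumes "u \<in> Box a b" "v \<in> Box c d"
  shows "u - v \<in> Box (a - d) (b - c)"
proof -
  have "u - v \<in> \<Lambda>" using assms unfolding Box_def by (blast intro: \<Lambda>_diff)
  moreover have "of_int (a - d) \<le> \<xi> i (u - v) \<and> \<xi> i (u - v) \<le> of_int (b - c)" if "i \<in> I" for i
  proof -
    have "of_int a \<le> \<xi> i u" "\<xi> i u \<le> of_int b" "of_int c \<le> \<xi> i v" "\<xi> i v \<le> of_int d"
      using assms that by (auto simp: Box_def)
    then show ?thesis by (simp add: \<xi>_diff)
  qed
  ultimately show ?thesis by (simp add: Box_def)
qed

lemma Box_add:
  assumes "u \<in> Box a b" "v \<in> Box c d"
  shows "u + v \<in> Box (a + c) (b + d)"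
proof -
  have "u + v \<in> \<Lambda>" using assms unfolding Box_def by (blast intro: \<Lambda>_add)
  moreover have "of_int (a + c) \<le> \<xi> i (u + v) \<and> \<xi> i (u + v) \<le> of_int (b + d)" if "i \<in> I" for i
  proof -
    have "of_int a \<le> \<xi> i u" "\<xi> i u \<le> of_int b" "of_int c \<le> \<xi> i v" "\<xi> i v \<le> of_int d"
      using assms that by (auto simp: Box_def)
    then show ?thesis by (simp add: \<xi>_add)
  qed
  ultimately show ?thesis by (simp add: Box_def)
qed

lemma Box_mono:
  assumes "u \<in> Box a b" "a' \<le> a" "b \<le> b'"
  shows "u \<in> Box a' b'"
proof -
  have "real_of_int a' \<le> of_int a" "real_of_int b \<le> of_int b'" using assms(2,3) by simp_all
  then show ?thesis using assms(1) unfolding Box_def by force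
qed

section \<open>Clusters around markers\<close>

text \<open>A point joins a marker in the cube of side 4s ahead of it, and a marker seen in the
  middle cube [s, 3s] has priority. There is at most one such marker by separation, so each marker
  receives its whole middle cube. Otherwise the colour of the marker decides. A change of cluster
  along an edge therefore requires a marker that enters or leaves the candidate cube or the middle
  cube along this edge, and the four listed coordinates are where this can happen.\<close>

lemma clusters:
  fixes s :: nat
  obtains B r where "r \<in> measurable N (count_space UNIV)" "\<And>x. r x \<in> Box 0 (4 * int s)" "\<And>x. x + r x \<in> B"
    "\<And>x y. \<lbrakk>x \<in> B; y \<in> B; y - x \<in> Box (- 2 * int s) (2 * int s)\<rbrakk> \<Longrightarrow> x = y"
    "\<And>z v. \<lbrakk>z \<in> B; v \<in> Box (int s) (3 * int s)\<rbrakk> \<Longrightarrow> r (z - v) = v"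
    "\<And>y i. \<lbrakk>i \<in> I; r y \<noteq> r (y + e i) + e i\<rbrakk> \<Longrightarrow>
       \<exists>u\<in>Box 0 (4 * int s + 1). y + u \<in> B \<and> \<xi> i u \<in> of_int ` {0, int s, 3 * int s + 1, 4 * int s + 1}"
proof -
  define F where "F = (\<lambda>m::int. Box (- m) m - {0})"
  have F: "finite (F m)" "F m \<subseteq> Fr" "uminus ` F m \<subseteq> F m" for m
  proof -
    show "finite (F m)" by (simp add: F_def finite_Box)
    show "F m \<subseteq> Fr" using \<Lambda>_free by (auto simp: F_def Box_def)
    show "uminus ` F m \<subseteq> F m" using \<Lambda>_minus unfolding F_def Box_def
      by (auto simp: \<xi>_minus)
  qed
  obtain B where B: "B \<in> sets N" "\<And>x f. \<lbrakk>x \<in> B; f \<in> F (2 * int s)\<rbrakk> \<Longrightarrow> x + f \<notin> B"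
    "\<And>x. \<exists>f\<in>insert 0 (F (2 * int s)). x + f \<in> B"
    by (rule markers[OF F, of "2 * int s"]) blast
  obtain \<kappa> :: "'a \<Rightarrow> nat" where \<kappa>: "\<kappa> \<in> measurable N (count_space UNIV)"
    and col: "\<And>x f. f \<in> F (4 * int s) \<Longrightarrow> \<kappa> (x + f) \<noteq> \<kappa> x"
    using coloring[OF F(1,2), of "4 * int s"] by blast
  let ?K = "Box 0 (4 * int s)"
  let ?C = "Box (int s) (3 * int s)"
  define score where "score = (\<lambda>v x. if v \<in> ?C then 0 else Suc (\<kappa> (x + v)))"
  have sep: "x = y" if "x \<in> B" "y \<in> B" "y - x \<in> Box (- 2 * int s) (2 * int s)" for x y
    using B(2)[of x "y - x"] that by (auto simp: F_def)
  have cand: "\<exists>v\<in>?K. x + v \<in> B" for x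
  proof -
    \<comment> \<open>Looking from \<open>x + d\<close> turns the symmetric cube that is known to
      meet \<open>B\<close> into the cube [0, 4s] ahead of \<open>x\<close>.\<close>
    define d where "d = comb (\<lambda>_. 2 * int s)"
    obtain f where f: "f \<in> insert 0 (F (2 * int s))" "x + d + f \<in> B" using B(3) by blast
    have "f \<in> Box (- 2 * int s) (2 * int s)" using f(1) \<Lambda>_0 by (auto simp: F_def Box_def linear_0[OF \<xi>_linear])
    moreover have "d \<in> Box (2 * int s) (2 * int s)" by (auto simp: Box_def d_def \<xi>_comb)
    ultimately have "d + f \<in> ?K" using Box_add[of d "2 * int s" "2 * int s" f "- 2 * int s" "2 * int s"] by simp
    then show ?thesis using f(2) by (auto simp: add.assoc)
  qed
  have sm: "score v \<in> measurable N (count_space UNIV)" for v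
  proof -
    have "(\<lambda>x. Suc (\<kappa> (x + v))) \<in> measurable N (count_space UNIV)"
      by (rule measurable_compose[OF measurable_compose[OF shift_measurable \<kappa>]]) simp
    then show ?thesis unfolding score_def by simp
  qed
  have inj: "score v x \<noteq> score v' x"
    if v: "v \<in> ?K" "v' \<in> ?K" "v \<noteq> v'" "x + v \<in> B" "x + v' \<in> B" for v v' x
  proof (cases "v \<in> ?C \<and> v' \<in> ?C")
    case True
    then have "v' - v \<in> Box (- 2 * int s) (2 * int s)" using Box_diff[of v' "int s" "3 * int s" v "int s" "3 * int s"] by simp
    then show ?thesis using sep[OF v(4,5)] v(3) by simp
  next
    case False
    have "v' - v \<in> F (4 * int s)" using Box_diff[OF v(2,1)] v(3) by (simp add: F_def)
    then have "\<kappa> (x + v') \<noteq> \<kappa> (x + v)" using col[of "v' - v" "x + v"] by simp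
    then show ?thesis using False by (auto simp: score_def)
  qed
  obtain r where r: "r \<in> measurable N (count_space UNIV)" "\<And>x. r x \<in> ?K" "\<And>x. x + r x \<in> B"
    "\<And>x v. \<lbrakk>v \<in> ?K; x + v \<in> B; \<And>v'. \<lbrakk>v' \<in> ?K; x + v' \<in> B\<rbrakk> \<Longrightarrow> score v x \<le> score v' x\<rbrakk> \<Longrightarrow> r x = v"
    "\<And>x v. \<lbrakk>v \<in> ?K; x + v \<in> B\<rbrakk> \<Longrightarrow> score (r x) x \<le> score v x"
  proof (rule select[of ?K B "\<lambda>v. v" score])
    show "finite ?K" by (rule finite_Box)
    show "B \<in> sets N" by (rule B)
    show "\<exists>v\<in>?K. x + v \<in> B" for x by (rule cand)
    show "score v \<in> measurable N (count_space UNIV)" for v by (rule sm)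
    show "score v x \<noteq> score v' x"
      if v: "v \<in> ?K" "v' \<in> ?K" "v \<noteq> v'" "x + v \<in> B" "x + v' \<in> B" for v v' x by (rule inj[OF v])
  qed (auto intro: that)
  show thesis
  proof (rule that[of r B])
    show "r (z - v) = v" if "z \<in> B" "v \<in> ?C" for z v
    proof (rule r(4))
      show "v \<in> ?K" by (rule Box_mono[OF that(2)]) auto
      show "score v (z - v) \<le> score v' (z - v)" for v' using that(2) by (simp add: score_def)
    qed (use that in simp)
    fix y i assume i: "i \<in> I" and ne: "r y \<noteq> r (y + e i) + e i"
    show "\<exists>u\<in>Box 0 (4 * int s + 1). y + u \<in> B \<and> \<xi> i u \<in> of_int ` {0, int s, 3 * int s + 1, 4 * int s + 1}"
    proof (rule ccontr)
      assume no: "\<not> ?thesis"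
      have ei: "e i \<in> Box 0 1" using i \<Lambda>_e by (auto simp: Box_def \<xi>_e)
      have slice: "\<exists>t::int. \<xi> i u = of_int t" if "u \<in> \<Lambda>" for u using \<Lambda>_int that i by blast
      have up: "u + e i \<in> Box a b" if u: "u \<in> Box a b" "0 \<le> a" "b \<le> 4 * int s" "y + (u + e i) \<in> B"
        "b + 1 \<in> {0, int s, 3 * int s + 1, 4 * int s + 1}" for u and a b :: int
      proof -
        have 1: "u + e i \<in> Box a (b + 1)" using Box_add[OF u(1) ei] by simp
        then have "u + e i \<in> Box 0 (4 * int s + 1)" by (rule Box_mono) (use u in auto)
        then have ne: "\<xi> i (u + e i) \<noteq> of_int (b + 1)" using no u(4,5) by blast
        obtain t :: int where t: "\<xi> i (u + e i) = of_int t" using slice 1 by (auto simp: Box_def)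
        have "t \<le> b" using 1 ne t i by (auto simp: Box_def)
        have "\<xi> j (u + e i) \<le> of_int b" if "j \<in> I" for j
        proof (cases "j = i")
          case True then show ?thesis using t \<open>t \<le> b\<close> by simp
        next
          case False then show ?thesis using u(1) i that by (auto simp: Box_def \<xi>_add \<xi>_e)
        qed
        then show ?thesis using 1 by (auto simp: Box_def)
      qed
      have down: "u - e i \<in> Box a b" if u: "u \<in> Box a b" "0 \<le> a" "b \<le> 4 * int s" "y + u \<in> B"
        "a \<in> {0, int s, 3 * int s + 1, 4 * int s + 1}" for u and a b :: int
      proof -
        have 1: "u - e i \<in> Box (a - 1) b" using Box_diff[OF u(1) ei] by simp
        have "u \<in> Box 0 (4 * int s + 1)" by (rule Box_mono[OF u(1)]) (use u in auto)
        then have ne: "\<xi> i u \<noteq> of_int a" using no u(4,5) by blast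
        obtain t :: int where t: "\<xi> i u = of_int t" using slice u(1) by (auto simp: Box_def)
        have "a + 1 \<le> t" using u(1) ne t i by (auto simp: Box_def)
        have "of_int a \<le> \<xi> j (u - e i)" if "j \<in> I" for j
        proof (cases "j = i")
          case True
          have "real_of_int (a + 1) \<le> of_int t" using \<open>a + 1 \<le> t\<close> by (simp only: of_int_le_iff)
          then show ?thesis using True t i by (simp add: \<xi>_diff \<xi>_e)
        next
          case False then show ?thesis using u(1) i that by (auto simp: Box_def \<xi>_diff \<xi>_e)
        qed
        then show ?thesis using 1 by (auto simp: Box_def)
      qed
      let ?s = "r (y + e i)"
      have s: "?s \<in> ?K" "y + (?s + e i) \<in> B" using r(2,3)[of "y + e i"] by (simp_all add: algebra_simps)
      have core_iff: "u \<in> ?C \<longleftrightarrow> u + e i \<in> ?C" if "y + (u + e i) \<in> B" for u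
        using up[of u "int s" "3 * int s"] down[of "u + e i" "int s" "3 * int s"] that by auto
      have sc: "score (u + e i) y = score u (y + e i)" if "y + (u + e i) \<in> B" for u
        using core_iff[OF that] by (simp add: score_def algebra_simps)
      have "r y = ?s + e i"
      proof (rule r(4))
        show "?s + e i \<in> ?K" by (rule up[OF s(1)]) (use s in auto)
        show "y + (?s + e i) \<in> B" by (rule s)
        fix v' assume v': "v' \<in> ?K" "y + v' \<in> B"
        have "v' - e i \<in> ?K" by (rule down[OF v'(1)]) (use v' in auto)
        then have "score ?s (y + e i) \<le> score (v' - e i) (y + e i)"
          by (rule r(5)) (use v' in simp)
        then show "score (?s + e i) y \<le> score v' y"
          using sc[OF s(2)] sc[of "v' - e i"] v' by simp
      qed
      then show False using ne by simp
    qed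
  qed (use r sep in auto)
qed


section \<open>Exchange of units between clusters\<close>

lemma push_equid:
  fixes c :: "'a \<Rightarrow> nat"
  assumes K: "finite K" "K \<subseteq> \<Lambda>" and r: "r \<in> measurable N (count_space UNIV)" "\<And>x. r x \<in> K"
    and c: "c \<in> measurable N (count_space UNIV)"
  shows "push K r c \<in> measurable N (count_space UNIV)" "equid \<Lambda> c (push K r c)"
proof -
  let ?u = "\<lambda>v x. if r x = v then c x else 0"
  have um: "?u v \<in> measurable N (count_space UNIV)" for v
  proof -
    have "{x \<in> space N. r x = v} \<in> sets N"
      using measurable_sets[OF r(1), of "{v}"] by (simp add: vimage_def)
    then show ?thesis by (intro measurable_If c) auto
  qed
  have eq: "push K r c = (\<lambda>x. \<Sum>v\<in>K. ?u v (x - v))" by (simp add: push_def fun_eq_iff)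
  show "push K r c \<in> measurable N (count_space UNIV)"
    unfolding eq by (intro measurable_sum_count_space measurable_compose[OF shift_minus_measurable um])
  have "(\<Sum>v\<in>K. ?u v x) = c x" for x
    using sum.delta[OF K(1), of "r x" "\<lambda>_. c x"] r(2)[of x] by (simp add: eq_commute)
  then show "equid \<Lambda> c (push K r c)"
    by (intro equidI[of K "\<lambda>v. v" \<Lambda> ?u] K um) (auto simp: eq K(2)[THEN subsetD])
qed

text \<open>All edges that carry \<open>h\<close> stay inside clusters, so shifting by
  \<open>d\<close> matches the starting points in a cluster with the end points in the same cluster.
  Flow along inner edges thus cancels from the totals.\<close>

lemma push_cancel:
  fixes h :: "'a \<Rightarrow> int"
  assumes K: "finite K" and r: "\<And>x. r x \<in> K" and h: "\<And>y. h y \<noteq> 0 \<Longrightarrow> r y = r (y + d) + d"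
  shows "push K r (\<lambda>x. h (x - d)) z = push K r h z"
proof -
  let ?S = "{v \<in> K. r (z - v) = v \<and> h (z - v - d) \<noteq> 0}"
  let ?T = "{v \<in> K. r (z - v) = v \<and> h (z - v) \<noteq> 0}"
  have "push K r (\<lambda>x. h (x - d)) z = (\<Sum>v\<in>?S. h (z - v - d))"
    unfolding push_def by (intro sum.mono_neutral_cong_right K) auto
  also have "\<dots> = (\<Sum>v\<in>?T. h (z - v))"
  proof (rule sum.reindex_bij_witness[of _ "\<lambda>v. v - d" "\<lambda>v. v + d"])
    fix v assume v: "v \<in> ?S"
    then have "r (z - v - d) = r (z - v) + d" using h[of "z - v - d"] by simp
    then have "r (z - (v + d)) = v + d" using v by (simp add: algebra_simps)
    then show "v + d \<in> ?T" using v r[of "z - (v + d)"] by (simp add: algebra_simps)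
    show "v + d - d = v" by simp
    show "h (z - (v + d)) = h (z - v - d)" by (simp add: algebra_simps)
  next
    fix v assume v: "v \<in> ?T"
    then have "v = r (z - v + d) + d" using h[of "z - v"] by simp
    then have eq: "r (z - (v - d)) = v - d" by (simp add: algebra_simps)
    have "v - d \<in> K" using r[of "z - (v - d)"] unfolding eq .
    then show "v - d \<in> ?S" using v eq by simp
    show "v - d + d = v" by simp
  qed
  also have "\<dots> = push K r h z"
    unfolding push_def by (intro sum.mono_neutral_cong_left K) auto
  finally show ?thesis .
qed

text \<open>Volume comparison: the cubes of side 2s+1 at the markers are disjoint and fit into a
  cube of side 10s+3, at most 5(2s+1).\<close>

lemma card_marker_near:
  fixes s :: nat
  assumes sep: "\<And>x y. \<lbrakk>x \<in> B; y \<in> B; y - x \<in> Box (- 2 * int s) (2 * int s)\<rbrakk> \<Longrightarrow> x = y"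
  shows "card {q \<in> Box (- 4 * int s - 1) (4 * int s + 1). z + q \<in> B} \<le> 5 ^ card I"
proof -
  let ?G = "{q \<in> Box (- 4 * int s - 1) (4 * int s + 1). z + q \<in> B}"
  let ?U = "Box 0 (2 * int s)"
  have "inj_on (\<lambda>(q, u). q + u) (?G \<times> ?U)"
  proof (rule inj_onI, clarify)
    fix q u q' u' assume a: "q + u = q' + u'" "u \<in> ?U" "u' \<in> ?U" "z + q \<in> B" "z + q' \<in> B"
    have "(z + q') - (z + q) = u - u'" using a(1) by (simp add: algebra_simps)
    moreover have "u - u' \<in> Box (- 2 * int s) (2 * int s)" using Box_diff[OF a(2,3)] by simp
    ultimately have "z + q = z + q'" using sep[OF a(4,5)] by simp
    then show "q = q' \<and> u = u'" using a(1) by simp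
  qed
  then have "card ?G * card ?U = card ((\<lambda>(q, u). q + u) ` (?G \<times> ?U))"
    by (simp add: card_image card_cartesian_product)
  also have "\<dots> \<le> card (Box (- 4 * int s - 1) (6 * int s + 1))"
  proof (rule card_mono[OF finite_Box])
    show "(\<lambda>(q, u). q + u) ` (?G \<times> ?U) \<subseteq> Box (- 4 * int s - 1) (6 * int s + 1)"
    proof clarsimp
      fix q u assume "q \<in> Box (- (4 * int s) - 1) (4 * int s + 1)" "u \<in> ?U"
      from Box_add[OF this] show "q + u \<in> Box (- (4 * int s) - 1) (6 * int s + 1)" by simp
    qed
  qed
  also have "\<dots> = (10 * s + 3) ^ card I" unfolding card_Box by (intro arg_cong2[of _ _ _ _ "(^)"]) auto
  also have "\<dots> \<le> (5 * (2 * s + 1)) ^ card I" by (intro power_mono) auto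
  also have "\<dots> = 5 ^ card I * (2 * s + 1) ^ card I" by (rule power_mult_distrib)
  also have "card ?U = (2 * s + 1) ^ card I" unfolding card_Box by (intro arg_cong2[of _ _ _ _ "(^)"]) auto
  ultimately have "card ?G * (2 * s + 1) ^ card I \<le> 5 ^ card I * (2 * s + 1) ^ card I" by simp
  then show ?thesis by simp
qed

text \<open>A cluster contains (2s+1)^k points but has only O(s^(k-1)) boundary edges, so for large s it
  holds enough units to feed all flow through its boundary.\<close>

lemma flow_equid:
  fixes c p :: "'a \<Rightarrow> nat" and A :: "'i \<Rightarrow> 'a \<Rightarrow> int" and C :: nat
  assumes c: "c \<in> measurable N (count_space UNIV)" "\<And>x. 1 \<le> c x"
    and p: "p \<in> measurable N (count_space UNIV)"
    and A: "\<And>i. i \<in> I \<Longrightarrow> A i \<in> measurable N (count_space UNIV)" "\<And>i x. i \<in> I \<Longrightarrow> \<bar>A i x\<bar> \<le> int C"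
    and flow: "AE x in N. int (p x) - int (c x) = (\<Sum>i\<in>I. A i x - A i (x - e i))"
  shows "equid \<Lambda> c p"
proof -
  define k where "k = card I"
  \<comment> \<open>Chosen so that 8 * C * k * 10^k = 2 * s, which is the constant arising in the
    estimate of \<open>out\<close> by the boundary edges.\<close>
  define s where "s = 4 * C * k * 10 ^ k"
  obtain B r where r: "r \<in> measurable N (count_space UNIV)" "\<And>x. r x \<in> Box 0 (4 * int s)" "\<And>x. x + r x \<in> B"
    and sep: "\<And>x y. \<lbrakk>x \<in> B; y \<in> B; y - x \<in> Box (- 2 * int s) (2 * int s)\<rbrakk> \<Longrightarrow> x = y"
    and core: "\<And>z v. \<lbrakk>z \<in> B; v \<in> Box (int s) (3 * int s)\<rbrakk> \<Longrightarrow> r (z - v) = v"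
    and bdry: "\<And>y i. \<lbrakk>i \<in> I; r y \<noteq> r (y + e i) + e i\<rbrakk> \<Longrightarrow>
       \<exists>u\<in>Box 0 (4 * int s + 1). y + u \<in> B \<and> \<xi> i u \<in> of_int ` {0, int s, 3 * int s + 1, 4 * int s + 1}"
    by (rule clusters[of s]) blast
  let ?K = "Box 0 (4 * int s)"
  have K: "finite ?K" "?K \<subseteq> \<Lambda>" by (rule finite_Box) (auto simp: Box_def)
  define bd where "bd = (\<lambda>i y. r y \<noteq> r (y + e i) + e i)"
  \<comment> \<open>By the sign in \<open>flow\<close>, a positive \<open>A i y\<close> moves units
    from \<open>y + e i\<close> to \<open>y\<close>, a negative one the other way. \<open>a\<close>
    and \<open>a'\<close> are these two parts on edges between clusters; \<open>out\<close> records
    the moved units where they start, \<open>inn\<close> where they end.\<close>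
  define a where "a = (\<lambda>i y. if bd i y then nat (A i y) else 0)"
  define a' where "a' = (\<lambda>i y. if bd i y then nat (- A i y) else 0)"
  define out where "out = (\<lambda>x. \<Sum>i\<in>I. a i (x - e i) + a' i x)"
  define inn where "inn = (\<lambda>x. \<Sum>i\<in>I. a i x + a' i (x - e i))"
  have bds: "{x \<in> space N. bd i x} \<in> sets N" for i
  proof -
    have "{x \<in> space N. bd i x} = {x \<in> space N. \<exists>u\<in>?K. \<exists>v\<in>?K. r x = u \<and> r (x + e i) = v \<and> u \<noteq> v + e i}"
      using r(2) by (auto simp: bd_def)
    also have "\<dots> \<in> sets N"
    proof (intro sets.sets_Collect_finite_Ex K sets.sets_Collect_conj)
      show "{x \<in> space N. r x = u} \<in> sets N" "{x \<in> space N. r (x + e i) = u} \<in> sets N" for u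
        using measurable_sets[OF r(1), of "{u}"] measurable_sets[OF measurable_compose[OF shift_measurable r(1)], of "{u}" "e i"]
        by (auto simp: vimage_def)
    qed (use sets.top[of N] in auto)
    finally show ?thesis .
  qed
  have am: "a i \<in> measurable N (count_space UNIV)" and am': "a' i \<in> measurable N (count_space UNIV)" if "i \<in> I" for i
    unfolding a_def a'_def using measurable_compose[OF A(1)[OF that], of nat "count_space UNIV"]
      measurable_compose[OF A(1)[OF that], of "\<lambda>t. nat (- t)" "count_space UNIV"] bds[of i]
    by (auto intro!: measurable_If)
  have addm: "(\<lambda>x. f x + g x) \<in> measurable N (count_space UNIV)"
    if "f \<in> measurable N (count_space UNIV)" "g \<in> measurable N (count_space UNIV)" for f g :: "'a \<Rightarrow> nat"
    by (rule measurable_count_space_compose2[OF that])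
  have om: "out \<in> measurable N (count_space UNIV)" and im: "inn \<in> measurable N (count_space UNIV)"
    unfolding out_def inn_def
    by (intro measurable_sum_count_space addm measurable_compose[OF shift_minus_measurable am]
        measurable_compose[OF shift_minus_measurable am'] am am'; assumption)+
  have neg: "uminus ` \<Lambda> \<subseteq> \<Lambda>" using \<Lambda>_minus by blast
  have oi: "equid \<Lambda> out inn"
    unfolding out_def inn_def
  proof (intro equid_sum fin \<Lambda>_0 equid_add)
    fix i assume i: "i \<in> I"
    show "equid \<Lambda> (\<lambda>x. a i (x - e i)) (a i)" by (rule equid_sym[OF equid_shift[OF am \<Lambda>_e] neg]) (rule i)+
    show "equid \<Lambda> (a' i) (\<lambda>x. a' i (x - e i))" by (rule equid_shift[OF am' \<Lambda>_e]) (rule i)+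
  qed
  have PO: "push ?K r out \<in> measurable N (count_space UNIV)" "equid \<Lambda> out (push ?K r out)"
    by (rule push_equid[OF K r(1,2) om])+
  have PI: "equid \<Lambda> inn (push ?K r inn)" by (rule push_equid(2)[OF K r(1,2) im])
  have Pc: "push ?K r c \<in> measurable N (count_space UNIV)" "equid \<Lambda> c (push ?K r c)"
    by (rule push_equid[OF K r(1,2) c(1)])+
  have Pp: "equid \<Lambda> p (push ?K r p)" by (rule push_equid(2)[OF K r(1,2) p])
  have OI: "equid \<Lambda> (push ?K r out) (push ?K r inn)"
    using equid_trans[OF equid_trans[OF equid_sym[OF PO(2) neg] oi] PI] \<Lambda>_add by blast
  have diff: "int (inn y) - int (out y) = (\<Sum>i\<in>I. (if bd i y then A i y else 0) - (if bd i (y - e i) then A i (y - e i) else 0))" for y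
    unfolding inn_def out_def of_nat_sum sum_subtractf[symmetric]
    by (intro sum.cong refl) (simp add: a_def a'_def)
  have int_push: "int (push ?K r f z) = push ?K r (\<lambda>x. int (f x)) z" for f z
    unfolding push_def of_nat_sum by (intro sum.cong) auto
  have push_diff: "push ?K r f z - push ?K r g z = push ?K r (\<lambda>x. f x - g x) z" for f g :: "'a \<Rightarrow> int" and z
    unfolding push_def sum_subtractf[symmetric] by (intro sum.cong) auto
  have push_sum: "push ?K r (\<lambda>x. \<Sum>i\<in>I. f i x) z = (\<Sum>i\<in>I. push ?K r (f i) z)" for f :: "'i \<Rightarrow> 'a \<Rightarrow> int" and z
    unfolding push_def by (subst sum.swap) (intro sum.cong, auto)
  have "AE z in N. \<forall>v\<in>?K. int (p (z - v)) - int (c (z - v)) = (\<Sum>i\<in>I. A i (z - v) - A i (z - v - e i))"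
    using K(1) AE_shift_minus[OF flow] by (intro AE_finite_allI) auto
  \<comment> \<open>Inner edges cancel in the cluster totals, so the edges between clusters alone
    account for the difference of \<open>p\<close> and \<open>c\<close>.\<close>
  then have bal: "AE z in N. int (push ?K r p z) - int (push ?K r c z) = int (push ?K r inn z) - int (push ?K r out z)"
  proof eventually_elim
    case (elim z)
    let ?h = "\<lambda>i y. if bd i y then 0 else A i y"
    have "push ?K r (\<lambda>x. int (p x) - int (c x)) z = push ?K r (\<lambda>x. \<Sum>i\<in>I. A i x - A i (x - e i)) z"
      unfolding push_def using elim by (intro sum.cong) auto
    moreover have "push ?K r (\<lambda>x. \<Sum>i\<in>I. A i x - A i (x - e i)) z - push ?K r (\<lambda>x. int (inn x) - int (out x)) z = 0"
    proof -
      have "push ?K r (\<lambda>x. \<Sum>i\<in>I. A i x - A i (x - e i)) z - push ?K r (\<lambda>x. int (inn x) - int (out x)) z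
        = push ?K r (\<lambda>x. \<Sum>i\<in>I. ?h i x - ?h i (x - e i)) z"
        unfolding push_diff diff sum_subtractf[symmetric]
        by (intro arg_cong[where f = "\<lambda>f. push ?K r f z"] ext sum.cong) auto
      also have "\<dots> = (\<Sum>i\<in>I. push ?K r (?h i) z - push ?K r (\<lambda>x. ?h i (x - e i)) z)"
        unfolding push_sum push_diff ..
      also have "\<dots> = 0"
        by (intro sum.neutral ballI, subst push_cancel[OF K(1) r(2)]) (auto simp: bd_def split: if_splits)
      finally show ?thesis .
    qed
    moreover have "int (push ?K r f z) - int (push ?K r g z) = push ?K r (\<lambda>x. int (f x) - int (g x)) z" for f g
      by (simp only: int_push push_diff)
    ultimately show ?case by simp
  qed
  have le: "push ?K r out z \<le> push ?K r c z" for z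
  proof (cases "z \<in> B")
    case False
    have "r (z - v) \<noteq> v" for v using r(3)[of "z - v"] False by auto
    then show ?thesis by (simp add: push_def)
  next
    case True
    let ?G = "{q \<in> Box (- 4 * int s - 1) (4 * int s + 1). z + q \<in> B}"
    have Gfin: "finite ?G" using finite_Box by simp
    let ?T = "{0, int s, 3 * int s + 1, 4 * int s + 1}"
    \<comment> \<open>By \<open>bdry\<close> such an edge sees a marker in one of four slices. With
      \<open>q\<close> the position of this marker relative to \<open>z\<close>, there are at most
      5^k values of \<open>q\<close>, four slices for each, and (4s+1)^(k-1) points in a
      slice.\<close>
    have cnt: "card {v \<in> ?K. bd i (z - v - d)} \<le> 5 ^ k * (4 * (4 * s + 1) ^ (k - 1))"
      if i: "i \<in> I" and d: "d = 0 \<or> d = e i" for i d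
    proof -
      have dB: "d \<in> Box 0 1" using d i \<Lambda>_0 \<Lambda>_e by (auto simp: Box_def \<xi>_e linear_0[OF \<xi>_linear])
      obtain d' :: int where d': "\<xi> i d = of_int d'" using dB \<Lambda>_int[of d i] i unfolding Box_def by blast
      define sl where "sl = (\<lambda>t x. {v \<in> ?K. \<xi> i v = of_int (t - d') - x})"
      have sub: "{v \<in> ?K. bd i (z - v - d)} \<subseteq> (\<Union>q\<in>?G. \<Union>t\<in>?T. sl t (\<xi> i q))"
      proof
        fix v assume "v \<in> {v \<in> ?K. bd i (z - v - d)}"
        then have v: "v \<in> ?K" "bd i (z - v - d)" by auto
        then obtain u t where u: "u \<in> Box 0 (4 * int s + 1)" "z - v - d + u \<in> B" "t \<in> ?T" "\<xi> i u = of_int t"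
          using bdry[OF i, of "z - v - d"] unfolding bd_def by blast
        have "u - (v + d) \<in> Box (- 4 * int s - 1) (4 * int s + 1)" using Box_diff[OF u(1) Box_add[OF v(1) dB]] by simp
        then have "u - (v + d) \<in> ?G" using u(2) by (simp add: algebra_simps)
        moreover have "v \<in> sl t (\<xi> i (u - (v + d)))" using v(1) u(4) d' by (simp add: sl_def \<xi>_diff \<xi>_add)
        ultimately show "v \<in> (\<Union>q\<in>?G. \<Union>t\<in>?T. sl t (\<xi> i q))" using u(3) by blast
      qed
      have sl: "card (sl t (\<xi> i q)) \<le> (4 * s + 1) ^ (k - 1)" if q: "q \<in> ?G" for t q
      proof -
        obtain q' :: int where q': "\<xi> i q = of_int q'" using q \<Lambda>_int[of q i] i unfolding Box_def by blast
        have "sl t (\<xi> i q) = {v \<in> ?K. \<xi> i v = of_int (t - d' - q')}" by (simp add: sl_def q')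
        moreover have "nat (4 * int s - 0 + 1) = 4 * s + 1" by simp
        ultimately show ?thesis using card_Box_slice[OF i, of 0 "4 * int s" "t - d' - q'"] by (simp add: k_def)
      qed
      have "card {v \<in> ?K. bd i (z - v - d)} \<le> card (\<Union>q\<in>?G. \<Union>t\<in>?T. sl t (\<xi> i q))"
        by (rule card_mono[OF _ sub]) (use Gfin finite_Box in \<open>auto simp: sl_def\<close>)
      also have "\<dots> \<le> (\<Sum>q\<in>?G. card (\<Union>t\<in>?T. sl t (\<xi> i q)))" by (rule card_UN_le[OF Gfin])
      also have "\<dots> \<le> (\<Sum>q\<in>?G. \<Sum>t\<in>?T. card (sl t (\<xi> i q)))" by (intro sum_mono card_UN_le) simp
      also have "\<dots> \<le> (\<Sum>q\<in>?G. \<Sum>t\<in>?T. (4 * s + 1) ^ (k - 1))" by (intro sum_mono sl)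
      also have "\<dots> = card ?G * (card ?T * (4 * s + 1) ^ (k - 1))" by simp
      also have "\<dots> \<le> 5 ^ k * (4 * (4 * s + 1) ^ (k - 1))"
      proof (intro mult_mono)
        show "card ?G \<le> 5 ^ k" unfolding k_def by (rule card_marker_near[OF sep])
        show "card ?T \<le> 4" 
          using card_length[of "[0, int s, 3 * int s + 1, 4 * int s + 1]"] unfolding list.set by simp
      qed auto
      finally show ?thesis .
    qed
    let ?b = "5 ^ k * (4 * (4 * s + 1) ^ (k - 1))"
    have aC: "a i y \<le> (if bd i y then C else 0)" "a' i y \<le> (if bd i y then C else 0)" if "i \<in> I" for i y
      using A(2)[OF that, of y] by (auto simp: a_def a'_def)
    have ind: "(\<Sum>v\<in>?K. if Q v then C else 0) = C * card {v \<in> ?K. Q v}" for Q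
      using sum.inter_filter[OF K(1), of "\<lambda>_. C" Q] by (simp add: mult.commute)
    have "push ?K r out z \<le> (\<Sum>v\<in>?K. out (z - v))"
      unfolding push_def by (intro sum_mono) auto
    also have "\<dots> = (\<Sum>i\<in>I. (\<Sum>v\<in>?K. a i (z - v - e i)) + (\<Sum>v\<in>?K. a' i (z - v)))"
      unfolding out_def by (subst sum.swap) (simp add: sum.distrib)
    also have "\<dots> \<le> (\<Sum>i\<in>I. C * card {v \<in> ?K. bd i (z - v - e i)} + C * card {v \<in> ?K. bd i (z - v - 0)})"
      unfolding ind[symmetric] by (intro sum_mono add_mono aC) (use aC in auto)
    also have "\<dots> \<le> (\<Sum>i\<in>I. C * ?b + C * ?b)"
      by (intro sum_mono add_mono mult_left_mono cnt) auto
    also have "\<dots> = k * (2 * C * ?b)" by (simp add: k_def)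
    also have "\<dots> \<le> (2 * s + 1) ^ k"
    proof (cases k)
      case (Suc m)
      have m: "k - 1 = m" by (simp add: Suc)
      have "k * (2 * C * ?b) = 8 * C * k * 5 ^ k * (4 * s + 1) ^ m" unfolding m by (simp add: ac_simps)
      also have "\<dots> \<le> 8 * C * k * 5 ^ k * (2 * (2 * s + 1)) ^ m" by (intro mult_left_mono power_mono) auto
      also have "\<dots> = 8 * C * k * 5 ^ k * 2 ^ m * (2 * s + 1) ^ m" unfolding power_mult_distrib by simp
      also have "\<dots> \<le> 8 * C * k * 5 ^ k * 2 ^ k * (2 * s + 1) ^ m" by (intro mult_right_mono mult_left_mono power_increasing) (auto simp: Suc)
      also have "\<dots> = 2 * s * (2 * s + 1) ^ m"
        using power_mult_distrib[of "5::nat" 2 k] by (simp add: s_def)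
      also have "\<dots> \<le> (2 * s + 1) ^ k" by (simp add: Suc)
      finally show ?thesis .
    qed simp
    also have "\<dots> = card (Box (int s) (3 * int s))" unfolding card_Box k_def by (intro arg_cong2[of _ _ _ _ "(^)"]) auto
    also have "\<dots> \<le> card {v \<in> ?K. r (z - v) = v}"
    proof (rule card_mono)
      show "Box (int s) (3 * int s) \<subseteq> {v \<in> ?K. r (z - v) = v}"
      proof clarify
        fix v assume v: "v \<in> Box (int s) (3 * int s)"
        show "v \<in> ?K \<and> r (z - v) = v" using core[OF True v] Box_mono[OF v, of 0 "4 * int s"] by simp
      qed
    qed (use K in simp)
    also have "\<dots> = (\<Sum>v | v \<in> ?K \<and> r (z - v) = v. 1)" by simp
    also have "\<dots> \<le> push ?K r c z" unfolding push_sum_filter[OF K(1)] by (intro sum_mono c)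
    finally show ?thesis .
  qed
  \<comment> \<open>The units a cluster keeps, a true difference by \<open>le\<close>. Its outgoing
    units are exchanged for the incoming ones, and \<open>bal\<close> identifies the result as the
    cluster total of \<open>p\<close>.\<close>
  let ?D = "\<lambda>x. push ?K r c x - push ?K r out x"
  have Dm: "?D \<in> measurable N (count_space UNIV)"
    by (rule measurable_count_space_compose2[OF Pc(1) PO(1)])
  have eq1: "equid \<Lambda> (\<lambda>x. ?D x + push ?K r out x) (\<lambda>x. ?D x + push ?K r inn x)"
    by (rule equid_add[OF equid_refl[OF Dm \<Lambda>_0] OI])
  have ae2: "AE x in N. ?D x + push ?K r inn x = push ?K r p x"
    using bal
  proof eventually_elim
    case (elim x)
    then show ?case using le[of x] by linarith
  qed
  have "equid \<Lambda> (push ?K r c) (push ?K r p)"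
    by (rule equid_cong_AE[OF eq1 _ ae2]) (simp add: le)
  then show ?thesis
    using equid_trans[OF equid_trans[OF Pc(2)] equid_sym[OF Pp neg]] \<Lambda>_add by blast
qed

end

section \<open>Lattices and adapted bases\<close>

definition add_subgroup :: "'a::ab_group_add set \<Rightarrow> bool" where
  "add_subgroup H \<longleftrightarrow> 0 \<in> H \<and> (\<forall>x\<in>H. \<forall>y\<in>H. x + y \<in> H) \<and> (\<forall>x\<in>H. - x \<in> H)"

lemma add_subgroupD:
  assumes "add_subgroup H"
  shows "0 \<in> H" "\<lbrakk>x \<in> H; y \<in> H\<rbrakk> \<Longrightarrow> x + y \<in> H" "x \<in> H \<Longrightarrow> - x \<in> H" "\<lbrakk>x \<in> H; y \<in> H\<rbrakk> \<Longrightarrow> x - y \<in> H"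
proof -
  show "0 \<in> H" "\<lbrakk>x \<in> H; y \<in> H\<rbrakk> \<Longrightarrow> x + y \<in> H" "x \<in> H \<Longrightarrow> - x \<in> H"
    using assms by (auto simp: add_subgroup_def)
  show "x - y \<in> H" if "x \<in> H" "y \<in> H"
    using assms that unfolding add_subgroup_def by (metis add_uminus_conv_diff)
qed

lemma add_subgroup_sum:
  assumes "add_subgroup H" "\<And>i. i \<in> S \<Longrightarrow> f i \<in> H"
  shows "sum f S \<in> H"
  using assms by (induction S rule: infinite_finite_induct) (auto simp: add_subgroupD)

lemma add_subgroup_nat_scale:
  fixes x :: "'a::real_vector"
  assumes "add_subgroup H" "x \<in> H"
  shows "of_nat n *\<^sub>R x \<in> H"
  by (induction n) (auto simp: assms add_subgroupD[OF assms(1)] scaleR_add_left)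

lemma add_subgroup_int_scale:
  fixes x :: "'a::real_vector"
  assumes "add_subgroup H" "x \<in> H"
  shows "of_int n *\<^sub>R x \<in> H"
  using add_subgroup_nat_scale[OF assms] add_subgroupD(3)[OF assms(1)] by (cases n rule: int_cases2) force+

text \<open>Differences carry the isolation of 0 to all points with the same radius, so the group is
  uniformly discrete.\<close>

lemma discrete_add_subgroup_finite:
  fixes H :: "'a::euclidean_space set"
  assumes H: "add_subgroup H" "discrete H" and S: "bounded S"
  shows "finite (H \<inter> S)"
proof -
  have "0 isolated_in H" using H add_subgroupD(1) discreteD by blast
  then obtain \<epsilon> where \<epsilon>: "\<epsilon> > 0" "\<And>y. \<lbrakk>y \<in> H; dist 0 y < \<epsilon>\<rbrakk> \<Longrightarrow> y = 0"
    unfolding isolated_in_dist_Ex_iff by blast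
  have "uniform_discrete H"
  proof (rule uniformI1[OF \<epsilon>(1)])
    fix x y assume xy: "x \<in> H" "y \<in> H" "dist x y < \<epsilon>"
    have "y - x = 0"
      by (rule \<epsilon>(2)) (use xy add_subgroupD(4)[OF H(1)] in \<open>auto simp: dist_norm norm_minus_commute\<close>)
    then show "x = y" by simp
  qed
  then have "uniform_discrete (H \<inter> S)" by (rule uniform_discrete_subset) auto
  moreover have "bounded (H \<inter> S)" using S by (rule bounded_subset) auto
  ultimately show ?thesis using uniform_discrete_finite_iff by blast
qed

definition zspan :: "'a::real_vector set \<Rightarrow> 'a set" where
  "zspan B = {\<Sum>b\<in>B. of_int (z b) *\<^sub>R b | z::'a \<Rightarrow> int. True}"

lemma zspan_subset:
  assumes "add_subgroup H" "B \<subseteq> H"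
  shows "zspan B \<subseteq> H"
  unfolding zspan_def using assms by (auto intro!: add_subgroup_sum add_subgroup_int_scale)

lemma zspan_span: "zspan B \<subseteq> span B"
  unfolding zspan_def by (auto intro: span_sum span_scale span_base)

lemma zspan_insert:
  assumes "finite B" "b \<notin> B" "y - of_int n *\<^sub>R b \<in> zspan B"
  shows "y \<in> zspan (insert b B)"
proof -
  obtain z where z: "y - of_int n *\<^sub>R b = (\<Sum>b\<in>B. of_int (z b) *\<^sub>R b)" using assms(3) by (auto simp: zspan_def)
  have "(\<Sum>x\<in>B. of_int ((z(b := n)) x) *\<^sub>R x) = (\<Sum>x\<in>B. of_int (z x) *\<^sub>R x)"
    using assms(2) by (intro sum.cong) auto
  then have "y = (\<Sum>x\<in>insert b B. of_int ((z(b := n)) x) *\<^sub>R x)"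
    using assms(1,2) z by (simp add: algebra_simps)
  then show ?thesis unfolding zspan_def by blast
qed

lemma span_coefficients:
  assumes "finite B" "y \<in> span B"
  obtains c where "y = (\<Sum>b\<in>B. c b *\<^sub>R b)"
  using assms by (auto simp: span_finite)

section \<open>Bases of discrete subgroups\<close>

text \<open>Among the finitely many points of \<open>H\<close> in a bounded parallelepiped,
  \<open>b\<close> has the least positive \<open>x0\<close>-coefficient. A point of \<open>H\<close>
  whose coefficient is not an integral multiple of that of \<open>b\<close> would, after reduction
  modulo \<open>b\<close> and \<open>B\<close>, give a smaller one.\<close>

lemma lattice_basis_step:
  fixes H :: "'a::euclidean_space set"
  assumes H: "add_subgroup H" "discrete H"
    and B: "finite B" "B \<subseteq> H" "H \<inter> span B \<subseteq> zspan B" and x0: "x0 \<in> H" "x0 \<notin> span B"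
  obtains b where "b \<in> H" "b \<notin> span B" "H \<inter> span (insert b B) \<subseteq> zspan (insert b B)"
proof -
  define T where "T = {y \<in> H. \<exists>c t. y = (\<Sum>b\<in>B. c b *\<^sub>R b) + t *\<^sub>R x0 \<and> (\<forall>b\<in>B. 0 \<le> c b \<and> c b \<le> 1) \<and> 0 < t \<and> t \<le> 1}"
  have T_bound: "norm y \<le> (\<Sum>b\<in>B. norm b) + norm x0" if y: "y \<in> T" for y
  proof -
    obtain c t where ct: "y = (\<Sum>b\<in>B. c b *\<^sub>R b) + t *\<^sub>R x0" "\<And>b. b \<in> B \<Longrightarrow> 0 \<le> c b \<and> c b \<le> 1" "0 < t" "t \<le> 1"
      using y unfolding T_def by blast
    have "norm (\<Sum>b\<in>B. c b *\<^sub>R b) \<le> (\<Sum>b\<in>B. norm b)"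
      by (intro sum_norm_le) (use ct(2) in \<open>auto simp: mult_left_le_one_le\<close>)
    moreover have "norm (t *\<^sub>R x0) \<le> norm x0" using ct(3,4) by (simp add: mult_left_le_one_le)
    ultimately show ?thesis using norm_triangle_ineq[of "\<Sum>b\<in>B. c b *\<^sub>R b" "t *\<^sub>R x0"] unfolding ct(1) by linarith
  qed
  have "bounded T" unfolding bounded_iff using T_bound by blast
  then have "finite (H \<inter> T)" by (rule discrete_add_subgroup_finite[OF H])
  moreover have "H \<inter> T = T" by (auto simp: T_def)
  ultimately have Tfin: "finite T" by simp
  have "x0 \<in> T" unfolding T_def using x0(1)
    by (intro CollectI conjI exI[of _ "\<lambda>_. 0"] exI[of _ 1]) auto
  have uniq: "t = t'" if "y - t *\<^sub>R x0 \<in> span B" "y - t' *\<^sub>R x0 \<in> span B" for y t t'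
  proof (rule ccontr)
    assume "t \<noteq> t'"
    have d: "(t - t') *\<^sub>R x0 = (y - t' *\<^sub>R x0) - (y - t *\<^sub>R x0)" by (simp add: algebra_simps)
    have "(t - t') *\<^sub>R x0 \<in> span B" unfolding d by (rule span_diff[OF that(2,1)])
    then have "(1 / (t - t')) *\<^sub>R ((t - t') *\<^sub>R x0) \<in> span B" by (rule span_scale)
    then show False using x0(2) \<open>t \<noteq> t'\<close> by simp
  qed
  have cspan: "(\<Sum>b\<in>B. c b *\<^sub>R b) \<in> span B" for c by (intro span_sum span_scale span_base)
  \<comment> \<open>The \<open>x0\<close>-coefficient modulo \<open>span B\<close>, well defined
    because \<open>x0\<close> lies outside this span.\<close>
  define f where "f = (\<lambda>y. SOME t. y - t *\<^sub>R x0 \<in> span B)"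
  have f: "f y = t" if "y - t *\<^sub>R x0 \<in> span B" for y t
    unfolding f_def by (rule some_equality) (use that uniq in auto)
  obtain b where b: "b \<in> T" "\<And>y. y \<in> T \<Longrightarrow> f b \<le> f y"
    using ex_is_arg_min_if_finite[OF Tfin, of f] \<open>x0 \<in> T\<close> by (auto simp: is_arg_min_linorder)
  obtain cb t1 where ct: "b = (\<Sum>x\<in>B. cb x *\<^sub>R x) + t1 *\<^sub>R x0" "0 < t1" "t1 \<le> 1" and bH: "b \<in> H"
    using b(1) unfolding T_def by blast
  have bt: "b - t1 *\<^sub>R x0 \<in> span B" using ct(1) cspan by simp
  then have fb: "f b = t1" by (rule f)
  have bB: "b \<notin> span B"
  proof
    assume "b \<in> span B"
    then have "f b = 0" by (intro f) simp
    then show False using fb ct(2) by simp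
  qed
  have "y \<in> zspan (insert b B)" if y: "y \<in> H" "y \<in> span (insert b B)" for y
  proof -
    obtain s where s: "y - s *\<^sub>R b \<in> span B" using y(2) by (auto simp: span_breakdown_eq)
    define n where "n = \<lfloor>s\<rfloor>"
    define y' where "y' = y - of_int n *\<^sub>R b"
    have y'H: "y' \<in> H" unfolding y'_def
      by (intro add_subgroupD(4)[OF H(1)] y(1) add_subgroup_int_scale[OF H(1)] bH)
    have "s = of_int n"
    proof (rule ccontr)
      assume ne: "s \<noteq> of_int n"
      define t where "t = (s - of_int n) * t1"
      have sn: "0 < s - of_int n" "s - of_int n < 1" using ne unfolding n_def by linarith+
      have t: "0 < t" "t < t1" using sn ct(2) by (simp_all add: t_def)
      have "y' - t *\<^sub>R x0 = (y - s *\<^sub>R b) + (s - of_int n) *\<^sub>R (b - t1 *\<^sub>R x0)"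
        by (simp add: y'_def t_def algebra_simps)
      then have "y' - t *\<^sub>R x0 \<in> span B" using s bt by (simp add: span_add span_scale)
      then obtain c where c: "y' - t *\<^sub>R x0 = (\<Sum>x\<in>B. c x *\<^sub>R x)" using span_coefficients[OF B(1)] by blast
      define y'' where "y'' = y' - (\<Sum>x\<in>B. of_int \<lfloor>c x\<rfloor> *\<^sub>R x)"
      have eq: "y'' = (\<Sum>x\<in>B. frac (c x) *\<^sub>R x) + t *\<^sub>R x0"
        using c unfolding y''_def frac_def by (simp add: sum_subtractf scaleR_diff_left algebra_simps)
      have "y'' \<in> H" unfolding y''_def
        by (intro add_subgroupD(4)[OF H(1)] y'H add_subgroup_sum[OF H(1)] add_subgroup_int_scale[OF H(1)])
          (use B(2) in auto)
      then have "y'' \<in> T" unfolding T_def using eq t ct(3)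
        by (intro CollectI conjI exI[of _ "\<lambda>x. frac (c x)"] exI[of _ t]) (auto simp: frac_ge_0 less_imp_le[OF frac_lt_1])
      moreover have "f y'' = t" by (rule f) (use eq cspan in simp)
      ultimately show False using b(2)[of y''] fb t by simp
    qed
    then have "y' \<in> span B" using s by (simp add: y'_def)
    then have "y' \<in> zspan B" using y'H B(3) by blast
    then show ?thesis unfolding y'_def by (rule zspan_insert[OF B(1), rotated]) (use bB span_base in blast)
  qed
  then show thesis using that[of b] bH bB by blast
qed

lemma lattice_basis_extend:
  fixes H :: "'a::euclidean_space set"
  assumes H: "add_subgroup H" "discrete H"
    and B: "independent B" "B \<subseteq> H" "H \<inter> span B \<subseteq> zspan B"
  obtains B' where "B \<subseteq> B'" "B' \<subseteq> H" "independent B'" "H \<subseteq> zspan B'"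
  using B
proof (induction "DIM('a) - card B" arbitrary: B thesis rule: less_induct)
  case less
  have fin: "finite B" using less.prems(2) independent_bound by blast
  show thesis
  proof (cases "H \<subseteq> span B")
    case True
    then show thesis using less.prems by blast
  next
    case False
    then obtain x0 where x0: "x0 \<in> H" "x0 \<notin> span B" by blast
    obtain b where b: "b \<in> H" "b \<notin> span B" "H \<inter> span (insert b B) \<subseteq> zspan (insert b B)"
      by (rule lattice_basis_step[OF H fin less.prems(3,4) x0])
    have ind: "independent (insert b B)" using b(2) less.prems(2) by (simp add: independent_insert)
    have "b \<notin> B" using b(2) span_base by blast
    moreover have "card (insert b B) \<le> DIM('a)" using independent_bound[OF ind] by simp
    ultimately have lt: "DIM('a) - card (insert b B) < DIM('a) - card B" using fin by simp
    show thesis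
      by (rule less.hyps[OF lt _ ind]) (use less.prems b in auto)
  qed
qed

text \<open>A subgroup that contains all its rational multiples inside a discrete group is a direct summand:
  the multiples of a point of its span repeat modulo the subgroup.\<close>

lemma pure_subgroup_span:
  fixes H :: "'a::euclidean_space set"
  assumes H: "add_subgroup H" "discrete H" and B: "finite B" "B \<subseteq> H"
    and pure: "\<And>x n. \<lbrakk>x \<in> H; n > 0; of_nat n *\<^sub>R x \<in> zspan B\<rbrakk> \<Longrightarrow> x \<in> zspan B"
  shows "H \<inter> span B \<subseteq> zspan B"
proof clarify
  fix x assume x: "x \<in> H" "x \<in> span B"
  obtain c where c: "x = (\<Sum>b\<in>B. c b *\<^sub>R b)" using span_coefficients[OF B(1) x(2)] .
  define g where "g = (\<lambda>n::nat. \<Sum>b\<in>B. frac (of_nat n * c b) *\<^sub>R b)"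
  have g: "of_nat n *\<^sub>R x - g n = (\<Sum>b\<in>B. of_int \<lfloor>of_nat n * c b\<rfloor> *\<^sub>R b)" for n
    unfolding g_def c frac_def by (simp add: scaleR_sum_right sum_subtractf[symmetric] scaleR_diff_left[symmetric])
  have gH: "g n \<in> H" for n
  proof -
    have "(\<Sum>b\<in>B. of_int \<lfloor>of_nat n * c b\<rfloor> *\<^sub>R b) \<in> H"
      by (intro add_subgroup_sum[OF H(1)] add_subgroup_int_scale[OF H(1)]) (use B in auto)
    moreover have "g n = of_nat n *\<^sub>R x - (\<Sum>b\<in>B. of_int \<lfloor>of_nat n * c b\<rfloor> *\<^sub>R b)" using g[of n] by (simp add: algebra_simps)
    ultimately show ?thesis using add_subgroupD(4)[OF H(1)] add_subgroup_nat_scale[OF H(1) x(1)] by metis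
  qed
  have "norm (g n) \<le> (\<Sum>b\<in>B. norm b)" for n
    unfolding g_def by (intro sum_norm_le) (auto simp: mult_left_le_one_le frac_ge_0 less_imp_le[OF frac_lt_1])
  then have "bounded (range g)" unfolding bounded_iff by blast
  then have "finite (H \<inter> range g)" by (rule discrete_add_subgroup_finite[OF H])
  moreover have "H \<inter> range g = range g" using gH by auto
  ultimately have "\<not> inj g" using finite_imageD[of g UNIV] by auto
  then obtain m n where mn: "g m = g n" "m < n" unfolding inj_def by (metis linorder_neqE_nat)
  have "of_nat (n - m) *\<^sub>R x = (of_nat n *\<^sub>R x - g n) - (of_nat m *\<^sub>R x - g m)"
    using mn by (simp add: of_nat_diff scaleR_diff_left)
  also have "\<dots> = (\<Sum>b\<in>B. of_int (\<lfloor>of_nat n * c b\<rfloor> - \<lfloor>of_nat m * c b\<rfloor>) *\<^sub>R b)"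
    unfolding g by (simp add: sum_subtractf scaleR_diff_left)
  finally have "of_nat (n - m) *\<^sub>R x \<in> zspan B" unfolding zspan_def
    by (intro CollectI exI[of _ "\<lambda>b. \<lfloor>of_nat n * c b\<rfloor> - \<lfloor>of_nat m * c b\<rfloor>"]) simp
  then show "x \<in> zspan B" using pure[OF x(1), of "n - m"] mn by simp
qed


section \<open>Lattices as images of the integer vectors\<close>

lemma matrix_vector_mult_columns: "A *v x = (\<Sum>i\<in>UNIV. x $ i *\<^sub>R column i A)"
  for A :: "real ^ 'n ^ 'm"
  by (simp add: matrix_mult_sum scalar_mult_eq_scaleR)

lemma zspan_matrix_lattice:
  fixes A :: "real ^ 'n ^ 'n"
  assumes bij: "bij_betw (\<lambda>i. column i A) UNIV B" and ind: "independent B"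
  shows "invertible A"
    and "S \<subseteq> B \<Longrightarrow> zspan S = {A *v z | z. z \<in> int_vectors \<and> (\<forall>i. column i A \<notin> S \<longrightarrow> z $ i = 0)}"
proof -
  let ?g = "inv_into UNIV (\<lambda>i. column i A)"
  have fin: "finite B" using bij by (meson bij_betw_finite finite)
  have inj: "inj (\<lambda>i. column i A)" using bij by (simp add: bij_betw_def)
  have gi: "?g (column i A) = i" for i by (rule inv_f_f[OF inj])
  have "inj ((*v) A)"
  proof (rule injI)
    fix x y assume eq: "A *v x = A *v y"
    define u where "u = (\<lambda>b. (x - y) $ ?g b)"
    have "(\<Sum>b\<in>B. u b *\<^sub>R b) = (\<Sum>i\<in>UNIV. u (column i A) *\<^sub>R column i A)"
      by (rule sum.reindex_bij_betw[OF bij, symmetric])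
    also have "\<dots> = A *v (x - y)" by (simp add: u_def gi matrix_vector_mult_columns)
    also have "\<dots> = 0" using eq by (simp add: matrix_vector_mult_diff_distrib)
    finally have u0: "\<forall>b\<in>B. u b = 0" using ind fin by (auto simp: dependent_finite)
    have "(x - y) $ i = 0" for i
    proof -
      have "column i A \<in> B" using bij by (auto simp: bij_betw_def)
      then show ?thesis using u0 gi[of i] unfolding u_def by metis
    qed
    then show "x = y" by (simp add: vec_eq_iff)
  qed
  then show "invertible A" using matrix_left_invertible_injective invertible_left_inverse by blast
  assume S: "S \<subseteq> B"
  have Sfin: "finite S" using S fin finite_subset by blast
  have eq: "(\<Sum>b\<in>S. f (?g b) *\<^sub>R b) = A *v (\<chi> i. if column i A \<in> S then f i else 0)" for f :: "'n \<Rightarrow> real"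
  proof -
    have "(\<Sum>b\<in>S. f (?g b) *\<^sub>R b) = (\<Sum>b\<in>B. (if b \<in> S then f (?g b) else 0) *\<^sub>R b)"
      by (rule sum.mono_neutral_cong_left) (use S fin in auto)
    also have "\<dots> = (\<Sum>i\<in>UNIV. (if column i A \<in> S then f (?g (column i A)) else 0) *\<^sub>R column i A)"
      by (rule sum.reindex_bij_betw[OF bij, symmetric])
    also have "\<dots> = A *v (\<chi> i. if column i A \<in> S then f i else 0)"
      unfolding gi by (simp add: matrix_vector_mult_columns)
    finally show ?thesis .
  qed
  show "zspan S = {A *v z | z. z \<in> int_vectors \<and> (\<forall>i. column i A \<notin> S \<longrightarrow> z $ i = 0)}"
  proof (intro equalityI subsetI)
    fix y assume "y \<in> zspan S"
    then obtain z :: "real ^ 'n \<Rightarrow> int" where y: "y = (\<Sum>b\<in>S. of_int (z b) *\<^sub>R b)" by (auto simp: zspan_def)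
    have "y = (\<Sum>b\<in>S. of_int (z (column (?g b) A)) *\<^sub>R b)"
      unfolding y
    proof (rule sum.cong[OF refl])
      fix b assume "b \<in> S"
      then obtain i where "b = column i A" using S bij by (auto simp: bij_betw_def)
      then show "of_int (z b) *\<^sub>R b = of_int (z (column (?g b) A)) *\<^sub>R b" using gi[of i] by metis
    qed
    also have "\<dots> = A *v (\<chi> i. if column i A \<in> S then of_int (z (column i A)) else 0)"
      by (rule eq[of "\<lambda>i. of_int (z (column i A))"])
    finally show "y \<in> {A *v z | z. z \<in> int_vectors \<and> (\<forall>i. column i A \<notin> S \<longrightarrow> z $ i = 0)}"
      by (intro CollectI exI[of _ "\<chi> i. if column i A \<in> S then of_int (z (column i A)) else 0"])
        (auto simp: int_vectors_def)
  next
    fix y assume "y \<in> {A *v z | z. z \<in> int_vectors \<and> (\<forall>i. column i A \<notin> S \<longrightarrow> z $ i = 0)}"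
    then obtain z where z: "y = A *v z" "z \<in> int_vectors" "\<And>i. column i A \<notin> S \<Longrightarrow> z $ i = 0" by blast
    have fl: "of_int \<lfloor>z $ i\<rfloor> = z $ i" for i using z(2) by (auto simp: int_vectors_def elim!: Ints_cases)
    have "(\<chi> i. if column i A \<in> S then z $ i else 0) = z" using z(3) by (auto simp: vec_eq_iff)
    then have "y = (\<Sum>b\<in>S. of_int \<lfloor>z $ ?g b\<rfloor> *\<^sub>R b)" using eq[of "\<lambda>i. z $ i"] z(1) by (simp add: fl)
    then show "y \<in> zspan S" unfolding zspan_def by (intro CollectI exI[of _ "\<lambda>b. \<lfloor>z $ ?g b\<rfloor>"]) simp
  qed
qed

lemma euclidean_lattice_iff:
  "euclidean_lattice L \<longleftrightarrow> add_subgroup L \<and> discrete L \<and> span L = UNIV"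
  by (auto simp: euclidean_lattice_def add_subgroup_def)

text \<open>A basis of \<tau> extends to one of \<open>M\<close>, because purity puts all points of
  \<open>M\<close> in the real span of \<tau> into \<tau> itself. The set \<open>I\<close> indexes
  the columns added in the extension.\<close>

lemma lattice_adapted_basis:
  fixes M \<tau> :: "(real ^ 'n) set"
  assumes M: "euclidean_lattice M" and \<tau>: "add_subgroup \<tau>" "\<tau> \<subseteq> M"
    and pure: "\<And>x n. \<lbrakk>x \<in> M; n > 0; of_nat n *\<^sub>R x \<in> \<tau>\<rbrakk> \<Longrightarrow> x \<in> \<tau>"
  obtains A :: "real ^ 'n ^ 'n" and I where "invertible A" "M = matrix_lattice A"
    "\<tau> = {A *v z | z. z \<in> int_vectors \<and> (\<forall>i\<in>I. z $ i = 0)}"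
proof -
  have M': "add_subgroup M" "discrete M" "span M = UNIV" using M by (auto simp: euclidean_lattice_iff)
  have \<tau>d: "discrete \<tau>" using M'(2) \<tau>(2) by (rule discrete_subset)
  have "\<tau> \<inter> span {} \<subseteq> zspan {}" by (auto simp: zspan_def)
  then obtain B where B: "B \<subseteq> \<tau>" "independent B" "\<tau> \<subseteq> zspan B"
    using lattice_basis_extend[OF \<tau>(1) \<tau>d, of "{}"] by (metis empty_subsetI independent_empty)
  have Bz: "\<tau> = zspan B" using B(3) zspan_subset[OF \<tau>(1) B(1)] by blast
  have Bfin: "finite B" using B(2) independent_bound by blast
  have BM: "B \<subseteq> M" using B(1) \<tau>(2) by blast
  have "M \<inter> span B \<subseteq> zspan B"
    using pure_subgroup_span[OF M'(1,2) Bfin BM] pure unfolding Bz[symmetric] by blast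
  then obtain B' where B': "B \<subseteq> B'" "B' \<subseteq> M" "independent B'" "M \<subseteq> zspan B'"
    using lattice_basis_extend[OF M'(1,2) B(2) BM] by metis
  have Mz: "M = zspan B'" using B'(4) zspan_subset[OF M'(1) B'(2)] by blast
  have "span M \<subseteq> span B'" using span_mono[OF order.trans[OF B'(4) zspan_span]] by (simp add: span_span)
  then have "span B' = UNIV" using M'(3) by auto
  then have "card B' = CARD('n)" using dim_eq_card[of B' UNIV] B'(3) by (simp add: dim_UNIV)
  moreover have fin': "finite B'" using B'(3) independent_bound by blast
  ultimately obtain g where g: "bij_betw g (UNIV :: 'n set) B'"
    using finite_same_card_bij[of "UNIV :: 'n set" B'] by auto
  define A :: "real ^ 'n ^ 'n" where "A = (\<chi> r c. g c $ r)"
  have col: "column i A = g i" for i by (simp add: A_def column_def vec_eq_iff)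
  have bij: "bij_betw (\<lambda>i. column i A) UNIV B'" using g by (simp add: col)
  have cB: "column i A \<in> B'" for i using bij by (auto simp: bij_betw_def)
  show thesis
  proof (rule that)
    show "invertible A" by (rule zspan_matrix_lattice(1)[OF bij B'(3)])
    show "M = matrix_lattice A"
      unfolding Mz zspan_matrix_lattice(2)[OF bij B'(3) order.refl] matrix_lattice_def using cB by auto
    show "\<tau> = {A *v z | z. z \<in> int_vectors \<and> (\<forall>i\<in>{i. column i A \<notin> B}. z $ i = 0)}"
      unfolding Bz zspan_matrix_lattice(2)[OF bij B'(3) B'(1)] by auto
  qed
qed

lemma euclidean_lattice_matrix:
  assumes "euclidean_lattice L"
  obtains A where "invertible A" "L = matrix_lattice A"
proof -
  have L: "add_subgroup L" using assms by (simp add: euclidean_lattice_iff)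
  show thesis
  proof (rule lattice_adapted_basis[OF assms, of "{0}"])
    show "add_subgroup {0 :: real ^ 'a}" by (simp add: add_subgroup_def)
    show "{0} \<subseteq> L" using add_subgroupD(1)[OF L] by simp
  qed (use that in auto)
qed

lemma discrete_add_subgroup_multiple:
  fixes H L :: "'a::real_normed_vector set"
  assumes L: "add_subgroup L" "discrete L" and H: "add_subgroup H"
    and K: "K > 0" "\<And>x. x \<in> H \<Longrightarrow> of_nat K *\<^sub>R x \<in> L"
  shows "discrete H"
proof (rule discreteI)
  fix x assume x: "x \<in> H"
  have "0 isolated_in L" using L add_subgroupD(1) discreteD by blast
  then obtain \<epsilon> where \<epsilon>: "\<epsilon> > 0" "\<And>y. \<lbrakk>y \<in> L; dist 0 y < \<epsilon>\<rbrakk> \<Longrightarrow> y = 0"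
    unfolding isolated_in_dist_Ex_iff by blast
  show "x isolated_in H"
    unfolding isolated_in_dist_Ex_iff
  proof (intro conjI x exI[of _ "\<epsilon> / of_nat K"] ballI impI)
    show "0 < \<epsilon> / of_nat K" using \<epsilon>(1) K(1) by simp
    fix y assume y: "y \<in> H" "dist x y < \<epsilon> / of_nat K"
    have "of_nat K *\<^sub>R (y - x) = 0"
    proof (rule \<epsilon>(2))
      show "of_nat K *\<^sub>R (y - x) \<in> L" by (intro K(2) add_subgroupD(4)[OF H] y(1) x)
      have "of_nat K * norm (y - x) < \<epsilon>"
        using y(2) K(1) by (simp add: dist_norm norm_minus_commute pos_less_divide_eq mult.commute)
      then show "dist 0 (of_nat K *\<^sub>R (y - x)) < \<epsilon>" by (simp add: dist_norm)
    qed
    then show "y = x" using K(1) by simp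
  qed
qed

section \<open>Periodic measures\<close>

interpretation lb: translation_invariant "lborel :: 'a::euclidean_space measure"
proof
  show "(\<lambda>x. x + v) \<in> lborel \<rightarrow>\<^sub>M lborel" for v :: 'a by measurable
  fix A :: "'a set" and v :: 'a assume A: "A \<in> sets lborel"
  have "emeasure lborel A = emeasure (distr lborel borel ((+) v)) A" by (simp add: lborel_distr_plus)
  also have "\<dots> = emeasure lborel ((+) v -` A \<inter> space lborel)"
    by (rule emeasure_distr) (use A in auto)
  also have "(+) v -` A \<inter> space lborel = (\<lambda>x. x + v) -` A" by (auto simp: add.commute)
  finally show "emeasure lborel ((\<lambda>x. x + v) -` A) = emeasure lborel A" by simp
qed simp

section \<open>Bounded functions with bounded support\<close>

definition nice :: "('a::real_normed_vector \<Rightarrow> real) \<Rightarrow> bool" where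
  "nice f \<longleftrightarrow> f \<in> borel_measurable borel \<and> (\<exists>R. \<forall>x. f x \<noteq> 0 \<longrightarrow> norm x \<le> R) \<and> (\<exists>C. \<forall>x. \<bar>f x\<bar> \<le> C)"

lemma nice_add: "nice f \<Longrightarrow> nice g \<Longrightarrow> nice (\<lambda>x. f x + g x)"
proof -
  assume "nice f" "nice g"
  then obtain R1 C1 R2 C2 where *: "f \<in> borel_measurable borel" "g \<in> borel_measurable borel"
    "\<And>x. f x \<noteq> 0 \<Longrightarrow> norm x \<le> R1" "\<And>x. \<bar>f x\<bar> \<le> C1" "\<And>x. g x \<noteq> 0 \<Longrightarrow> norm x \<le> R2" "\<And>x. \<bar>g x\<bar> \<le> C2"
    unfolding nice_def by metis
  show "nice (\<lambda>x. f x + g x)"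
    unfolding nice_def
  proof (intro conjI exI allI impI)
    show "(\<lambda>x. f x + g x) \<in> borel_measurable borel" using * by measurable
    show "norm x \<le> max R1 R2" if "f x + g x \<noteq> 0" for x
    proof -
      have "f x \<noteq> 0 \<or> g x \<noteq> 0" using that by auto
      then show ?thesis using *(3)[of x] *(5)[of x] by auto
    qed
    show "\<bar>f x + g x\<bar> \<le> C1 + C2" for x using *(4)[of x] *(6)[of x] by linarith
  qed
qed

lemma nice_zero: "nice (\<lambda>_. 0)" by (auto simp: nice_def)

lemma nice_uminus: "nice f \<Longrightarrow> nice (\<lambda>x. - f x)"
  unfolding nice_def by auto

lemma nice_diff: "nice f \<Longrightarrow> nice g \<Longrightarrow> nice (\<lambda>x. f x - g x)"
  using nice_add[OF _ nice_uminus] by simp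

lemma nice_shift: "nice f \<Longrightarrow> nice (\<lambda>x. f (x - v))"
proof -
  assume "nice f"
  then obtain R C where *: "f \<in> borel_measurable borel" "\<And>x. f x \<noteq> 0 \<Longrightarrow> norm x \<le> R" "\<And>x. \<bar>f x\<bar> \<le> C"
    unfolding nice_def by metis
  show "nice (\<lambda>x. f (x - v))"
    unfolding nice_def
  proof (intro conjI exI allI impI)
    have "(\<lambda>x. x - v) \<in> borel_measurable borel" by (intro borel_measurable_continuous_onI continuous_intros)
    from measurable_compose[OF this *(1)] show "(\<lambda>x. f (x - v)) \<in> borel_measurable borel" .
    show "norm x \<le> R + norm v" if "f (x - v) \<noteq> 0" for x
      using *(2)[OF that] norm_triangle_sub[of x v] by linarith
    show "\<bar>f (x - v)\<bar> \<le> C" for x by (rule *)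
  qed
qed

lemma nice_restrict: "nice f \<Longrightarrow> S \<in> sets borel \<Longrightarrow> nice (\<lambda>x. if x \<in> S then f x else 0)"
proof -
  assume "nice f" and S[measurable]: "S \<in> sets borel"
  then obtain R C where *: "f \<in> borel_measurable borel" "\<And>x. f x \<noteq> 0 \<Longrightarrow> norm x \<le> R" "\<And>x. \<bar>f x\<bar> \<le> C"
    unfolding nice_def by metis
  show "nice (\<lambda>x. if x \<in> S then f x else 0)"
    unfolding nice_def
  proof (intro conjI exI allI impI)
    show "(\<lambda>x. if x \<in> S then f x else 0) \<in> borel_measurable borel" using *(1) by measurable
    show "norm x \<le> R" if "(if x \<in> S then f x else 0) \<noteq> 0" for x using *(2)[of x] that by (auto split: if_splits)
    show "\<bar>if x \<in> S then f x else 0\<bar> \<le> C" for x using *(3)[of x] by auto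
  qed
qed

lemma nice_indicator: "bounded S \<Longrightarrow> S \<in> sets borel \<Longrightarrow> nice (indicat_real S)"
proof -
  assume S: "bounded S" "S \<in> sets borel"
  obtain R where R: "\<And>x. x \<in> S \<Longrightarrow> norm x \<le> R" using S(1) bounded_iff by blast
  show ?thesis
    unfolding nice_def
  proof (intro conjI exI allI impI)
    show "norm x \<le> R" if "indicat_real S x \<noteq> 0" for x using that R by (auto simp: indicator_def split: if_splits)
    show "\<bar>indicat_real S x\<bar> \<le> 1" for x by (simp add: indicator_def)
  qed (use S in measurable)
qed

section \<open>Lattice coordinates and the fundamental parallelepiped\<close>

locale basis_matrix =
  fixes A Ai :: "real ^ 'n ^ 'n"
  assumes A_Ai: "A ** Ai = mat 1" and Ai_A: "Ai ** A = mat 1"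
    and discr: "discrete (matrix_lattice A)"
begin

abbreviation lat :: "(real ^ 'n) set" where "lat \<equiv> matrix_lattice A"

definition coord :: "'n \<Rightarrow> real ^ 'n \<Rightarrow> real" where "coord i x = (Ai *v x) $ i"

lemma linear_coord: "linear (coord i)"
  by (rule linearI) (simp_all add: coord_def matrix_vector_right_distrib matrix_vector_mult_scaleR)

lemma coord_add: "coord i (x + y) = coord i x + coord i y" and coord_diff: "coord i (x - y) = coord i x - coord i y"
  by (simp_all add: linear_add[OF linear_coord] linear_diff[OF linear_coord])

lemma coord_mult: "coord i (A *v z) = z $ i"
  by (simp add: coord_def matrix_vector_mul_assoc Ai_A)

lemma coord_column: "coord i (column j A) = (if i = j then 1 else 0)"
  using coord_mult[of i "axis j 1"] unfolding matrix_vector_mult_basis by (simp add: axis_def)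

lemma coord_expand: "x = A *v (\<chi> i. coord i x)"
  by (simp add: coord_def matrix_vector_mul_assoc A_Ai)

lemma lat_iff: "x \<in> lat \<longleftrightarrow> (\<forall>i. coord i x \<in> \<int>)"
proof
  assume "x \<in> lat" then show "\<forall>i. coord i x \<in> \<int>"
    by (auto simp: matrix_lattice_def int_vectors_def coord_mult)
next
  assume "\<forall>i. coord i x \<in> \<int>"
  then show "x \<in> lat" unfolding matrix_lattice_def using coord_expand[of x]
    by (intro image_eqI[of _ _ "\<chi> i. coord i x"]) (auto simp: int_vectors_def)
qed

lemma lat_subgroup: "add_subgroup lat"
  unfolding add_subgroup_def
  by (auto simp: lat_iff coord_add linear_neg[OF linear_coord] linear_0[OF linear_coord])

lemmas lat_0 = add_subgroupD(1)[OF lat_subgroup] and lat_add = add_subgroupD(2)[OF lat_subgroup]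
  and lat_minus = add_subgroupD(3)[OF lat_subgroup] and lat_diff = add_subgroupD(4)[OF lat_subgroup]

lemma column_lat: "column i A \<in> lat"
  by (simp add: lat_iff coord_column)

lemma lat_columns:
  assumes "l \<in> lat"
  obtains z :: "'n \<Rightarrow> int" where "l = (\<Sum>i\<in>UNIV. of_int (z i) *\<^sub>R column i A)"
proof -
  have z: "of_int \<lfloor>coord i l\<rfloor> = coord i l" for i using assms lat_iff[of l] by (auto elim!: Ints_cases)
  have "l = (\<Sum>i\<in>UNIV. coord i l *\<^sub>R column i A)"
    using coord_expand[of l] by (simp add: matrix_vector_mult_columns)
  then show thesis using that[of "\<lambda>i. \<lfloor>coord i l\<rfloor>"] z by simp
qed

lemma finite_lat: "bounded S \<Longrightarrow> finite (lat \<inter> S)"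
  by (rule discrete_add_subgroup_finite[OF lat_subgroup discr])

lemma countable_lat: "countable lat"
proof -
  have "lat = (\<Union>n::nat. lat \<inter> cball 0 (of_nat n))"
  proof (intro equalityI subsetI)
    fix x assume x: "x \<in> lat"
    obtain n :: nat where "norm x \<le> of_nat n" using real_arch_simple by blast
    then have "x \<in> lat \<inter> cball 0 (of_nat n)" using x by simp
    then show "x \<in> (\<Union>n::nat. lat \<inter> cball 0 (of_nat n))" by blast
  qed blast
  moreover have "countable (\<Union>n::nat. lat \<inter> cball 0 (of_nat n))"
    by (rule countable_UN[OF _ countable_finite[OF finite_lat]]) simp_all
  ultimately show ?thesis by simp
qed

lemma closed_lat: "closed lat"
proof -
  have "0 isolated_in lat" using discr lat_0 discreteD by blast
  then obtain \<epsilon> where \<epsilon>: "\<epsilon> > 0" "\<And>y. \<lbrakk>y \<in> lat; dist 0 y < \<epsilon>\<rbrakk> \<Longrightarrow> y = 0"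
    unfolding isolated_in_dist_Ex_iff by blast
  show ?thesis
  proof (rule discrete_imp_closed[OF \<epsilon>(1)], intro ballI impI)
    fix x y assume "x \<in> lat" "y \<in> lat" "dist y x < \<epsilon>"
    then show "y = x" using \<epsilon>(2)[of "y - x"] lat_diff[of y x] by (auto simp: dist_norm norm_minus_commute)
  qed
qed

definition fdom :: "(real ^ 'n) set" where
  "fdom = {x. \<forall>i. 0 \<le> coord i x \<and> coord i x < 1}"

lemma coord_measurable [measurable]: "coord i \<in> borel_measurable borel"
  by (intro borel_measurable_continuous_onI linear_continuous_on linear_conv_bounded_linear[THEN iffD1] linear_coord)

lemma fdom_borel [measurable]: "fdom \<in> sets borel"
proof -
  have "{x \<in> space borel. \<forall>i\<in>UNIV. 0 \<le> coord i x \<and> coord i x < 1} \<in> sets borel" by measurable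
  then show ?thesis by (simp add: fdom_def)
qed

lemma fdom_image: "fdom = (*v) A ` {y. \<forall>i. 0 \<le> y $ i \<and> y $ i < 1}"
proof (intro equalityI subsetI)
  fix x assume "x \<in> fdom"
  then show "x \<in> (*v) A ` {y. \<forall>i. 0 \<le> y $ i \<and> y $ i < 1}"
    using coord_expand[of x] by (intro image_eqI[of _ _ "\<chi> i. coord i x"]) (auto simp: fdom_def)
qed (auto simp: fdom_def coord_mult)

lemma bounded_fdom: "bounded fdom"
proof -
  have "{y :: real ^ 'n. \<forall>i. 0 \<le> y $ i \<and> y $ i < 1} \<subseteq> cbox 0 1"
    by (auto simp: mem_box_cart less_imp_le)
  then have "bounded {y :: real ^ 'n. \<forall>i. 0 \<le> y $ i \<and> y $ i < 1}" using bounded_cbox bounded_subset by blast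
  then show ?thesis unfolding fdom_image
    by (rule bounded_linear_image) (rule matrix_vector_mul_bounded_linear)
qed

definition red :: "real ^ 'n \<Rightarrow> real ^ 'n" where
  "red x = x - (\<Sum>i\<in>UNIV. of_int \<lfloor>coord i x\<rfloor> *\<^sub>R column i A)"

lemma coord_sum_columns: "coord j (\<Sum>i\<in>UNIV. c i *\<^sub>R column i A) = c j"
proof -
  have "(\<Sum>i\<in>UNIV. c i *\<^sub>R column i A) = A *v (\<chi> i. c i)" by (simp add: matrix_vector_mult_columns)
  then show ?thesis by (simp add: coord_mult)
qed

lemma red_fdom: "red x \<in> fdom"
  unfolding fdom_def red_def by (simp add: coord_diff coord_sum_columns) (metis frac_def frac_ge_0 frac_lt_1 diff_ge_0_iff_ge diff_less_eq add.commute)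

lemma red_lat: "x - red x \<in> lat"
  by (simp add: red_def lat_iff coord_sum_columns)

lemma fdom_unique: "\<lbrakk>x \<in> fdom; y \<in> fdom; x - y \<in> lat\<rbrakk> \<Longrightarrow> x = y"
proof -
  assume a: "x \<in> fdom" "y \<in> fdom" "x - y \<in> lat"
  have "coord i x = coord i y" for i
  proof -
    obtain t :: int where t: "coord i x - coord i y = of_int t"
      using a(3) by (auto simp: lat_iff coord_diff elim: Ints_cases)
    have "-1 < coord i x - coord i y" "coord i x - coord i y < 1"
      using a(1,2)[unfolded fdom_def, simplified, rule_format, of i] by linarith+
    then have "t = 0" using t by linarith
    then show ?thesis using t by simp
  qed
  then show ?thesis using coord_expand[of x] coord_expand[of y] by simp
qed

lemma red_eq: "\<lbrakk>y \<in> fdom; x - y \<in> lat\<rbrakk> \<Longrightarrow> red x = y"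
proof (rule fdom_unique[OF red_fdom])
  assume "x - y \<in> lat"
  then have "(x - y) - (x - red x) \<in> lat" using red_lat lat_diff by blast
  then show "red x - y \<in> lat" by simp
qed

lemma red_measurable [measurable]: "red \<in> borel_measurable borel"
  unfolding red_def by measurable

lemma fdom_ex1: "\<exists>!l. l \<in> lat \<and> x - l \<in> fdom"
proof (rule ex1I[of _ "x - red x"])
  show "x - red x \<in> lat \<and> x - (x - red x) \<in> fdom" using red_lat red_fdom by simp
  fix l assume "l \<in> lat \<and> x - l \<in> fdom"
  then have "red x = x - l" by (intro red_eq) auto
  then show "l = x - red x" by simp
qed

lemma fdom_ex: "\<exists>l\<in>lat. x - l \<in> fdom"
  using fdom_ex1[of x] by blast

lemma fdom_translate_unique: "\<lbrakk>l \<in> lat; l' \<in> lat; x - l \<in> fdom; x - l' \<in> fdom\<rbrakk> \<Longrightarrow> l = l'"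
  using fdom_ex1[of x] by blast

section \<open>The torus as a measure on periodic sets\<close>

definition Per :: "(real ^ 'n) set set" where
  "Per = {S \<in> sets borel. \<forall>x. \<forall>l\<in>lat. x + l \<in> S \<longleftrightarrow> x \<in> S}"

text \<open>Invariant measure of the torus modulo \<open>lat\<close>, realised on periodic subsets
  of the whole space instead of on a quotient. Translations remain maps of \<open>real ^ 'n\<close>,
  and functions measurable into a \<open>count_space\<close> are periodic
  (\<open>pm_measurable_periodic\<close>).\<close>

definition pm :: "(real ^ 'n) measure" where
  "pm = measure_of UNIV Per (\<lambda>S. emeasure lborel (S \<inter> fdom))"

lemma sigma_Per: "sigma_algebra UNIV Per"
  unfolding sigma_algebra_iff2
  by (auto simp: Per_def Compl_eq_Diff_UNIV[symmetric])

lemma space_pm [simp]: "space pm = UNIV" by (simp add: pm_def)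

lemma sets_pm: "sets pm = Per"
  unfolding pm_def by (simp add: sigma_algebra.sigma_sets_eq[OF sigma_Per])

lemma emeasure_pm: "S \<in> Per \<Longrightarrow> emeasure pm S = emeasure lborel (S \<inter> fdom)"
  unfolding pm_def
proof (rule emeasure_measure_of_sigma[OF sigma_Per])
  show "positive Per (\<lambda>S. emeasure lborel (S \<inter> fdom))" by (simp add: positive_def)
  show "countably_additive Per (\<lambda>S. emeasure lborel (S \<inter> fdom))"
  proof (rule countably_additiveI)
    fix X :: "nat \<Rightarrow> (real ^ 'n) set" assume X: "range X \<subseteq> Per" "disjoint_family X"
    have "(\<Sum>i. emeasure lborel (X i \<inter> fdom)) = emeasure lborel (\<Union>i. X i \<inter> fdom)"
    proof (rule suminf_emeasure)
      show "range (\<lambda>i. X i \<inter> fdom) \<subseteq> sets lborel" using X(1) by (auto simp: Per_def)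
      show "disjoint_family (\<lambda>i. X i \<inter> fdom)" using X(2) unfolding disjoint_family_on_def by blast
    qed
    then show "(\<Sum>i. emeasure lborel (X i \<inter> fdom)) = emeasure lborel (\<Union> (range X) \<inter> fdom)" by simp
  qed
qed

lemma measurable_pm_borel: "f \<in> measurable pm K \<Longrightarrow> f \<in> measurable borel K"
  by (auto simp: measurable_def sets_pm Per_def)

lemma measurable_pmI:
  assumes "f \<in> measurable borel K" "\<And>x l. l \<in> lat \<Longrightarrow> f (x + l) = f x"
  shows "f \<in> measurable pm K"
  using assms by (auto simp: measurable_def sets_pm Per_def)

text \<open>The parallelepiped and its translate are cut into countably many pieces by each other's
  lattice translates. Corresponding pieces are translates of one another, and periodicity of
  \<open>S\<close> makes the parts inside \<open>S\<close> match.\<close>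

lemma emeasure_shift_pm:
  assumes S: "S \<in> Per"
  shows "emeasure lborel ({x. x + v \<in> S} \<inter> fdom) = emeasure lborel (S \<inter> fdom)"
proof -
  have Sb [measurable]: "S \<in> sets borel" and Sp: "\<And>x l. l \<in> lat \<Longrightarrow> x + l \<in> S \<longleftrightarrow> x \<in> S" using S by (auto simp: Per_def)
  define X where "X = (\<lambda>l. {x. x + v \<in> S \<and> x \<in> fdom \<and> x + v - l \<in> fdom})"
  define Y where "Y = (\<lambda>l. {y. y \<in> S \<and> y \<in> fdom \<and> y + l - v \<in> fdom})"
  have Xs: "X l \<in> sets lborel" for l
  proof -
    have "{x \<in> space borel. x + v \<in> S \<and> x \<in> fdom \<and> x + v - l \<in> fdom} \<in> sets borel" by measurable
    then show ?thesis by (simp add: X_def)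
  qed
  have Ys: "Y l \<in> sets lborel" for l
  proof -
    have "{y \<in> space borel. y \<in> S \<and> y \<in> fdom \<and> y + l - v \<in> fdom} \<in> sets borel" by measurable
    then show ?thesis by (simp add: Y_def)
  qed
  have XY: "emeasure lborel (X l) = emeasure lborel (Y l)" if l: "l \<in> lat" for l
  proof -
    have "X l = (\<lambda>x. x + (v - l)) -` Y l"
    proof (rule set_eqI)
      fix x
      have "x + v \<in> S \<longleftrightarrow> x + (v - l) \<in> S" using Sp[OF l, of "x + (v - l)"] by simp
      moreover have "x + (v - l) + l - v = x" "x + v - l = x + (v - l)" by simp_all
      ultimately show "x \<in> X l \<longleftrightarrow> x \<in> (\<lambda>x. x + (v - l)) -` Y l"
        unfolding X_def Y_def vimage_def mem_Collect_eq by metis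
    qed
    then show ?thesis using lb.emeasure_shift[OF Ys] by simp
  qed
  have XU: "{x. x + v \<in> S} \<inter> fdom = (\<Union>l\<in>lat. X l)"
  proof (intro equalityI subsetI)
    fix x assume x: "x \<in> {x. x + v \<in> S} \<inter> fdom"
    obtain l where "l \<in> lat" "x + v - l \<in> fdom" using fdom_ex[of "x + v"] by blast
    then show "x \<in> (\<Union>l\<in>lat. X l)" using x unfolding X_def by blast
  qed (auto simp: X_def)
  have YU: "S \<inter> fdom = (\<Union>l\<in>lat. Y l)"
  proof (intro equalityI subsetI)
    fix y assume y: "y \<in> S \<inter> fdom"
    obtain l where "l \<in> lat" "y - v - l \<in> fdom" using fdom_ex[of "y - v"] by blast
    then have "- l \<in> lat" "y \<in> Y (- l)" using y lat_minus by (auto simp: Y_def algebra_simps)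
    then show "y \<in> (\<Union>l\<in>lat. Y l)" by blast
  qed (auto simp: Y_def)
  have Xd: "disjoint_family_on X lat"
    unfolding disjoint_family_on_def X_def using fdom_translate_unique by blast
  have Yd: "disjoint_family_on Y lat"
    unfolding disjoint_family_on_def
  proof (intro ballI impI)
    fix l l' assume l: "l \<in> lat" "l' \<in> lat" "l \<noteq> l'"
    have False if "y + l - v \<in> fdom" "y + l' - v \<in> fdom" for y
    proof -
      have "(y + l - v) - (y + l' - v) \<in> lat" using lat_diff[OF l(1,2)] by (simp add: algebra_simps)
      then show False using fdom_unique[OF that] l(3) by simp
    qed
    then show "Y l \<inter> Y l' = {}" by (auto simp: Y_def)
  qed
  have "emeasure lborel (\<Union>l\<in>lat. X l) = (\<integral>\<^sup>+l. emeasure lborel (X l) \<partial>count_space lat)"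
    by (rule emeasure_UN_countable[OF Xs countable_lat Xd])
  also have "\<dots> = (\<integral>\<^sup>+l. emeasure lborel (Y l) \<partial>count_space lat)"
    by (intro nn_integral_cong) (simp add: XY)
  also have "\<dots> = emeasure lborel (\<Union>l\<in>lat. Y l)"
    by (rule emeasure_UN_countable[OF Ys countable_lat Yd, symmetric])
  finally show ?thesis unfolding XU YU .
qed

lemma shift_Per: "S \<in> Per \<Longrightarrow> {x. x + v \<in> S} \<in> Per"
proof -
  assume S: "S \<in> Per"
  then have [measurable]: "S \<in> sets borel" by (simp add: Per_def)
  have "{x \<in> space borel. x + v \<in> S} \<in> sets borel" by measurable
  moreover have "x + l + v \<in> S \<longleftrightarrow> x + v \<in> S" if "l \<in> lat" for x l
  proof -
    have e: "x + l + v = x + v + l" by (simp add: ac_simps)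
    show ?thesis unfolding e using S that unfolding Per_def by blast
  qed
  ultimately show ?thesis by (simp add: Per_def)
qed

text \<open>The finite set \<open>F\<close> has a distance \<delta> > 0 from the closed set
  \<open>lat\<close>. A point gets the index of the first periodic union of balls of radius
  \<delta>/2, with centres in a countable dense set, that contains it. If \<open>x\<close> and
  \<open>x + f\<close> had the same colour, \<open>f\<close> would be closer than \<delta> to a
  lattice vector.\<close>

lemma coloring_pm:
  assumes "finite F" "F \<subseteq> - lat"
  shows "\<exists>\<kappa>. \<kappa> \<in> measurable pm (count_space (UNIV::nat set)) \<and> (\<forall>x. \<forall>f\<in>F. \<kappa> (x + f) \<noteq> \<kappa> x)"
proof -
  have "\<exists>\<delta>>0. \<forall>f\<in>F. \<forall>l\<in>lat. \<delta> \<le> dist f l"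
    using assms
  proof (induction F)
    case empty then show ?case using zero_less_one by blast
  next
    case (insert f F)
    then obtain \<delta> where \<delta>: "\<delta> > 0" "\<And>f l. \<lbrakk>f \<in> F; l \<in> lat\<rbrakk> \<Longrightarrow> \<delta> \<le> dist f l" by auto
    have "f \<in> - lat" using insert.prems by auto
    with open_Compl[OF closed_lat] obtain \<epsilon> where \<epsilon>: "\<epsilon> > 0" "ball f \<epsilon> \<subseteq> - lat"
      by (rule openE)
    have "min \<delta> \<epsilon> \<le> dist g l" if "g \<in> insert f F" "l \<in> lat" for g l
      using \<delta>(2)[of g l] \<epsilon>(2) that by (cases "g = f") (force simp: subset_eq not_less)+
    then show ?case using \<delta>(1) \<epsilon>(1) by (intro exI[of _ "min \<delta> \<epsilon>"]) auto
  qed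
  then obtain \<delta> where \<delta>: "\<delta> > 0" "\<And>f l. \<lbrakk>f \<in> F; l \<in> lat\<rbrakk> \<Longrightarrow> \<delta> \<le> dist f l" by blast
  obtain Q :: "(real ^ 'n) set" where Q: "countable Q" "\<And>X. \<lbrakk>open X; X \<noteq> {}\<rbrakk> \<Longrightarrow> \<exists>d\<in>Q. d \<in> X"
    using countable_dense_setE by blast
  have Qne: "Q \<noteq> {}" using Q(2)[of UNIV] by auto
  define q where "q = from_nat_into Q"
  define U where "U = (\<lambda>j. \<Union>l\<in>lat. ball (q j + l) (\<delta> / 2))"
  have Uo: "open (U j)" for j unfolding U_def by auto
  have Up: "x + l \<in> U j \<longleftrightarrow> x \<in> U j" if l: "l \<in> lat" for x l j
  proof
    assume "x \<in> U j"
    then obtain l' where "l' \<in> lat" "dist (q j + l') x < \<delta> / 2" by (auto simp: U_def)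
    moreover have d: "dist (q j + (l' + l)) (x + l) = dist (q j + l') x" by (simp add: dist_norm algebra_simps)
    ultimately have "l' + l \<in> lat" "x + l \<in> ball (q j + (l' + l)) (\<delta> / 2)"
      using l lat_add unfolding mem_ball d by blast+
    then show "x + l \<in> U j" unfolding U_def by blast
  next
    assume "x + l \<in> U j"
    then obtain l' where "l' \<in> lat" "dist (q j + l') (x + l) < \<delta> / 2" by (auto simp: U_def)
    moreover have d: "dist (q j + (l' - l)) x = dist (q j + l') (x + l)" by (simp add: dist_norm algebra_simps)
    ultimately have "l' - l \<in> lat" "x \<in> ball (q j + (l' - l)) (\<delta> / 2)"
      using l lat_diff unfolding mem_ball d by blast+
    then show "x \<in> U j" unfolding U_def by blast
  qed
  have Us: "U j \<in> sets pm" for j unfolding sets_pm Per_def using Uo Up by auto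
  have cov: "\<exists>j. x \<in> U j" for x
  proof -
    obtain d where d: "d \<in> Q" "d \<in> ball x (\<delta> / 2)" using Q(2)[of "ball x (\<delta> / 2)"] \<delta>(1) by auto
    obtain j where "q j = d" using from_nat_into_surj[OF Q(1) d(1)] unfolding q_def by blast
    then have "x \<in> ball (q j + 0) (\<delta> / 2)" using d(2) by (simp add: dist_commute)
    then show ?thesis unfolding U_def using lat_0 by blast
  qed
  define \<kappa> where "\<kappa> = (\<lambda>x. LEAST j. x \<in> U j)"
  have \<kappa>U: "x \<in> U (\<kappa> x)" for x unfolding \<kappa>_def using cov by (rule LeastI_ex)
  have "\<kappa> \<in> measurable pm (count_space UNIV)"
    unfolding \<kappa>_def by (rule measurable_Least) (use Us in \<open>simp add: pred_def\<close>)
  moreover have "\<kappa> (x + f) \<noteq> \<kappa> x" if f: "f \<in> F" for x f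
  proof
    assume "\<kappa> (x + f) = \<kappa> x"
    then obtain l l' where l: "l \<in> lat" "l' \<in> lat" "dist (q (\<kappa> x) + l) x < \<delta> / 2" "dist (q (\<kappa> x) + l') (x + f) < \<delta> / 2"
      using \<kappa>U[of x] \<kappa>U[of "x + f"] by (auto simp: U_def)
    have "f - (l' - l) = (q (\<kappa> x) + l - x) - (q (\<kappa> x) + l' - (x + f))" by (simp add: algebra_simps)
    then have "norm (f - (l' - l)) \<le> norm (q (\<kappa> x) + l - x) + norm (q (\<kappa> x) + l' - (x + f))"
      by (metis norm_triangle_ineq4)
    then have "dist f (l' - l) < \<delta>" using l(3,4) by (simp add: dist_norm)
    then show False using \<delta>(2)[OF f lat_diff[OF l(2,1)]] by simp
  qed
  ultimately show ?thesis by blast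
qed

sublocale pm: finite_free_translation pm "- lat"
proof (intro finite_free_translation.intro free_translation.intro translation_invariant.intro free_translation_axioms.intro)
  show "space pm = UNIV" by simp
  show "(\<lambda>x. x + v) \<in> pm \<rightarrow>\<^sub>M pm" for v
    using shift_Per by (auto simp: measurable_def sets_pm vimage_def)
  show "emeasure pm ((\<lambda>x. x + v) -` S) = emeasure pm S" if "S \<in> sets pm" for S v
    using that emeasure_pm[of S] emeasure_pm[OF shift_Per[of S v]] emeasure_shift_pm[of S v]
    by (simp add: sets_pm vimage_def)
  show "\<exists>\<kappa>. \<kappa> \<in> measurable pm (count_space (UNIV::nat set)) \<and> (\<forall>x. \<forall>f\<in>F. \<kappa> (x + f) \<noteq> \<kappa> x)"
    if "finite F" "F \<subseteq> - lat" for F by (rule coloring_pm[OF that])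
  have "emeasure pm UNIV = emeasure lborel fdom" using emeasure_pm[of UNIV] by (simp add: Per_def)
  also have "\<dots> < \<infinity>" by (rule emeasure_bounded_finite[OF bounded_fdom])
  finally show "finite_measure pm" by (intro finite_measureI) simp
qed

lemma AE_pm_lborel:
  assumes "AE x in pm. Q x"
  shows "AE x in lborel. Q x"
proof -
  obtain Z where Z: "{x. \<not> Q x} \<subseteq> Z" "emeasure pm Z = 0" "Z \<in> sets pm" using assms by (auto elim: AE_E)
  have ZP: "Z \<in> Per" using Z(3) sets_pm by simp
  then have [measurable]: "Z \<in> sets borel" by (simp add: Per_def)
  have z: "Z \<inter> fdom \<in> null_sets lborel"
    using emeasure_pm[OF ZP] Z(2) by (auto simp: null_sets_def)
  have "(\<lambda>x. x + (- l)) -` (Z \<inter> fdom) \<in> null_sets lborel" for l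
    using z lb.emeasure_shift[of "Z \<inter> fdom" "- l"] lb.shift_sets[of "Z \<inter> fdom" "- l"]
    by (auto simp: null_sets_def vimage_def)
  then have nul: "(\<Union>l\<in>lat. (\<lambda>x. x + (- l)) -` (Z \<inter> fdom)) \<in> null_sets lborel"
    by (intro null_sets_UN' countable_lat)
  have "Z \<subseteq> (\<Union>l\<in>lat. (\<lambda>x. x + (- l)) -` (Z \<inter> fdom))"
  proof
    fix x assume x: "x \<in> Z"
    obtain l where l: "l \<in> lat" "x - l \<in> fdom" using fdom_ex[of x] by blast
    have "x + (- l) \<in> Z \<longleftrightarrow> x \<in> Z" using ZP lat_minus[OF l(1)] unfolding Per_def by blast
    then have "x - l \<in> Z" using x by simp
    then show "x \<in> (\<Union>l\<in>lat. (\<lambda>x. x + (- l)) -` (Z \<inter> fdom))" using l by auto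
  qed
  then show ?thesis using Z(1) by (intro AE_I'[OF nul]) blast
qed

end

section \<open>Periodization\<close>

lemma measure_transvection_cbox:
  fixes m n :: "'n::finite"
  assumes "m \<noteq> n"
  defines "h \<equiv> (\<lambda>v::real ^ 'n. \<chi> i. if i = m then v $ m + v $ n else v $ i)"
  shows "measure lebesgue (h ` cbox a b) = measure lebesgue (cbox a b)"
proof (cases "cbox a b = {}")
  case False
  \<comment> \<open>Translating along axis \<open>n\<close> brings the lower end of the n-th side to
    0, since \<open>measure_shear_interval\<close> asks for a nonnegative one.\<close>
  define d :: "real ^ 'n" where "d = axis n (a $ n)"
  have lin: "linear h" unfolding h_def by (rule linearI) (auto simp: vec_eq_iff algebra_simps)
  have eq: "cbox a b = (+) d ` cbox (a - d) (b - d)" using cbox_translation[of d "a - d" "b - d"] by simp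
  have ne: "cbox (a - d) (b - d) \<noteq> {}" using False eq by auto
  have "h ` (+) d ` X = (+) (h d) ` h ` X" for X
    by (simp add: image_image linear_add[OF lin])
  then have "measure lebesgue (h ` cbox a b) = measure lebesgue (h ` cbox (a - d) (b - d))"
    unfolding eq by (simp add: measure_translation)
  also have "\<dots> = measure lebesgue (cbox (a - d) (b - d))"
    unfolding h_def by (rule measure_shear_interval[OF assms(1) ne]) (simp add: d_def axis_def)
  also have "\<dots> = measure lebesgue (cbox a b)" unfolding eq by (simp add: measure_translation)
  finally show ?thesis .
qed simp

text \<open>The library version of this lemma requires a well-ordered index type.\<close>

lemma measure_matrix_image:
  fixes A :: "real ^ 'n ^ 'n"
  shows "\<forall>S\<in>lmeasurable. (*v) A ` S \<in> lmeasurable \<and> measure lebesgue ((*v) A ` S) = \<bar>det A\<bar> * measure lebesgue S"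
    (is "?P A")
proof (rule induct_matrix_elementary_alt[where P = ?P])
  fix A B :: "real ^ 'n ^ 'n" assume A: "?P A" and B: "?P B"
  have "(*v) (A ** B) ` S = (*v) A ` (*v) B ` S" for S by (simp add: image_image matrix_vector_mul_assoc)
  then show "?P (A ** B)" using A B by (auto simp: det_mul abs_mult)
next
  fix A :: "real ^ 'n ^ 'n" and i assume r: "row i A = 0"
  have d: "det A = 0" by (rule det_zero_row(2)[OF r])
  then have "\<not> inj ((*v) A)"
    using matrix_left_invertible_injective[of A] invertible_left_inverse[of A] invertible_det_nz[of A] by auto
  then have "negligible ((*v) A ` S)" for S
    by (intro negligible_linear_singular_image matrix_vector_mul_linear)
  then show "?P A" using d by (simp add: negligible_iff_measure)
next
  fix A :: "real ^ 'n ^ 'n" assume dg: "\<And>i j. i \<noteq> j \<Longrightarrow> A $ i $ j = 0"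
  have "(A *v x) $ k = A $ k $ k * x $ k" for x k
  proof -
    have "(A *v x) $ k = (\<Sum>j\<in>UNIV. if j = k then A $ k $ k * x $ k else 0)"
      unfolding matrix_vector_mult_def vec_lambda_beta using dg by (intro sum.cong) auto
    then show ?thesis by simp
  qed
  then have "(*v) A = (\<lambda>x. \<chi> k. A $ k $ k * x $ k)" by (simp add: fun_eq_iff vec_eq_iff)
  then show "?P A" using dg by (simp add: measurable_stretch measure_stretch det_diagonal)
next
  fix m n :: 'n assume mn: "m \<noteq> n"
  let ?t = "Transposition.transpose m n"
  let ?A = "(\<chi> i j. mat 1 $ i $ ?t j) :: real ^ 'n ^ 'n"
  have Av: "?A *v x = (\<chi> i. x $ ?t i)" for x :: "real ^ 'n"
  proof -
    have "(?A *v x) $ i = x $ ?t i" for i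
    proof -
      have "(?A *v x) $ i = (\<Sum>j\<in>UNIV. if j = ?t i then x $ ?t i else 0)"
        unfolding matrix_vector_mult_def vec_lambda_beta mat_def
        by (intro sum.cong) (auto simp: transpose_eq_iff)
      then show ?thesis by simp
    qed
    then show ?thesis by (simp add: vec_eq_iff)
  qed
  have "?A ** ?A = mat 1" unfolding matrix_eq by (simp add: matrix_vector_mul_assoc[symmetric] Av vec_eq_iff)
  then have dd: "det ?A * det ?A = 1" unfolding det_mul[symmetric] by (simp only: det_I)
  have aux: "\<bar>t\<bar> = 1" if "t * t = 1" for t :: real
    using that abs_square_eq_1[of t] by (simp add: power2_eq_square)
  have d: "\<bar>det ?A\<bar> = 1" by (rule aux[OF dd])
  have box: "measure lebesgue ((*v) ?A ` cbox a b) = 1 * measure lebesgue (cbox a b)" for a b :: "real ^ 'n"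
  proof -
    have mem: "(\<chi> i. x $ ?t i) \<in> cbox (\<chi> i. a $ ?t i) (\<chi> i. b $ ?t i) \<longleftrightarrow> x \<in> cbox a b" for x
      unfolding mem_box_cart vec_lambda_beta by (metis transpose_involutory)
    have im: "(*v) ?A ` cbox a b = cbox (\<chi> i. a $ ?t i) (\<chi> i. b $ ?t i)"
    proof (intro equalityI subsetI)
      fix y assume "y \<in> cbox (\<chi> i. a $ ?t i) (\<chi> i. b $ ?t i)"
      moreover have y: "y = ?A *v (\<chi> i. y $ ?t i)" by (simp add: Av vec_eq_iff)
      ultimately show "y \<in> (*v) ?A ` cbox a b" using mem[of "\<chi> i. y $ ?t i"] 
        by (intro image_eqI[where x = "\<chi> i. y $ ?t i"] y) simp
    qed (use mem in \<open>auto simp: Av\<close>)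
    have pr: "(\<Prod>i\<in>UNIV. b $ ?t i - a $ ?t i) = (\<Prod>i\<in>UNIV. b $ i - a $ i)"
      by (rule prod.reindex_bij_betw) simp
    show ?thesis
    proof (cases "cbox a b = {}")
      case False
      then have "cbox (\<chi> i. a $ ?t i) (\<chi> i. b $ ?t i) \<noteq> {}" using im by (metis image_is_empty)
      from content_cbox_cart[OF this] content_cbox_cart[OF False] show ?thesis
        unfolding im using pr by simp
    qed simp
  qed
  show "?P ?A"
  proof
    fix S :: "(real ^ 'n) set" assume S: "S \<in> lmeasurable"
    show "(*v) ?A ` S \<in> lmeasurable \<and> measure lebesgue ((*v) ?A ` S) = \<bar>det ?A\<bar> * measure lebesgue S"
      using measure_linear_sufficient[OF matrix_vector_mul_linear S box] unfolding d by (simp only:)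
  qed
next
  fix m n :: 'n assume mn: "m \<noteq> n"
  let ?A = "(\<chi> i j. of_bool (i = m \<and> j = n \<or> i = j)) :: real ^ 'n ^ 'n"
  have Av: "?A *v x = (\<chi> i. if i = m then x $ m + x $ n else x $ i)" for x :: "real ^ 'n"
  proof -
    have "(?A *v x) $ i = (if i = m then x $ m + x $ n else x $ i)" for i
    proof -
      have "(?A *v x) $ i = (\<Sum>j\<in>UNIV. (if j = i then x $ i else 0) + (if j = n then (if i = m then x $ n else 0) else 0))"
        unfolding matrix_vector_mult_def vec_lambda_beta using mn by (intro sum.cong) auto
      then show ?thesis by (simp add: sum.distrib)
    qed
    then show ?thesis by (simp add: vec_eq_iff)
  qed
  have "?A = (\<chi> k. if k = m then row m (mat 1) + 1 *s row n (mat 1) else row k (mat 1))"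
    using mn by (auto simp: vec_eq_iff row_def mat_def)
  then have d: "\<bar>det ?A\<bar> = 1" using det_row_operation[OF mn, of "mat 1 :: real ^ 'n ^ 'n" 1] by (metis abs_one det_I)
  have box: "measure lebesgue ((*v) ?A ` cbox a b) = 1 * measure lebesgue (cbox a b)" for a b :: "real ^ 'n"
    unfolding Av[abs_def] mult_1 by (rule measure_transvection_cbox[OF mn])
  show "?P ?A"
  proof
    fix S :: "(real ^ 'n) set" assume S: "S \<in> lmeasurable"
    show "(*v) ?A ` S \<in> lmeasurable \<and> measure lebesgue ((*v) ?A ` S) = \<bar>det ?A\<bar> * measure lebesgue S"
      using measure_linear_sufficient[OF matrix_vector_mul_linear S box] unfolding d by (simp only:)
  qed
qed

section \<open>Sums over lattice translates\<close>

context basis_matrix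
begin

lemma finite_support:
  assumes "nice f"
  shows "finite {l \<in> lat. f (x - l) \<noteq> 0}"
proof -
  obtain R where R: "\<And>x. f x \<noteq> 0 \<Longrightarrow> norm x \<le> R" using assms unfolding nice_def by blast
  have "{l \<in> lat. f (x - l) \<noteq> 0} \<subseteq> lat \<inter> cball x R"
    using R by (auto simp: dist_norm)
  then show ?thesis using finite_lat[OF bounded_cball] finite_subset by blast
qed

text \<open>The index set keeps nonzero terms only, which makes it finite for every
  \<open>nice\<close> function.\<close>

definition per :: "(real ^ 'n \<Rightarrow> real) \<Rightarrow> real ^ 'n \<Rightarrow> real" where
  "per f x = (\<Sum>l | l \<in> lat \<and> f (x - l) \<noteq> 0. f (x - l))"

lemma per_eq:
  assumes "finite T" "T \<subseteq> lat" "\<And>l. \<lbrakk>l \<in> lat; f (x - l) \<noteq> 0\<rbrakk> \<Longrightarrow> l \<in> T"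
  shows "per f x = (\<Sum>l\<in>T. f (x - l))"
  unfolding per_def by (rule sum.mono_neutral_left) (use assms in auto)

lemma per_add:
  assumes "nice f" "nice g"
  shows "per (\<lambda>x. f x + g x) x = per f x + per g x"
proof -
  let ?T = "{l \<in> lat. f (x - l) \<noteq> 0} \<union> {l \<in> lat. g (x - l) \<noteq> 0}"
  have T: "finite ?T" "?T \<subseteq> lat" using finite_support assms by auto
  have "per f x = (\<Sum>l\<in>?T. f (x - l))" "per g x = (\<Sum>l\<in>?T. g (x - l))"
    "per (\<lambda>x. f x + g x) x = (\<Sum>l\<in>?T. f (x - l) + g (x - l))"
    by (rule per_eq[OF T], auto)+
  then show ?thesis by (simp add: sum.distrib)
qed

lemma per_uminus: "per (\<lambda>x. - f x) x = - per f x"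
  unfolding per_def by (simp add: sum_negf)

lemma per_diff:
  assumes "nice f" "nice g"
  shows "per (\<lambda>x. f x - g x) x = per f x - per g x"
  using per_add[OF assms(1) nice_uminus[OF assms(2)], of x] by (simp add: per_uminus)

lemma per_zero: "per (\<lambda>_. 0) x = 0" by (simp add: per_def)

lemma nice_sum: "(\<And>i. i \<in> S \<Longrightarrow> nice (f i)) \<Longrightarrow> nice (\<lambda>x. \<Sum>i\<in>S. f i x)"
  by (induction S rule: infinite_finite_induct) (auto simp: nice_zero nice_add)

lemma per_sum: "(\<And>i. i \<in> S \<Longrightarrow> nice (f i)) \<Longrightarrow> per (\<lambda>x. \<Sum>i\<in>S. f i x) x = (\<Sum>i\<in>S. per (f i) x)"
  by (induction S rule: infinite_finite_induct) (auto simp: per_zero per_add nice_sum)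

lemma per_shift: "per (\<lambda>x. f (x - v)) x = per f (x - v)"
proof -
  have e: "x - l - v = x - v - l" for l by (simp add: algebra_simps)
  show ?thesis unfolding per_def e ..
qed

lemma per_periodic: "l0 \<in> lat \<Longrightarrow> per f (x + l0) = per f x"
  unfolding per_def
  by (rule sum.reindex_bij_witness[of _ "\<lambda>l. l + l0" "\<lambda>l. l - l0"]) (auto simp: lat_add lat_diff algebra_simps)

lemma per_shift_lat: "l0 \<in> lat \<Longrightarrow> per (\<lambda>x. f (x - l0)) x = per f x"
  using per_periodic[of l0 f "x - l0"] by (simp add: per_shift)

lemma per_red: "per f (red x) = per f x"
  using per_periodic[OF red_lat[of x], of f "red x"] by simp

text \<open>After reducing \<open>x\<close> to \<open>fdom\<close>, one finite set of lattice
  vectors serves for all \<open>x\<close>.\<close>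

lemma per_nice:
  assumes "nice f"
  shows "per f \<in> borel_measurable pm" "\<exists>C. \<forall>x. \<bar>per f x\<bar> \<le> C"
proof -
  obtain R C where f: "f \<in> borel_measurable borel" "\<And>x. f x \<noteq> 0 \<Longrightarrow> norm x \<le> R" "\<And>x. \<bar>f x\<bar> \<le> C"
    using assms unfolding nice_def by metis
  obtain R' where R': "\<And>x. x \<in> fdom \<Longrightarrow> norm x \<le> R'" using bounded_fdom bounded_iff by blast
  define T where "T = lat \<inter> cball 0 (R + R')"
  have T: "finite T" "T \<subseteq> lat" unfolding T_def using finite_lat[OF bounded_cball] by auto
  have eq: "per f x = (\<Sum>l\<in>T. f (red x - l))" for x
  proof -
    have "per f (red x) = (\<Sum>l\<in>T. f (red x - l))"
    proof (rule per_eq[OF T])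
      fix l assume l: "l \<in> lat" "f (red x - l) \<noteq> 0"
      have "norm l \<le> norm (red x) + norm (red x - l)" by (metis norm_minus_commute norm_triangle_sub)
      then show "l \<in> T" using l f(2)[OF l(2)] R'[OF red_fdom[of x]] by (simp add: T_def)
    qed
    then show ?thesis by (simp add: per_red)
  qed
  have "(\<lambda>x. \<Sum>l\<in>T. f (red x - l)) \<in> borel_measurable borel" using f(1) by measurable
  then have "per f \<in> borel_measurable borel" unfolding eq[abs_def] .
  then show "per f \<in> borel_measurable pm" by (rule measurable_pmI) (simp add: per_periodic)
  have "\<bar>per f x\<bar> \<le> (\<Sum>l\<in>T. C)" for x
    unfolding eq by (rule order.trans[OF sum_abs sum_mono]) (rule f(3))
  then show "\<exists>C. \<forall>x. \<bar>per f x\<bar> \<le> C" by blast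
qed

section \<open>Coboundaries over a lattice\<close>

text \<open>The functions \<psi> are the source of the real flow: periodized modulo a larger
  lattice, they become its components. Being \<open>nice\<close>, they have bounded and measurable
  periodizations.\<close>

definition cob :: "(real ^ 'n \<Rightarrow> real) \<Rightarrow> bool" where
  "cob f \<longleftrightarrow> (\<exists>\<psi>. (\<forall>i. nice (\<psi> i)) \<and> (\<forall>x. f x = (\<Sum>i\<in>UNIV. \<psi> i x - \<psi> i (x - column i A))))"

lemma cob_zero: "cob (\<lambda>_. 0)"
  unfolding cob_def by (intro exI[of _ "\<lambda>_ _. 0"]) (simp add: nice_zero)

lemma cob_add:
  assumes "cob f" "cob g"
  shows "cob (\<lambda>x. f x + g x)"
proof -
  obtain \<psi> where p: "\<And>i. nice (\<psi> i)" and f: "\<And>x. f x = (\<Sum>i\<in>UNIV. \<psi> i x - \<psi> i (x - column i A))"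
    using assms(1) unfolding cob_def by blast
  obtain \<psi>' where p': "\<And>i. nice (\<psi>' i)" and g: "\<And>x. g x = (\<Sum>i\<in>UNIV. \<psi>' i x - \<psi>' i (x - column i A))"
    using assms(2) unfolding cob_def by blast
  show ?thesis unfolding cob_def
  proof (intro exI[of _ "\<lambda>i x. \<psi> i x + \<psi>' i x"] conjI allI)
    show "nice (\<lambda>x. \<psi> i x + \<psi>' i x)" for i by (intro nice_add p p')
    show "f x + g x = (\<Sum>i\<in>UNIV. \<psi> i x + \<psi>' i x - (\<psi> i (x - column i A) + \<psi>' i (x - column i A)))" for x
      unfolding f g sum.distrib[symmetric] by (intro sum.cong) auto
  qed
qed

lemma cob_sum: "(\<And>i. i \<in> S \<Longrightarrow> cob (f i)) \<Longrightarrow> cob (\<lambda>x. \<Sum>i\<in>S. f i x)"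
  by (induction S rule: infinite_finite_induct) (auto simp: cob_zero cob_add)

lemma cob_shift_column:
  assumes "nice f"
  shows "cob (\<lambda>x. f x - f (x - column i A))"
proof -
  have "f x - f (x - column i A) = (\<Sum>j\<in>UNIV. (if j = i then f x else 0) - (if j = i then f (x - column j A) else 0))" for x
    by (simp add: sum_subtractf)
  moreover have "nice (\<lambda>x. if j = i then f x else 0)" for j using assms nice_zero by (cases "j = i") auto
  ultimately show ?thesis unfolding cob_def by (intro exI[of _ "\<lambda>j x. if j = i then f x else 0"]) auto
qed

text \<open>The vectors along which all such differences are coboundaries form a group that contains
  the columns.\<close>

lemma cob_shift:
  assumes "nice f" "l \<in> lat"
  shows "cob (\<lambda>x. f x - f (x - l))"
proof -
  define H where "H = {l. \<forall>f. nice f \<longrightarrow> cob (\<lambda>x. f x - f (x - l))}"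
  have "add_subgroup H"
    unfolding add_subgroup_def
  proof (intro conjI ballI)
    show "0 \<in> H" by (simp add: H_def cob_zero)
    fix a b assume ab: "a \<in> H" "b \<in> H"
    show "a + b \<in> H"
      unfolding H_def
    proof (intro CollectI allI impI)
      fix f :: "real ^ 'n \<Rightarrow> real" assume f: "nice f"
      have "cob (\<lambda>x. (f x - f (x - a)) + (f (x - a) - f (x - b - a)))"
        using ab f nice_shift[OF f, of a] by (intro cob_add) (auto simp: H_def)
      then show "cob (\<lambda>x. f x - f (x - (a + b)))" by (simp add: algebra_simps)
    qed
  next
    fix a assume a: "a \<in> H"
    show "- a \<in> H"
      unfolding H_def
    proof (intro CollectI allI impI)
      fix f :: "real ^ 'n \<Rightarrow> real" assume f: "nice f"
      have "nice (\<lambda>x. - f (x - (- a)))" by (intro nice_uminus nice_shift f)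
      then have "cob (\<lambda>x. - f (x - (- a)) - (- f (x - a - (- a))))" using a unfolding H_def by blast
      then show "cob (\<lambda>x. f x - f (x - - a))" by (simp add: algebra_simps)
    qed
  qed
  moreover have "column i A \<in> H" for i using cob_shift_column by (simp add: H_def)
  moreover obtain z :: "'n \<Rightarrow> int" where "l = (\<Sum>i\<in>UNIV. of_int (z i) *\<^sub>R column i A)"
    using lat_columns[OF assms(2)] .
  ultimately have "l \<in> H" by (simp add: add_subgroup_sum add_subgroup_int_scale)
  then show ?thesis using assms(1) by (simp add: H_def)
qed

lemma fdom_decompose:
  fixes f :: "real ^ 'n \<Rightarrow> 'b::comm_monoid_add"
  assumes "\<And>x. f x \<noteq> 0 \<Longrightarrow> norm x \<le> R"
  obtains V where "finite V" "V \<subseteq> lat" "\<And>x. f x = (\<Sum>l\<in>V. if x + l \<in> fdom then f x else 0)"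
    "\<And>x l. \<lbrakk>x \<in> fdom; l \<in> lat; f (x - l) \<noteq> 0\<rbrakk> \<Longrightarrow> l \<in> V"
proof -
  obtain R' where R': "\<And>x. x \<in> fdom \<Longrightarrow> norm x \<le> R'" using bounded_fdom bounded_iff by blast
  define V where "V = lat \<inter> cball 0 (R + R')"
  have V: "finite V" "V \<subseteq> lat" unfolding V_def using finite_lat[OF bounded_cball] by auto
  have inV: "l \<in> V" if "l \<in> lat" "f x \<noteq> 0" "x + l \<in> fdom" for x l
  proof -
    have "norm l \<le> norm (x + l) + norm x" by (metis add_diff_cancel_left' norm_triangle_ineq4)
    then show ?thesis using assms[OF that(2)] R'[OF that(3)] that(1) by (simp add: V_def)
  qed
  have "f x = (\<Sum>l\<in>V. if x + l \<in> fdom then f x else 0)" for x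
  proof (cases "f x = 0")
    case False
    obtain l0 where l0: "l0 \<in> lat" "x - l0 \<in> fdom" using fdom_ex by blast
    have m: "- l0 \<in> V" using inV[of "- l0" x] l0 lat_minus False by simp
    have "(x + l \<in> fdom) = (l = - l0)" if l: "l \<in> V" for l
    proof
      assume "x + l \<in> fdom"
      then have "- l = l0" using fdom_translate_unique[of "- l" l0 x] l0 lat_minus[of l] l V(2) by auto
      then show "l = - l0" by (metis minus_minus)
    qed (use l0 in simp)
    then have "(\<Sum>l\<in>V. if x + l \<in> fdom then f x else 0) = (\<Sum>l\<in>V. if l = - l0 then f x else 0)"
      by (intro sum.cong) auto
    then show ?thesis using m V(1) by simp
  next
    case True
    then have "(if x + l \<in> fdom then f x else 0) = 0" for l by simp
    then show ?thesis using True by simp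
  qed
  moreover have "l \<in> V" if "x \<in> fdom" "l \<in> lat" "f (x - l) \<noteq> 0" for x l
    using inV[of l "x - l"] that by simp
  ultimately show thesis using that V by blast
qed

text \<open>Cut \<open>f\<close> by the lattice vector that brings a point into \<open>fdom\<close>.
  Translated there, the pieces add up to \<open>per f\<close>, which is 0, so \<open>f\<close> is
  the sum of the differences between the pieces and their translates.\<close>

lemma cob_if_per_zero:
  assumes f: "nice f" and per: "\<And>x. per f x = 0"
  shows "cob f"
proof -
  obtain R where R: "\<And>x. f x \<noteq> 0 \<Longrightarrow> norm x \<le> R" using f unfolding nice_def by blast
  obtain V where V: "finite V" "V \<subseteq> lat" and dec: "\<And>x. f x = (\<Sum>l\<in>V. if x + l \<in> fdom then f x else 0)"
    and inV: "\<And>x l. \<lbrakk>x \<in> fdom; l \<in> lat; f (x - l) \<noteq> 0\<rbrakk> \<Longrightarrow> l \<in> V"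
    using fdom_decompose[of f R, OF R] by blast
  let ?g = "\<lambda>l x. if x + l \<in> fdom then f x else 0"
  have g: "nice (?g l)" for l
  proof -
    have "{x. x + l \<in> fdom} \<in> sets borel" using lb.shift_sets[of fdom l] by simp
    from nice_restrict[OF f this] show ?thesis by simp
  qed
  have z: "(\<Sum>l\<in>V. ?g l (x - l)) = 0" for x
  proof (cases "x \<in> fdom")
    case True
    have "(\<Sum>l\<in>V. ?g l (x - l)) = (\<Sum>l\<in>V. f (x - l))" using True by (intro sum.cong) auto
    also have "\<dots> = per f x" by (rule per_eq[symmetric, OF V]) (use inV True in blast)
    finally show ?thesis using per by simp
  qed simp
  have "cob (\<lambda>x. \<Sum>l\<in>V. ?g l x - ?g l (x - l))"
    by (intro cob_sum cob_shift g) (use V in auto)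
  moreover have "(\<lambda>x. \<Sum>l\<in>V. ?g l x - ?g l (x - l)) = f"
  proof
    fix x show "(\<Sum>l\<in>V. ?g l x - ?g l (x - l)) = f x" 
      unfolding sum_subtractf z using dec[of x] by simp
  qed
  ultimately show ?thesis by simp
qed

section \<open>Counting modulo the lattice and the convolution kernel\<close>

definition cnt :: "(real ^ 'n) set \<Rightarrow> real ^ 'n \<Rightarrow> nat" where
  "cnt D x = card {l \<in> lat. x - l \<in> D}"

lemma cnt_per: "real (cnt D x) = per (indicat_real D) x"
proof -
  have "{l \<in> lat. indicat_real D (x - l) \<noteq> 0} = {l \<in> lat. x - l \<in> D}" by (auto simp: indicator_def)
  then show ?thesis by (simp add: cnt_def per_def indicator_def)
qed

lemma cnt_sum:
  assumes "finite T" "T \<subseteq> lat" "\<And>l. \<lbrakk>l \<in> lat; x - l \<in> D\<rbrakk> \<Longrightarrow> l \<in> T"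
  shows "cnt D x = (\<Sum>l\<in>T. if x - l \<in> D then 1 else 0)"
proof -
  have "{l \<in> lat. x - l \<in> D} = {l \<in> T. x - l \<in> D}" using assms(2,3) by auto
  then show ?thesis unfolding cnt_def using sum.inter_filter[OF assms(1), of "\<lambda>_. 1::nat" "\<lambda>l. x - l \<in> D"] by simp
qed

lemma cnt_measurable:
  assumes "bounded D" "D \<in> sets borel"
  shows "cnt D \<in> measurable pm (count_space UNIV)"
proof -
  have [measurable]: "per (indicat_real D) \<in> borel_measurable pm"
    by (rule per_nice(1)[OF nice_indicator[OF assms]])
  have "(\<lambda>x. nat \<lfloor>per (indicat_real D) x\<rfloor>) \<in> measurable pm (count_space UNIV)" by measurable
  then show ?thesis by (simp add: cnt_per[symmetric])
qed

text \<open>Each point of \<open>D\<close> moves by the one lattice vector that brings it into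
  \<open>fdom\<close>; boundedness of \<open>D\<close> leaves finitely many vectors, and coinciding
  images are counted by \<open>cnt\<close>.\<close>

lemma equid_fdom:
  assumes D: "bounded D" "D \<in> sets borel"
  shows "lb.equid lat (\<lambda>x. if x \<in> D then 1 else 0) (\<lambda>x. if x \<in> fdom then cnt D x else 0)"
proof -
  let ?f = "\<lambda>x. if x \<in> D then 1 else (0::nat)"
  obtain R where R: "\<And>x. x \<in> D \<Longrightarrow> norm x \<le> R" using D(1) bounded_iff by blast
  have R': "norm x \<le> R" if "?f x \<noteq> 0" for x using R that by (auto split: if_splits)
  obtain V where V: "finite V" "V \<subseteq> lat" and dec: "\<And>x. ?f x = (\<Sum>l\<in>V. if x + l \<in> fdom then ?f x else 0)"
    and inV: "\<And>x l. \<lbrakk>x \<in> fdom; l \<in> lat; ?f (x - l) \<noteq> 0\<rbrakk> \<Longrightarrow> l \<in> V"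
    using fdom_decompose[of ?f R, OF R'] by blast
  show ?thesis
  proof (rule lb.equidI[where J = V and g = "\<lambda>l. l" and u = "\<lambda>l x. if x + l \<in> fdom then ?f x else 0"])
    show "(\<lambda>x. if x + l \<in> fdom then ?f x else 0) \<in> lborel \<rightarrow>\<^sub>M count_space UNIV" for l
      using D(2) by measurable
    show "AE x in lborel. ?f x = (\<Sum>l\<in>V. if x + l \<in> fdom then ?f x else 0)" using dec by simp
    have "(if x \<in> fdom then cnt D x else 0) = (\<Sum>l\<in>V. if x - l + l \<in> fdom then ?f (x - l) else 0)" for x
    proof (cases "x \<in> fdom")
      case True
      have "cnt D x = (\<Sum>l\<in>V. if x - l \<in> D then 1 else 0)"
        by (rule cnt_sum[OF V]) (use inV[OF True] in auto)
      then show ?thesis using True by simp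
    qed simp
    then show "AE x in lborel. (if x \<in> fdom then cnt D x else 0) = (\<Sum>l\<in>V. if x - l + l \<in> fdom then ?f (x - l) else 0)"
      by simp
  qed (use V in auto)
qed

text \<open>The summed function is the convolution of the indicators of \<open>D\<close> and
  \<open>fdom\<close>. The translates of \<open>fdom\<close> partition the space, so the sets of
  \<open>y\<close> that occur in the sum partition \<open>D\<close>.\<close>

lemma kernel_per:
  assumes D: "bounded D" "D \<in> sets borel"
  shows "per (\<lambda>x. measure lborel {y \<in> D. x - y \<in> fdom}) x = measure lborel D"
proof -
  have [measurable]: "D \<in> sets borel" by (rule D)
  define T where "T = {l \<in> lat. \<exists>y\<in>D. x - l - y \<in> fdom}"
  obtain R where R: "\<And>y. y \<in> D \<Longrightarrow> norm y \<le> R" using D(1) bounded_iff by blast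
  obtain R' where R': "\<And>x. x \<in> fdom \<Longrightarrow> norm x \<le> R'" using bounded_fdom bounded_iff by blast
  have "T \<subseteq> lat \<inter> cball x (R + R')"
  proof
    fix l assume "l \<in> T"
    then obtain y where y: "l \<in> lat" "y \<in> D" "x - l - y \<in> fdom" by (auto simp: T_def)
    have "norm (x - l) \<le> norm (x - l - y) + norm y" by (metis diff_add_cancel norm_triangle_ineq)
    then show "l \<in> lat \<inter> cball x (R + R')" using y R[OF y(2)] R'[OF y(3)] by (simp add: dist_norm)
  qed
  then have Tf: "finite T" using finite_lat[OF bounded_cball] finite_subset by blast
  have Tl: "T \<subseteq> lat" by (auto simp: T_def)
  let ?S = "\<lambda>l. {y \<in> D. x - l - y \<in> fdom}"
  have Ss: "?S l \<in> sets lborel" for l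
  proof -
    have "{y \<in> space borel. y \<in> D \<and> x - l - y \<in> fdom} \<in> sets borel" by measurable
    then show ?thesis by simp
  qed
  have fin: "emeasure lborel (?S l) \<noteq> \<infinity>" for l
    using emeasure_bounded_finite[of "?S l"] bounded_subset[OF D(1), of "?S l"] by auto
  have "per (\<lambda>x. measure lborel {y \<in> D. x - y \<in> fdom}) x = (\<Sum>l\<in>T. measure lborel (?S l))"
  proof (rule per_eq[OF Tf Tl])
    fix l assume l: "l \<in> lat" "measure lborel (?S l) \<noteq> 0"
    then have "?S l \<noteq> {}" by (metis measure_empty)
    then show "l \<in> T" using l(1) by (auto simp: T_def)
  qed
  also have "\<dots> = measure lborel (\<Union>l\<in>T. ?S l)"
  proof (rule measure_finite_Union[symmetric, OF Tf])
    show "?S ` T \<subseteq> sets lborel" using Ss by blast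
    show "disjoint_family_on ?S T"
      unfolding disjoint_family_on_def
    proof (intro ballI impI)
      fix l l' assume l: "l \<in> T" "l' \<in> T" "l \<noteq> l'"
      show "?S l \<inter> ?S l' = {}"
      proof (rule equals0I)
        fix y assume y: "y \<in> ?S l \<inter> ?S l'"
        have e: "x - l - y = x - y - l" "x - l' - y = x - y - l'" by (simp_all add: algebra_simps)
        have "x - y - l \<in> fdom" "x - y - l' \<in> fdom" using y by (auto simp: e[symmetric])
        then show False using fdom_translate_unique[of l l' "x - y"] l Tl by blast
      qed
    qed
  qed (use fin in auto)
  also have "(\<Union>l\<in>T. ?S l) = D"
  proof (intro equalityI subsetI)
    fix y assume y: "y \<in> D"
    obtain l where l: "l \<in> lat" "x - y - l \<in> fdom" using fdom_ex by blast
    have "x - l - y \<in> fdom" using l(2) by (simp add: algebra_simps)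
    then show "y \<in> (\<Union>l\<in>T. ?S l)" using l(1) y by (auto simp: T_def)
  qed auto
  finally show ?thesis .
qed

text \<open>The volume of the unit cube is left unevaluated: two lattices with equal determinants
  are to be compared, and it is a common factor.\<close>

lemma measure_fdom:
  "measure lborel fdom = \<bar>det A\<bar> * measure lebesgue {y :: real ^ 'n. \<forall>i. 0 \<le> y $ i \<and> y $ i < 1}"
proof -
  let ?U = "{y :: real ^ 'n. \<forall>i. 0 \<le> y $ i \<and> y $ i < 1}"
  have "{y \<in> space borel. \<forall>i\<in>UNIV. 0 \<le> y $ i \<and> y $ i < 1} \<in> sets (borel :: (real ^ 'n) measure)" by measurable
  then have Ub: "?U \<in> sets borel" by simp
  have "?U \<subseteq> cbox 0 1" by (auto simp: mem_box_cart less_imp_le)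
  then have "bounded ?U" using bounded_cbox bounded_subset by blast
  then have "?U \<in> lmeasurable" using Ub by (intro bounded_set_imp_lmeasurable) auto
  then have "measure lebesgue ((*v) A ` ?U) = \<bar>det A\<bar> * measure lebesgue ?U"
    using measure_matrix_image[of A] by blast
  then show ?thesis unfolding fdom_image[symmetric] by (simp add: measure_completion)
qed

text \<open>A null \<open>fdom\<close> would make the torus measure zero, and
  \<open>AE_pm_lborel\<close> would then make the whole space a null set.\<close>

lemma measure_fdom_pos: "measure lborel fdom > 0"
proof (rule ccontr)
  assume "\<not> measure lborel fdom > 0"
  then have "measure lborel fdom = 0" using measure_nonneg[of lborel fdom] by linarith
  then have z: "emeasure lborel fdom = 0"
    using emeasure_bounded_finite[OF bounded_fdom] by (simp add: emeasure_eq_ennreal_measure)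
  have "UNIV \<in> Per" by (simp add: Per_def)
  then have "UNIV \<in> null_sets pm" using emeasure_pm[of UNIV] z by (simp add: null_sets_def sets_pm)
  then have "AE x in pm. x \<notin> UNIV" by (rule AE_not_in)
  then have "AE x in lborel. x \<notin> (UNIV :: (real ^ 'n) set)" by (rule AE_pm_lborel)
  then have "(UNIV :: (real ^ 'n) set) \<in> null_sets lborel"
    using AE_iff_null_sets[of "UNIV :: (real ^ 'n) set" lborel] by simp
  then show False by (simp add: null_sets_def emeasure_lborel_UNIV)
qed

end

text \<open>Commutativity of convolution by the reflection y -> x - y. It allows
  \<open>kernel_per\<close> to be applied to one and the same kernel for both lattices.\<close>

lemma measure_reflect:
  fixes D E :: "'a::euclidean_space set"
  assumes [measurable]: "D \<in> sets borel" "E \<in> sets borel"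
  shows "measure lborel {y \<in> D. x - y \<in> E} = measure lborel {y \<in> E. x - y \<in> D}"
proof -
  have s: "{y \<in> P. x - y \<in> Q} \<in> sets borel" if [measurable]: "P \<in> sets borel" "Q \<in> sets borel" for P Q :: "'a set"
  proof -
    have "{y \<in> space borel. y \<in> P \<and> x - y \<in> Q} \<in> sets borel" by measurable
    then show ?thesis by simp
  qed
  have affine: "measure lebesgue ((\<lambda>y. - 1 *\<^sub>R y + x) ` S) = measure lebesgue S" for S
    using measure_lebesgue_affine[where m = "- 1"] by simp
  have im: "(\<lambda>y. - 1 *\<^sub>R y + x) ` {y \<in> D. x - y \<in> E} = {y \<in> E. x - y \<in> D}"
  proof (intro equalityI subsetI)
    fix y assume "y \<in> {y \<in> E. x - y \<in> D}"
    then show "y \<in> (\<lambda>y. - 1 *\<^sub>R y + x) ` {y \<in> D. x - y \<in> E}" by (intro image_eqI[of _ _ "x - y"]) auto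
  qed (auto simp: algebra_simps)
  have "measure lebesgue {y \<in> E. x - y \<in> D} = measure lebesgue {y \<in> D. x - y \<in> E}"
    using affine[of "{y \<in> D. x - y \<in> E}"] unfolding im .
  then show ?thesis using s[OF assms] s[OF assms(2,1)] by (simp add: measure_completion)
qed

lemma nice_kernel:
  fixes D E :: "(real ^ 'n) set"
  assumes D: "bounded D" "D \<in> sets borel" and E: "bounded E" "E \<in> sets borel"
  shows "nice (\<lambda>x. measure lborel {y \<in> D. x - y \<in> E} / v)"
proof -
  have [measurable]: "D \<in> sets borel" "E \<in> sets borel" by (rule D E)+
  define Q where "Q = {p \<in> space (borel \<Otimes>\<^sub>M lborel). snd p \<in> D \<and> fst p - snd p \<in> E}"
  have "Q \<in> sets (borel \<Otimes>\<^sub>M lborel)" unfolding Q_def by measurable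
  from lborel.measurable_emeasure_Pair[OF this]
  have "(\<lambda>x. emeasure lborel (Pair x -` Q)) \<in> borel_measurable borel" .
  moreover have "Pair x -` Q = {y \<in> D. x - y \<in> E}" for x by (auto simp: Q_def space_pair_measure)
  ultimately have m: "(\<lambda>x. measure lborel {y \<in> D. x - y \<in> E} / v) \<in> borel_measurable borel"
    unfolding measure_def by simp
  obtain R where R: "\<And>y. y \<in> D \<Longrightarrow> norm y \<le> R" using D(1) bounded_iff by blast
  obtain R' where R': "\<And>x. x \<in> E \<Longrightarrow> norm x \<le> R'" using E(1) bounded_iff by blast
  show ?thesis
    unfolding nice_def
  proof (intro conjI m exI allI impI)
    fix x assume "measure lborel {y \<in> D. x - y \<in> E} / v \<noteq> 0"
    then have "{y \<in> D. x - y \<in> E} \<noteq> {}" by (metis div_0 measure_empty)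
    then obtain y where y: "y \<in> D" "x - y \<in> E" by auto
    have "norm x \<le> norm (x - y) + norm y" by (metis diff_add_cancel norm_triangle_ineq)
    then show "norm x \<le> R' + R" using R[OF y(1)] R'[OF y(2)] by linarith
  next
    fix x
    have "measure lborel {y \<in> D. x - y \<in> E} \<le> measure lborel D"
    proof (rule measure_mono_fmeasurable)
      have "{y \<in> space borel. y \<in> D \<and> x - y \<in> E} \<in> sets borel" by measurable
      then show "{y \<in> D. x - y \<in> E} \<in> sets lborel" by simp
      show "D \<in> fmeasurable lborel" using D emeasure_bounded_finite[OF D(1)] by (intro fmeasurableI) auto
    qed auto
    then show "\<bar>measure lborel {y \<in> D. x - y \<in> E} / v\<bar> \<le> measure lborel D / \<bar>v\<bar>"
      by (simp add: divide_right_mono)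
  qed
qed

section \<open>Common fundamental domains\<close>

lemma (in translation_invariant) equid_mono: "\<lbrakk>equid H c d; H \<subseteq> H'\<rbrakk> \<Longrightarrow> equid H' c d"
  unfolding equid_def by (meson order.trans)

lemma (in translation_invariant) equid_mult_invariant:
  fixes w :: "'a \<Rightarrow> nat"
  assumes "equid H c d" "w \<in> measurable N (count_space UNIV)" "\<And>x h. h \<in> H \<Longrightarrow> w (x - h) = w x"
  shows "equid H (\<lambda>x. c x * w x) (\<lambda>x. d x * w x)"
proof -
  obtain V u where V: "finite V" "V \<subseteq> H" "\<forall>v\<in>V. u v \<in> measurable N (count_space UNIV)"
    "AE x in N. c x = (\<Sum>v\<in>V. u v x)" "AE x in N. d x = (\<Sum>v\<in>V. u v (x - v))"
    using assms(1) unfolding equid_def by blast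
  show ?thesis
  proof (rule equidI[where J = V and g = "\<lambda>v. v" and u = "\<lambda>v x. u v x * w x"])
    show "(\<lambda>x. u v x * w x) \<in> measurable N (count_space UNIV)" if "v \<in> V" for v
    proof -
      have [measurable]: "u v \<in> measurable N (count_space UNIV)" "w \<in> measurable N (count_space UNIV)"
        using V(3) that assms(2) by auto
      show ?thesis by measurable
    qed
    show "AE x in N. c x * w x = (\<Sum>v\<in>V. u v x * w x)"
      using V(4) by eventually_elim (simp add: sum_distrib_right)
    have w: "w (x - v) = w x" if "v \<in> V" for v x using assms(3) V(2) that by blast
    show "AE x in N. d x * w x = (\<Sum>v\<in>V. u v (x - v) * w (x - v))"
      using V(5) by eventually_elim (simp add: sum_distrib_right w)
  qed (use V in auto)
qed

context basis_matrix
begin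

lemma per_divide: "per (\<lambda>x. f x / v) x = per f x / v"
  by (cases "v = 0") (simp_all add: per_def sum_divide_distrib)

lemma cnt_shift_fdom: "cnt {x. x - v \<in> fdom} x = 1"
proof -
  have e: "x - l - v = x - v - l" for l by (simp add: algebra_simps)
  obtain l0 where "\<And>l. l \<in> lat \<and> x - v - l \<in> fdom \<longleftrightarrow> l = l0" using fdom_ex1[of "x - v"] by blast
  then have "{l \<in> lat. x - l \<in> {x. x - v \<in> fdom}} = {l0}" by (auto simp: e)
  then show ?thesis by (simp add: cnt_def)
qed

lemma cnt_fdom: "cnt fdom x = 1"
  using cnt_shift_fdom[of 0] by simp

lemma pm_measurable_periodic:
  assumes "f \<in> measurable pm (count_space UNIV)" "l \<in> lat"
  shows "f (x - l) = f x"
proof -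
  have "f -` {f x} \<inter> space pm \<in> sets pm" by (rule measurable_sets[OF assms(1)]) simp
  then have "f -` {f x} \<in> Per" by (simp add: sets_pm)
  then have "x + (- l) \<in> f -` {f x} \<longleftrightarrow> x \<in> f -` {f x}" using lat_minus[OF assms(2)] unfolding Per_def by blast
  then show ?thesis by simp
qed

text \<open>The pieces are restricted to \<open>fdom\<close> and moved by \<open>v\<close>, which
  spreads them over the shifted parallelepiped. Lattice vectors return it to \<open>fdom\<close> by
  \<open>equid_fdom\<close>, and the weight \<open>u v (x - v)\<close>, being periodic, is carried
  along unchanged.\<close>

lemma equid_pm_lborel:
  assumes eq: "pm.equid \<Lambda> c d" and G: "add_subgroup G" "lat \<subseteq> G" "\<Lambda> \<subseteq> G"
  shows "lb.equid G (\<lambda>x. if x \<in> fdom then c x else 0) (\<lambda>x. if x \<in> fdom then d x else 0)"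
proof -
  obtain V u where V: "finite V" "V \<subseteq> \<Lambda>" "\<forall>v\<in>V. u v \<in> measurable pm (count_space UNIV)"
    and c: "AE x in pm. c x = (\<Sum>v\<in>V. u v x)" and d: "AE x in pm. d x = (\<Sum>v\<in>V. u v (x - v))"
    using eq unfolding pm.equid_def by blast
  have um: "u v \<in> measurable borel (count_space UNIV)" if "v \<in> V" for v
    using V(3) that measurable_pm_borel by blast
  have um': "(\<lambda>x. u v (x - v)) \<in> measurable borel (count_space UNIV)" if "v \<in> V" for v
    by (rule measurable_compose[OF _ um[OF that]]) measurable
  let ?d = "\<lambda>x. \<Sum>v\<in>V. if x - v \<in> fdom then u v (x - v) else 0"
  have 1: "lb.equid G (\<lambda>x. if x \<in> fdom then c x else 0) ?d"
  proof (rule lb.equidI[where J = V and g = "\<lambda>v. v" and u = "\<lambda>v x. if x \<in> fdom then u v x else 0"])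
    show "(\<lambda>x. if x \<in> fdom then u v x else 0) \<in> measurable lborel (count_space UNIV)" if "v \<in> V" for v
      using um[OF that] by measurable
    show "AE x in lborel. (if x \<in> fdom then c x else 0) = (\<Sum>v\<in>V. if x \<in> fdom then u v x else 0)"
      using AE_pm_lborel[OF c] by eventually_elim auto
  qed (use V G in auto)
  have "lb.equid G (\<lambda>x. if x - v \<in> fdom then u v (x - v) else 0) (\<lambda>x. if x \<in> fdom then u v (x - v) else 0)"
    if v: "v \<in> V" for v
  proof -
    let ?D = "{x. x - v \<in> fdom}"
    have "{x \<in> space borel. x - v \<in> fdom} \<in> sets borel" by measurable
    then have D: "?D \<in> sets borel" by simp
    have "?D = (+) v ` fdom"
    proof (intro equalityI subsetI)
      fix x assume "x \<in> ?D" then show "x \<in> (+) v ` fdom" by (intro image_eqI[of _ _ "x - v"]) auto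
    qed auto
    then have Db: "bounded ?D" using bounded_translation[OF bounded_fdom] by simp
    have eqD: "lb.equid lat (\<lambda>x. (if x \<in> ?D then 1 else 0) * u v (x - v)) (\<lambda>x. (if x \<in> fdom then cnt ?D x else 0) * u v (x - v))"
    proof (rule lb.equid_mult_invariant[OF equid_fdom[OF Db D]])
      show "(\<lambda>x. u v (x - v)) \<in> measurable lborel (count_space UNIV)" using um'[OF v] by simp
      fix x l assume "l \<in> lat"
      then show "u v (x - l - v) = u v (x - v)"
        using pm_measurable_periodic[of "u v" l "x - v"] V(3) v by (simp add: algebra_simps)
    qed
    have "(\<lambda>x. (if x \<in> ?D then 1 else 0) * u v (x - v)) = (\<lambda>x. if x - v \<in> fdom then u v (x - v) else 0)"
      and "(\<lambda>x. (if x \<in> fdom then cnt ?D x else 0) * u v (x - v)) = (\<lambda>x. if x \<in> fdom then u v (x - v) else 0)"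
      unfolding cnt_shift_fdom by (rule ext, simp)+
    note 3 = this
    show ?thesis using lb.equid_mono[OF eqD G(2)] unfolding 3 .
  qed
  then have "lb.equid G ?d (\<lambda>x. \<Sum>v\<in>V. if x \<in> fdom then u v (x - v) else 0)"
    by (intro lb.equid_sum V(1) add_subgroupD(1)[OF G(1)])
  then have 2: "lb.equid G ?d (\<lambda>x. if x \<in> fdom then d x else 0)"
  proof (rule lb.equid_cong_AE)
    show "AE x in lborel. (\<Sum>v\<in>V. if x \<in> fdom then u v (x - v) else 0) = (if x \<in> fdom then d x else 0)"
      using AE_pm_lborel[OF d] by eventually_elim auto
  qed simp
  show ?thesis by (rule lb.equid_trans[OF 1 2 add_subgroupD(2)[OF G(1)]])
qed

end

section \<open>From an equidecomposition to a common tile\<close>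

lemma has_sum_indicator_single:
  assumes "k \<in> L" "\<And>l. l \<in> L \<Longrightarrow> x - l \<in> \<Omega> \<longleftrightarrow> l = k"
  shows "((\<lambda>l. indicat_real \<Omega> (x - l)) has_sum 1) L"
proof -
  have "((\<lambda>l. indicat_real \<Omega> (x - l)) has_sum (\<Sum>l\<in>{k}. indicat_real \<Omega> (x - l))) {k}" by (rule has_sum_finite) simp
  moreover have "(\<Sum>l\<in>{k}. indicat_real \<Omega> (x - l)) = 1" using assms by (simp add: indicator_def)
  ultimately have "((\<lambda>l. indicat_real \<Omega> (x - l)) has_sum 1) {k}" by simp
  moreover have "((\<lambda>l. indicat_real \<Omega> (x - l)) has_sum 1) L \<longleftrightarrow> ((\<lambda>l. indicat_real \<Omega> (x - l)) has_sum 1) {k}"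
    by (rule has_sum_cong_neutral) (use assms in \<open>auto simp: indicator_def\<close>)
  ultimately show ?thesis by blast
qed

text \<open>A point of \<Omega> has the form y = x + a v with x in the piece of \<open>D\<close>
  that is moved by v. Modulo \<open>L\<close> it represents the point x of \<open>D\<close>; modulo
  \<open>M\<close> it represents y + b v = x + v, a point of \<open>E\<close>. Hence \<Omega>
  inherits the tiling property of \<open>D\<close> for \<open>L\<close> and that of \<open>E\<close>
  for \<open>M\<close>.\<close>

lemma tiling_of_equid:
  fixes L M D E :: "(real ^ 'n) set"
  assumes L: "add_subgroup L" "countable L" and M: "add_subgroup M" "countable M"
    and D: "D \<in> sets borel" "bounded D" "\<And>x. \<exists>!l. l \<in> L \<and> x - l \<in> D"
    and E: "\<And>x. \<exists>!m. m \<in> M \<and> x - m \<in> E"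
    and eq: "lb.equid {l + m | l m. l \<in> L \<and> m \<in> M} (\<lambda>x. if x \<in> D then 1 else 0) (\<lambda>x. if x \<in> E then 1 else 0)"
  shows "\<exists>\<Omega>. bounded \<Omega> \<and> \<Omega> \<in> sets lebesgue \<and> tiles_with \<Omega> L \<and> tiles_with \<Omega> M"
proof -
  let ?G = "{l + m | l m. l \<in> L \<and> m \<in> M}"
  obtain V u where V: "finite V" "V \<subseteq> ?G" "\<forall>v\<in>V. u v \<in> measurable lborel (count_space (UNIV::nat set))"
    and c: "AE x in lborel. (if x \<in> D then 1 else 0) = (\<Sum>v\<in>V. u v x)"
    and d: "AE x in lborel. (if x \<in> E then 1 else 0) = (\<Sum>v\<in>V. u v (x - v))"
    using eq unfolding lb.equid_def by blast
  have "\<forall>v\<in>V. \<exists>l m. v = l + m \<and> l \<in> L \<and> m \<in> M" using V(2) by blast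
  then obtain a b where ab: "\<And>v. v \<in> V \<Longrightarrow> v = a v + b v \<and> a v \<in> L \<and> b v \<in> M" by metis
  have bv: "b v = v - a v" if "v \<in> V" for v using ab[OF that] by (metis add_diff_cancel_left')
  define \<Omega> where "\<Omega> = (\<Union>v\<in>V. {y. y - a v \<in> D \<and> u v (y - a v) \<ge> 1})"
  have "\<Omega> \<subseteq> (\<Union>v\<in>V. (+) (a v) ` D)"
  proof
    fix y assume "y \<in> \<Omega>"
    then obtain v where "v \<in> V" "y - a v \<in> D" by (auto simp: \<Omega>_def)
    moreover have "y = a v + (y - a v)" by simp
    ultimately show "y \<in> (\<Union>v\<in>V. (+) (a v) ` D)" by blast
  qed
  moreover have "bounded (\<Union>v\<in>V. (+) (a v) ` D)"
    using V(1) bounded_translation[OF D(2)] by (intro bounded_UN) auto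
  ultimately have bd: "bounded \<Omega>" using bounded_subset by blast
  have "{y. y - a v \<in> D \<and> u v (y - a v) \<ge> 1} \<in> sets borel" if "v \<in> V" for v
  proof -
    have [measurable]: "u v \<in> measurable borel (count_space UNIV)" "D \<in> sets borel" using V(3) that D(1) by auto
    have "{y \<in> space borel. y - a v \<in> D \<and> u v (y - a v) \<ge> 1} \<in> sets borel" by measurable
    then show ?thesis by simp
  qed
  then have "\<Omega> \<in> sets borel" unfolding \<Omega>_def using V(1) by (intro sets.finite_UN) auto
  then have ms: "\<Omega> \<in> sets lebesgue" by simp
  define good where "good = (\<lambda>x. (if x \<in> D then 1 else 0) = (\<Sum>v\<in>V. u v x) \<and> (if x \<in> E then 1 else 0) = (\<Sum>v\<in>V. u v (x - v)))"
  have "?G = (\<lambda>(l, m). l + m) ` (L \<times> M)" by auto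
  then have cG: "countable ?G" using L(2) M(2) by simp
  have aeg: "AE x in lborel. good (x - g)" for g
    by (rule lb.AE_shift_minus) (use c d in \<open>unfold good_def, eventually_elim, simp\<close>)
  have "AE x in lborel. \<forall>g\<in>?G. good (x - g)"
    by (rule AE_ball_countable[THEN iffD2, OF cG]) (intro ballI aeg)
  then have ae: "AE x in lebesgue. \<forall>g\<in>?G. good (x - g)" by (rule AE_completion)
  have goodL: "good (x - l)" if "\<forall>g\<in>?G. good (x - g)" "l \<in> L" for x l
    using that add_subgroupD(1)[OF M(1)] by (metis (mono_tags, lifting) add.right_neutral mem_Collect_eq)
  have goodM: "good (x - m)" if "\<forall>g\<in>?G. good (x - g)" "m \<in> M" for x m
    using that add_subgroupD(1)[OF L(1)] by (metis (mono_tags, lifting) add.left_neutral mem_Collect_eq)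
  have one: "\<exists>v0\<in>V. \<forall>v\<in>V. f v \<ge> 1 \<longleftrightarrow> v = v0" if f: "(\<Sum>v\<in>V. f v) = 1" for f :: "real ^ 'n \<Rightarrow> nat"
  proof -
    obtain v0 where "v0 \<in> V" "f v0 = 1" "\<forall>v\<in>V. v0 \<noteq> v \<longrightarrow> f v = 0" using f sum_eq_1_iff[OF V(1), of f] by auto
    then show ?thesis by (intro bexI[of _ v0]) auto
  qed
  have "tiles_with \<Omega> L"
    unfolding tiles_with_def using ae
  proof eventually_elim
    case (elim x)
    obtain l0 where l0: "l0 \<in> L" "x - l0 \<in> D" and un: "\<And>l. \<lbrakk>l \<in> L; x - l \<in> D\<rbrakk> \<Longrightarrow> l = l0" using D(3)[of x] by blast
    have "(\<Sum>v\<in>V. u v (x - l0)) = 1" using goodL[OF elim l0(1)] l0(2) by (simp add: good_def)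
    then obtain v0 where v0: "v0 \<in> V" "\<And>v. v \<in> V \<Longrightarrow> u v (x - l0) \<ge> 1 \<longleftrightarrow> v = v0" using one by blast
    show ?case
    proof (rule has_sum_indicator_single[where k = "l0 - a v0"])
      show "l0 - a v0 \<in> L" using l0 ab[OF v0(1)] add_subgroupD(4)[OF L(1)] by blast
      fix l assume l: "l \<in> L"
      show "x - l \<in> \<Omega> \<longleftrightarrow> l = l0 - a v0"
      proof
        assume "x - l \<in> \<Omega>"
        then obtain v where v: "v \<in> V" "x - l - a v \<in> D" "u v (x - l - a v) \<ge> 1" by (auto simp: \<Omega>_def)
        have e: "x - l - a v = x - (l + a v)" by simp
        have "l + a v = l0" using un[of "l + a v"] v(1,2) ab[OF v(1)] add_subgroupD(2)[OF L(1) l] unfolding e by blast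
        moreover from this have "v = v0" using v v0(2)[of v] unfolding e by simp
        ultimately show "l = l0 - a v0" by auto
      next
        assume l: "l = l0 - a v0"
        have e: "x - l - a v0 = x - l0" unfolding l by simp
        have "x - l - a v0 \<in> D \<and> u v0 (x - l - a v0) \<ge> 1" unfolding e using v0(1) v0(2)[of v0] l0(2) by blast
        then show "x - l \<in> \<Omega>" unfolding \<Omega>_def using v0(1) by blast
      qed
    qed
  qed
  moreover have "tiles_with \<Omega> M"
    unfolding tiles_with_def using ae
  proof eventually_elim
    case (elim x)
    obtain m0 where m0: "m0 \<in> M" "x - m0 \<in> E" and un: "\<And>m. \<lbrakk>m \<in> M; x - m \<in> E\<rbrakk> \<Longrightarrow> m = m0" using E[of x] by blast
    have "(\<Sum>v\<in>V. u v (x - m0 - v)) = 1" using goodM[OF elim m0(1)] m0(2) by (simp add: good_def)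
    then obtain v0 where v0: "v0 \<in> V" "\<And>v. v \<in> V \<Longrightarrow> u v (x - m0 - v) \<ge> 1 \<longleftrightarrow> v = v0"
      using one[of "\<lambda>v. u v (x - m0 - v)"] by blast
    show ?case
    proof (rule has_sum_indicator_single[where k = "m0 + b v0"])
      show "m0 + b v0 \<in> M" using m0 ab[OF v0(1)] add_subgroupD(2)[OF M(1)] by blast
      fix m assume m: "m \<in> M"
      show "x - m \<in> \<Omega> \<longleftrightarrow> m = m0 + b v0"
      proof
        assume "x - m \<in> \<Omega>"
        then obtain v where v: "v \<in> V" "u v (x - m - a v) \<ge> 1" by (auto simp: \<Omega>_def)
        define m' where "m' = m - b v"
        have m': "m' \<in> M" using m ab[OF v(1)] add_subgroupD(4)[OF M(1)] by (simp add: m'_def)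
        have e: "x - m - a v = x - m' - v" unfolding m'_def bv[OF v(1)] by (simp add: algebra_simps)
        have "u v (x - m' - v) \<le> (\<Sum>v\<in>V. u v (x - m' - v))" using v(1) V(1) by (intro member_le_sum) auto
        then have "x - m' \<in> E" using goodM[OF elim m'] v(2) unfolding e by (auto simp: good_def split: if_splits)
        then have "m' = m0" using un m' by blast
        moreover from this have "v = v0" using v v0(2)[of v] unfolding e by simp
        ultimately show "m = m0 + b v0" by (auto simp: m'_def)
      next
        assume m: "m = m0 + b v0"
        have e: "x - m - a v0 = x - m0 - v0" unfolding m bv[OF v0(1)] by (simp add: algebra_simps)
        have u: "u v0 (x - m0 - v0) \<ge> 1" using v0 by blast
        \<comment> \<open>The starting point of the unit that ends at \<open>x - m0\<close> differs
          from \<open>x\<close> by an element of L + M, so \<open>good\<close> is available there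
          too and shows that it lies in \<open>D\<close>.\<close>
        have xe: "x - m0 - v0 = x - (a v0 + (m0 + b v0))" unfolding bv[OF v0(1)] by (simp add: algebra_simps)
        have "a v0 + (m0 + b v0) \<in> ?G" using ab[OF v0(1)] m0(1) add_subgroupD(2)[OF M(1)] by blast
        then have "good (x - m0 - v0)" using elim unfolding xe by blast
        moreover have "u v0 (x - m0 - v0) \<le> (\<Sum>v\<in>V. u v (x - m0 - v0))"
          using v0(1) V(1) by (intro member_le_sum) auto
        ultimately have "x - m0 - v0 \<in> D" using u by (auto simp: good_def split: if_splits)
        then have "x - m - a v0 \<in> D \<and> u v0 (x - m - a v0) \<ge> 1" unfolding e using u by blast
        then show "x - m \<in> \<Omega>" unfolding \<Omega>_def using v0(1) by blast
      qed
    qed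
  qed
  ultimately show ?thesis using bd ms by blast
qed

section \<open>The two lattices and the torus modulo H\<close>

locale lattice_triple = L: basis_matrix A Ai + M: basis_matrix B Bi + H: basis_matrix C Ci
  for A Ai B Bi C Ci :: "real ^ 'n ^ 'n" +
  fixes I :: "'n set"
  assumes L_sub: "L.lat \<subseteq> H.lat" and column_H: "i \<notin> I \<Longrightarrow> column i B \<in> H.lat"
    and H_sub: "H.lat \<subseteq> {l + m | l m. l \<in> L.lat \<and> m \<in> M.lat}"
    and free: "\<And>z :: 'n \<Rightarrow> int. \<exists>i\<in>I. z i \<noteq> 0 \<Longrightarrow> (\<Sum>i\<in>I. of_int (z i) *\<^sub>R column i B) \<notin> H.lat"
    and det: "\<bar>det A\<bar> = \<bar>det B\<bar>"
begin

text \<open>Periodization modulo H annihilates differences along vectors of H. This removes the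
  whole coboundary over L, which compares \<open>F\<close> with the indicator of
  \<open>L.fdom\<close>, and the columns of \<open>B\<close> outside \<open>I\<close> from the one
  over M, so a flow in the directions of \<open>I\<close> remains.\<close>

lemma count_difference:
  obtains \<phi> K where "\<And>i. \<phi> i \<in> borel_measurable H.pm" "\<And>i x. \<bar>\<phi> i x\<bar> \<le> K"
    "\<And>x. real (H.cnt M.fdom x) - real (H.cnt L.fdom x) = (\<Sum>i\<in>I. \<phi> i x - \<phi> i (x - column i B))"
proof -
  define v where "v = measure lborel L.fdom"
  have vM: "v = measure lborel M.fdom" unfolding v_def L.measure_fdom M.measure_fdom det ..
  have v: "v > 0" unfolding v_def by (rule L.measure_fdom_pos)
  note bdL = L.bounded_fdom L.fdom_borel and bdM = M.bounded_fdom M.fdom_borel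
  define F where "F = (\<lambda>x. measure lborel {y \<in> L.fdom. x - y \<in> M.fdom} / v)"
  have nF: "nice F" unfolding F_def by (rule nice_kernel[OF bdL bdM])
  have pM: "M.per F x = 1" for x
    unfolding F_def M.per_divide M.kernel_per[OF bdL] using v by (simp add: v_def)
  have F': "F = (\<lambda>x. measure lborel {y \<in> M.fdom. x - y \<in> L.fdom} / v)"
    unfolding F_def measure_reflect[OF bdL(2) bdM(2)] ..
  have pL: "L.per F x = 1" for x
    unfolding F' L.per_divide L.kernel_per[OF bdM] using v by (simp add: vM)
  note nL = nice_indicator[OF bdL] and nM = nice_indicator[OF bdM]
  have "M.cob (\<lambda>x. indicat_real M.fdom x - F x)"
    by (rule M.cob_if_per_zero[OF nice_diff[OF nM nF]])
      (simp add: M.per_diff[OF nM nF] pM M.cnt_per[symmetric] M.cnt_fdom)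
  then obtain \<psi> where \<psi>: "\<And>i. nice (\<psi> i)"
    and fM: "\<And>x. indicat_real M.fdom x - F x = (\<Sum>i\<in>UNIV. \<psi> i x - \<psi> i (x - column i B))"
    unfolding M.cob_def by blast
  have "L.cob (\<lambda>x. F x - indicat_real L.fdom x)"
    by (rule L.cob_if_per_zero[OF nice_diff[OF nF nL]])
      (simp add: L.per_diff[OF nF nL] pL L.cnt_per[symmetric] L.cnt_fdom)
  then obtain \<eta> where \<eta>: "\<And>i. nice (\<eta> i)"
    and fL: "\<And>x. F x - indicat_real L.fdom x = (\<Sum>i\<in>UNIV. \<eta> i x - \<eta> i (x - column i A))"
    unfolding L.cob_def by blast
  have per_cob: "H.per (\<lambda>x. \<Sum>i\<in>UNIV. \<theta> i x - \<theta> i (x - e i)) x = (\<Sum>i\<in>UNIV. H.per (\<theta> i) x - H.per (\<theta> i) (x - e i))"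
    if "\<And>i. nice (\<theta> i)" for \<theta> :: "'n \<Rightarrow> real ^ 'n \<Rightarrow> real" and e x
  proof -
    have "H.per (\<lambda>x. \<Sum>i\<in>UNIV. \<theta> i x - \<theta> i (x - e i)) x = (\<Sum>i\<in>UNIV. H.per (\<lambda>x. \<theta> i x - \<theta> i (x - e i)) x)"
      by (rule H.per_sum) (intro nice_diff nice_shift that)
    also have "\<dots> = (\<Sum>i\<in>UNIV. H.per (\<theta> i) x - H.per (\<theta> i) (x - e i))"
    proof (rule sum.cong[OF refl])
      show "H.per (\<lambda>x. \<theta> i x - \<theta> i (x - e i)) x = H.per (\<theta> i) x - H.per (\<theta> i) (x - e i)" for i
        unfolding H.per_diff[OF that nice_shift[OF that]] H.per_shift ..
    qed
    finally show ?thesis .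
  qed
  have inv: "H.per f (x - l) = H.per f x" if "l \<in> H.lat" for f l x
    using H.per_shift_lat[OF that, of f x] by (simp add: H.per_shift)
  have eq: "real (H.cnt M.fdom x) - real (H.cnt L.fdom x) = (\<Sum>i\<in>I. H.per (\<psi> i) x - H.per (\<psi> i) (x - column i B))" for x
  proof -
    have "H.per (indicat_real M.fdom) x - H.per F x = H.per (\<lambda>x. \<Sum>i\<in>UNIV. \<psi> i x - \<psi> i (x - column i B)) x"
      unfolding fM[symmetric] H.per_diff[OF nM nF] ..
    also have "\<dots> = (\<Sum>i\<in>UNIV. H.per (\<psi> i) x - H.per (\<psi> i) (x - column i B))" by (rule per_cob[OF \<psi>])
    also have "\<dots> = (\<Sum>i\<in>I. H.per (\<psi> i) x - H.per (\<psi> i) (x - column i B))"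
      by (rule sum.mono_neutral_right) (auto simp: inv column_H)
    finally have 1: "H.per (indicat_real M.fdom) x - H.per F x = (\<Sum>i\<in>I. H.per (\<psi> i) x - H.per (\<psi> i) (x - column i B))" .
    have "H.per F x - H.per (indicat_real L.fdom) x = H.per (\<lambda>x. \<Sum>i\<in>UNIV. \<eta> i x - \<eta> i (x - column i A)) x"
      unfolding fL[symmetric] H.per_diff[OF nF nL] ..
    also have "\<dots> = (\<Sum>i\<in>UNIV. H.per (\<eta> i) x - H.per (\<eta> i) (x - column i A))" by (rule per_cob[OF \<eta>])
    also have "\<dots> = 0" by (rule sum.neutral) (simp add: inv subsetD[OF L_sub L.column_lat])
    finally show ?thesis using 1 by (simp add: H.cnt_per)
  qed
  have "\<forall>i. \<exists>K. \<forall>x. \<bar>H.per (\<psi> i) x\<bar> \<le> K" using H.per_nice(2)[OF \<psi>] by blast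
  then obtain K where K: "\<And>i x. \<bar>H.per (\<psi> i) x\<bar> \<le> K i" by metis
  have "K i \<le> Max (range K)" for i by simp
  then have "\<And>i x. \<bar>H.per (\<psi> i) x\<bar> \<le> Max (range K)" using K order.trans by blast
  then show thesis using that[of "\<lambda>i. H.per (\<psi> i)"] H.per_nice(1)[OF \<psi>] eq by blast
qed

lemma equid_fdoms:
  "lb.equid {l + m | l m. l \<in> L.lat \<and> m \<in> M.lat} (\<lambda>x. if x \<in> L.fdom then 1 else 0) (\<lambda>x. if x \<in> M.fdom then 1 else 0)"
proof -
  let ?G = "{l + m | l m. l \<in> L.lat \<and> m \<in> M.lat}"
  let ?e = "\<lambda>i. column i B"
  interpret lt: lattice_translation H.pm "- H.lat" I ?e M.coord
  proof (intro lattice_translation.intro lattice_translation_axioms.intro H.pm.free_translation_axioms)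
    show "(\<Sum>i\<in>I. of_int (z i) *\<^sub>R ?e i) \<in> - H.lat" if "\<exists>i\<in>I. z i \<noteq> 0" for z :: "'n \<Rightarrow> int" using free[OF that] by simp
  qed (simp_all add: M.linear_coord M.coord_column)
  obtain \<phi> K where \<phi>: "\<And>i. \<phi> i \<in> borel_measurable H.pm" "\<And>i x. \<bar>\<phi> i x\<bar> \<le> K"
    and diff: "\<And>x. real (H.cnt M.fdom x) - real (H.cnt L.fdom x) = (\<Sum>i\<in>I. \<phi> i x - \<phi> i (x - ?e i))"
    using count_difference by blast
  have int: "(\<Sum>i\<in>I. \<phi> i x - \<phi> i (x - ?e i)) \<in> \<int>" for x unfolding diff[symmetric] by simp
  obtain a K' where a: "\<And>i. i \<in> I \<Longrightarrow> a i \<in> borel_measurable H.pm" "\<And>i. i \<in> I \<Longrightarrow> AE x in H.pm. \<bar>a i x\<bar> \<le> K'"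
    "\<And>i. i \<in> I \<Longrightarrow> AE x in H.pm. a i x \<in> \<int>"
    and adiv: "AE x in H.pm. (\<Sum>i\<in>I. a i x - a i (x - ?e i)) = (\<Sum>i\<in>I. \<phi> i x - \<phi> i (x - ?e i))"
    using H.pm.integer_flow[where I = I and e = ?e and \<phi> = \<phi> and C = K] lt.free \<phi> int by auto
  define k where "k = nat \<lceil>K'\<rceil>"
  \<comment> \<open>The floor gives genuine integers, and clamping makes the bound hold at every
    point, as \<open>flow_equid\<close> demands. Almost everywhere neither changes the
    value.\<close>
  define b where "b = (\<lambda>i x. max (- int k) (min (int k) \<lfloor>a i x\<rfloor>))"
  have bm: "b i \<in> measurable H.pm (count_space UNIV)" if "i \<in> I" for i
  proof -
    have [measurable]: "a i \<in> borel_measurable H.pm" by (rule a(1)[OF that])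
    show ?thesis unfolding b_def by measurable
  qed
  have bb: "\<bar>b i x\<bar> \<le> int k" for i x by (auto simp: b_def)
  have bt: "a i x = of_int (b i x)" if ax: "\<bar>a i x\<bar> \<le> K'" "a i x \<in> \<int>" for i x
  proof -
    obtain n where n: "a i x = of_int n" using ax(2) by (auto elim: Ints_cases)
    have "\<bar>n\<bar> \<le> int k" using ax(1) unfolding n k_def by linarith
    then show ?thesis by (auto simp: b_def n)
  qed
  have ab: "AE x in H.pm. a i x = of_int (b i x)" if "i \<in> I" for i
    using a(2,3)[OF that] by eventually_elim (rule bt)
  have "AE x in H.pm. \<forall>i\<in>I. a i x = of_int (b i x)" by (rule AE_finite_allI) (use ab in auto)
  moreover have "AE x in H.pm. \<forall>i\<in>I. a i (x - ?e i) = of_int (b i (x - ?e i))"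
    by (rule AE_finite_allI) (use H.pm.AE_shift_minus[OF ab] in auto)
  ultimately have flow: "AE x in H.pm. int (H.cnt M.fdom x) - int (H.cnt L.fdom x) = (\<Sum>i\<in>I. b i x - b i (x - ?e i))"
    using adiv
  proof eventually_elim
    case (elim x)
    have "(of_int (int (H.cnt M.fdom x) - int (H.cnt L.fdom x)) :: real) = (\<Sum>i\<in>I. a i x - a i (x - ?e i))"
      using elim(3) diff[of x] by simp
    also have "\<dots> = of_int (\<Sum>i\<in>I. b i x - b i (x - ?e i))" using elim(1,2) by simp
    finally show ?case by (simp only: of_int_eq_iff)
  qed
  \<comment> \<open>Every coset of L meets \<open>L.fdom\<close>, hence so does every coset of the
    larger H. This supplies the units exchanged in \<open>flow_equid\<close>.\<close>
  have "1 \<le> H.cnt L.fdom x" for x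
  proof -
    obtain l where l: "l \<in> L.lat" "x - l \<in> L.fdom" using L.fdom_ex by blast
    have "{l \<in> H.lat. x - l \<in> L.fdom} = {l \<in> H.lat. indicat_real L.fdom (x - l) \<noteq> 0}" by (auto simp: indicator_def)
    then have "finite {l \<in> H.lat. x - l \<in> L.fdom}"
      using H.finite_support[OF nice_indicator[OF L.bounded_fdom L.fdom_borel], of x] by simp
    moreover have "l \<in> {l \<in> H.lat. x - l \<in> L.fdom}" using l L_sub by auto
    ultimately have "card {l \<in> H.lat. x - l \<in> L.fdom} \<noteq> 0" by (metis card_0_eq empty_iff)
    then show ?thesis by (simp add: H.cnt_def)
  qed
  then have eq: "H.pm.equid lt.\<Lambda> (H.cnt L.fdom) (H.cnt M.fdom)"
    by (rule lt.flow_equid[OF H.cnt_measurable[OF L.bounded_fdom L.fdom_borel] _ H.cnt_measurable[OF M.bounded_fdom M.fdom_borel] bm bb flow])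
  have G: "add_subgroup ?G"
    unfolding add_subgroup_def
  proof (intro conjI ballI)
    show "0 \<in> ?G" using L.lat_0 M.lat_0 by force
    fix x y assume "x \<in> ?G" "y \<in> ?G"
    then obtain l m l' m' where *: "x = l + m" "y = l' + m'" "l \<in> L.lat" "m \<in> M.lat" "l' \<in> L.lat" "m' \<in> M.lat" by blast
    have "x + y = (l + l') + (m + m')" unfolding * by (simp add: algebra_simps)
    then show "x + y \<in> ?G" using L.lat_add[OF *(3,5)] M.lat_add[OF *(4,6)] by blast
  next
    fix x assume "x \<in> ?G"
    then obtain l m where *: "x = l + m" "l \<in> L.lat" "m \<in> M.lat" by blast
    have "- x = (- l) + (- m)" unfolding * by simp
    then show "- x \<in> ?G" using L.lat_minus[OF *(2)] M.lat_minus[OF *(3)] by blast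
  qed
  have "lt.\<Lambda> \<subseteq> M.lat"
    unfolding lt.comb_def by (auto intro!: add_subgroup_sum add_subgroup_int_scale M.lat_subgroup M.column_lat)
  moreover have "M.lat \<subseteq> ?G" using L.lat_0 by force
  ultimately have "lt.\<Lambda> \<subseteq> ?G" by blast
  from H.equid_pm_lborel[OF eq G H_sub this]
  have 2: "lb.equid ?G (\<lambda>x. if x \<in> H.fdom then H.cnt L.fdom x else 0) (\<lambda>x. if x \<in> H.fdom then H.cnt M.fdom x else 0)" .
  have 1: "lb.equid ?G (\<lambda>x. if x \<in> L.fdom then 1 else 0) (\<lambda>x. if x \<in> H.fdom then H.cnt L.fdom x else 0)"
    by (rule lb.equid_mono[OF H.equid_fdom[OF L.bounded_fdom L.fdom_borel] H_sub])
  have "lb.equid ?G (\<lambda>x. if x \<in> M.fdom then 1 else 0) (\<lambda>x. if x \<in> H.fdom then H.cnt M.fdom x else 0)"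
    by (rule lb.equid_mono[OF H.equid_fdom[OF M.bounded_fdom M.fdom_borel] H_sub])
  moreover have "uminus ` ?G \<subseteq> ?G" using add_subgroupD(3)[OF G] by blast
  ultimately have 3: "lb.equid ?G (\<lambda>x. if x \<in> H.fdom then H.cnt M.fdom x else 0) (\<lambda>x. if x \<in> M.fdom then 1 else 0)"
    by (rule lb.equid_sym)
  have Gadd: "\<And>x y. \<lbrakk>x \<in> ?G; y \<in> ?G\<rbrakk> \<Longrightarrow> x + y \<in> ?G" by (rule add_subgroupD(2)[OF G])
  show ?thesis by (rule lb.equid_trans[OF lb.equid_trans[OF 1 2 Gadd] 3 Gadd])
qed

lemma common_tile: "\<exists>\<Omega>. bounded \<Omega> \<and> \<Omega> \<in> sets lebesgue \<and> tiles_with \<Omega> L.lat \<and> tiles_with \<Omega> M.lat"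
  by (rule tiling_of_equid[OF L.lat_subgroup L.countable_lat M.lat_subgroup M.countable_lat
        L.fdom_borel L.bounded_fdom L.fdom_ex1 M.fdom_ex1 equid_fdoms])

end

text \<open>H is discrete because one integer multiple sends it into L. For freeness, suppose a
  combination of the columns in \<open>I\<close> equals l + t with l in L and t in \<tau>. Then l
  lies in both L and M, hence in \<tau>, so the combination is in \<tau>, where all coordinates in
  \<open>I\<close> vanish.\<close>

lemma lattice_triple_exists:
  fixes L M :: "(real ^ 'n) set"
  assumes L: "euclidean_lattice L" and M: "euclidean_lattice M"
  obtains B C :: "real ^ 'n ^ 'n" and I where "invertible B" "M = matrix_lattice B" "invertible C"
    "discrete (matrix_lattice C)" "L \<subseteq> matrix_lattice C" "\<And>i. i \<notin> I \<Longrightarrow> column i B \<in> matrix_lattice C"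
    "matrix_lattice C \<subseteq> {l + m | l m. l \<in> L \<and> m \<in> M}"
    "\<And>z :: 'n \<Rightarrow> int. \<exists>i\<in>I. z i \<noteq> 0 \<Longrightarrow> (\<Sum>i\<in>I. of_int (z i) *\<^sub>R column i B) \<notin> matrix_lattice C"
proof -
  have sL: "add_subgroup L" "discrete L" "span L = UNIV" and sM: "add_subgroup M"
    using L M by (auto simp: euclidean_lattice_iff)
  define \<tau> where "\<tau> = {m \<in> M. \<exists>n::nat. n > 0 \<and> of_nat n *\<^sub>R m \<in> L}"
  have s\<tau>: "add_subgroup \<tau>"
    unfolding add_subgroup_def
  proof (intro conjI ballI)
    show "0 \<in> \<tau>" using add_subgroupD(1)[OF sM] add_subgroupD(1)[OF sL(1)] by (auto simp: \<tau>_def)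
    fix x y assume "x \<in> \<tau>" "y \<in> \<tau>"
    then obtain n m :: nat where *: "n > 0" "m > 0" "of_nat n *\<^sub>R x \<in> L" "of_nat m *\<^sub>R y \<in> L" "x \<in> M" "y \<in> M"
      by (auto simp: \<tau>_def)
    have "of_nat (n * m) *\<^sub>R (x + y) = of_nat m *\<^sub>R (of_nat n *\<^sub>R x) + of_nat n *\<^sub>R (of_nat m *\<^sub>R y)"
      by (simp add: algebra_simps)
    then have "of_nat (n * m) *\<^sub>R (x + y) \<in> L"
      using add_subgroup_nat_scale[OF sL(1) *(3)] add_subgroup_nat_scale[OF sL(1) *(4)] add_subgroupD(2)[OF sL(1)] by metis
    moreover have "n * m > 0" using *(1,2) by simp
    ultimately show "x + y \<in> \<tau>" using add_subgroupD(2)[OF sM *(5,6)] unfolding \<tau>_def by blast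
  next
    fix x assume "x \<in> \<tau>"
    then show "- x \<in> \<tau>" using add_subgroupD(3)[OF sM] add_subgroupD(3)[OF sL(1)] by (fastforce simp: \<tau>_def)
  qed
  have \<tau>M: "\<tau> \<subseteq> M" by (auto simp: \<tau>_def)
  have pure: "x \<in> \<tau>" if x: "x \<in> M" "n > 0" "of_nat n *\<^sub>R x \<in> \<tau>" for x and n :: nat
  proof -
    obtain m :: nat where m: "m > 0" "of_nat m *\<^sub>R (of_nat n *\<^sub>R x) \<in> L" using x(3) by (auto simp: \<tau>_def)
    then have "of_nat (m * n) *\<^sub>R x \<in> L" "m * n > 0" using x(2) by simp_all
    then show ?thesis using x(1) unfolding \<tau>_def by blast
  qed
  obtain B :: "real ^ 'n ^ 'n" and I where B: "invertible B" "M = matrix_lattice B"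
    and \<tau>: "\<tau> = {B *v z | z. z \<in> int_vectors \<and> (\<forall>i\<in>I. z $ i = 0)}"
    by (rule lattice_adapted_basis[OF M s\<tau> \<tau>M]) (auto intro: pure)
  define H where "H = {l + t | l t. l \<in> L \<and> t \<in> \<tau>}"
  have sH: "add_subgroup H"
    unfolding add_subgroup_def
  proof (intro conjI ballI)
    show "0 \<in> H" using add_subgroupD(1)[OF sL(1)] add_subgroupD(1)[OF s\<tau>] unfolding H_def by force
    fix x y assume "x \<in> H" "y \<in> H"
    then obtain l m l' m' where *: "x = l + m" "y = l' + m'" "l \<in> L" "m \<in> \<tau>" "l' \<in> L" "m' \<in> \<tau>" unfolding H_def by blast
    have "x + y = (l + l') + (m + m')" unfolding * by (simp add: algebra_simps)
    then show "x + y \<in> H" unfolding H_def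
      using add_subgroupD(2)[OF sL(1) *(3,5)] add_subgroupD(2)[OF s\<tau> *(4,6)] by blast
  next
    fix x assume "x \<in> H"
    then obtain l m where *: "x = l + m" "l \<in> L" "m \<in> \<tau>" unfolding H_def by blast
    have "- x = (- l) + (- m)" unfolding * by simp
    then show "- x \<in> H" unfolding H_def
      using add_subgroupD(3)[OF sL(1) *(2)] add_subgroupD(3)[OF s\<tau> *(3)] by blast
  qed
  have LH: "L \<subseteq> H" using add_subgroupD(1)[OF s\<tau>] unfolding H_def by force
  have \<tau>H: "\<tau> \<subseteq> H" using add_subgroupD(1)[OF sL(1)] unfolding H_def by force
  have col\<tau>: "column i B \<in> \<tau>" if "i \<notin> I" for i
  proof -
    have "column i B = B *v axis i 1" by (simp add: matrix_vector_mult_basis)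
    moreover have "axis i 1 \<in> (int_vectors :: (real ^ 'n) set)" by (auto simp: int_vectors_def axis_def)
    moreover have "\<forall>j\<in>I. axis i (1::real) $ j = 0" using that by (auto simp: axis_def)
    ultimately show ?thesis unfolding \<tau> by blast
  qed
  then have "\<forall>i. \<exists>n::nat. i \<notin> I \<longrightarrow> n > 0 \<and> of_nat n *\<^sub>R column i B \<in> L" unfolding \<tau>_def by blast
  then obtain n :: "'n \<Rightarrow> nat" where n: "\<And>i. i \<notin> I \<Longrightarrow> n i > 0" "\<And>i. i \<notin> I \<Longrightarrow> of_nat (n i) *\<^sub>R column i B \<in> L" by metis
  \<comment> \<open>A common multiple of the orders modulo L of the columns that generate \<tau>, so
    that multiplication by \<open>K\<close> sends \<tau>, and hence H, into L.\<close>
  define K where "K = (\<Prod>i\<in>-I. n i)"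
  have K0: "K > 0" unfolding K_def using n(1) by (intro prod_pos) auto
  have Kcol: "of_nat K *\<^sub>R column i B \<in> L" if "i \<notin> I" for i
  proof -
    have "K = (\<Prod>j\<in>-I-{i}. n j) * n i" unfolding K_def using that by (subst prod.remove[of _ i]) auto
    then have "of_nat K *\<^sub>R column i B = of_nat (\<Prod>j\<in>-I-{i}. n j) *\<^sub>R (of_nat (n i) *\<^sub>R column i B)"
      by (simp del: of_nat_prod)
    then show ?thesis using add_subgroup_nat_scale[OF sL(1) n(2)[OF that]] by metis
  qed
  have K\<tau>: "of_nat K *\<^sub>R t \<in> L" if "t \<in> \<tau>" for t
  proof -
    obtain z where z: "t = B *v z" "z \<in> int_vectors" "\<And>i. i \<in> I \<Longrightarrow> z $ i = 0" using \<open>t \<in> \<tau>\<close> unfolding \<tau> by blast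
    have "of_nat K *\<^sub>R t = (\<Sum>i\<in>UNIV. z $ i *\<^sub>R (of_nat K *\<^sub>R column i B))"
      unfolding z(1) matrix_vector_mult_columns by (simp add: scaleR_sum_right mult.commute)
    also have "\<dots> \<in> L"
    proof (rule add_subgroup_sum[OF sL(1)])
      fix i
      obtain k where k: "z $ i = of_int k" using z(2) by (auto simp: int_vectors_def elim: Ints_cases)
      show "z $ i *\<^sub>R (of_nat K *\<^sub>R column i B) \<in> L"
      proof (cases "i \<in> I")
        case True then show ?thesis using z(3) add_subgroupD(1)[OF sL(1)] by simp
      next
        case False then show ?thesis unfolding k by (intro add_subgroup_int_scale sL(1) Kcol)
      qed
    qed
    finally show ?thesis .
  qed
  have "of_nat K *\<^sub>R x \<in> L" if xH: "x \<in> H" for x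
  proof -
    obtain l t where "x = l + t" "l \<in> L" "t \<in> \<tau>" using xH unfolding H_def by blast
    then show ?thesis using add_subgroupD(2)[OF sL(1) add_subgroup_nat_scale[OF sL(1)] K\<tau>]
      by (simp add: scaleR_add_right)
  qed
  then have dH: "discrete H" by (rule discrete_add_subgroup_multiple[OF sL(1,2) sH K0])
  have "span H = UNIV" using span_mono[OF LH] sL(3) by auto
  then have "euclidean_lattice H" using sH dH by (simp add: euclidean_lattice_iff)
  then obtain C where C: "invertible C" "H = matrix_lattice C" using euclidean_lattice_matrix by blast
  have fr: "(\<Sum>i\<in>I. of_int (z i) *\<^sub>R column i B) \<notin> H" if z: "\<exists>i\<in>I. z i \<noteq> 0" for z :: "'n \<Rightarrow> int"
  proof
    let ?s = "\<Sum>i\<in>I. of_int (z i) *\<^sub>R column i B"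
    let ?z = "(\<chi> i. if i \<in> I then of_int (z i) else 0) :: real ^ 'n"
    assume "?s \<in> H"
    then obtain l t where lt: "?s = l + t" "l \<in> L" "t \<in> \<tau>" unfolding H_def by blast
    have "?s = (\<Sum>i\<in>UNIV. ?z $ i *\<^sub>R column i B)" by (rule sum.mono_neutral_cong_left) auto
    then have s: "?s = B *v ?z" unfolding matrix_vector_mult_columns .
    have "?z \<in> int_vectors" by (auto simp: int_vectors_def)
    then have "?s \<in> M" unfolding s B(2) matrix_lattice_def by blast
    moreover have "l = ?s - t" using lt(1) by simp
    ultimately have "l \<in> M" using add_subgroupD(4)[OF sM] lt(3) \<tau>M by blast
    then have "l \<in> \<tau>" using lt(2) unfolding \<tau>_def by (auto intro!: exI[of _ 1])
    then have "?s \<in> \<tau>" using lt add_subgroupD(2)[OF s\<tau>] by simp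
    then obtain w where w: "B *v ?z = B *v w" "\<And>i. i \<in> I \<Longrightarrow> w $ i = 0" unfolding s \<tau> by blast
    have "?z = w" using w(1) inj_matrix_vector_mult[OF B(1)] by (rule injD[rotated])
    then have zw: "?z $ i = w $ i" for i by (rule arg_cong)
    have "of_int (z i) = w $ i" if "i \<in> I" for i using zw[of i] that by simp
    then show False using z w(2) by fastforce
  qed
  have HG: "H \<subseteq> {l + m | l m. l \<in> L \<and> m \<in> M}" unfolding H_def using \<tau>M by blast
  show thesis
    by (rule that[of B C I, OF B C(1)]) (use LH \<tau>H col\<tau> HG fr dH in \<open>auto simp: C(2)[symmetric]\<close>)
qed

theorem theorem1:
  fixes L M :: "(real ^ 'n) set"
  assumes "euclidean_lattice L"
    and "euclidean_lattice M"
    and "lattice_volume L = lattice_volume M"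
  shows "\<exists>\<Omega> :: (real ^ 'n) set.
    bounded \<Omega> \<and> \<Omega> \<in> sets lebesgue \<and> tiles_with \<Omega> L \<and> tiles_with \<Omega> M"
proof -
  obtain A where A: "invertible A" "L = matrix_lattice A" using euclidean_lattice_matrix[OF assms(1)] .
  obtain B C :: "real ^ 'n ^ 'n" and I where B: "invertible B" "M = matrix_lattice B" and C: "invertible C"
    "discrete (matrix_lattice C)" and sub: "L \<subseteq> matrix_lattice C" "\<And>i. i \<notin> I \<Longrightarrow> column i B \<in> matrix_lattice C"
    "matrix_lattice C \<subseteq> {l + m | l m. l \<in> L \<and> m \<in> M}"
    "\<And>z :: 'n \<Rightarrow> int. \<exists>i\<in>I. z i \<noteq> 0 \<Longrightarrow> (\<Sum>i\<in>I. of_int (z i) *\<^sub>R column i B) \<notin> matrix_lattice C"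
    using lattice_triple_exists[OF assms(1,2)] by blast
  have dets: "\<bar>det A\<bar> = \<bar>det B\<bar>"
    using assms(3) A B by (simp add: lattice_volume_matrix_lattice invertible_det_nz)
  obtain Ai Bi Ci where inv: "A ** Ai = mat 1" "Ai ** A = mat 1" "B ** Bi = mat 1" "Bi ** B = mat 1"
    "C ** Ci = mat 1" "Ci ** C = mat 1"
    using A(1) B(1) C(1) unfolding invertible_def by blast
  interpret lattice_triple A Ai B Bi C Ci I
  proof (unfold_locales)
    show "discrete (matrix_lattice A)" "discrete (matrix_lattice B)"
      using assms(1,2) unfolding A(2) B(2) euclidean_lattice_iff by blast+
  qed (use inv C(2) sub[unfolded A(2) B(2)] dets in blast)+
  show ?thesis using common_tile unfolding A(2) B(2) .
qed

end
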